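(* Let $G$ be a torsion-free group, let $(\{\alpha_g\}_{g\in G},\{D_g\}_{g\in G},\{w_{g,h}\}_{(g,h)\in G\times G})$ be a unital twisted partial action of $G$ on a unital ring $R$, and let $R\star_\alpha^w G$ be the associated unital partial crossed product. Then $R\star_\alpha^w G$ is prime if and only if $R$ is $G$-prime.
   Context: Rings are associative; a unital ring has a nonzero multiplicative identity; ideals are two-sided. For subsets $U,V$ of a ring, $UV$ denotes the set of finite sums of elements $uv$ with $u\in U$, $v\in V$. A ring $T$ is prime if $\{0\}$ is a proper ideal and for all ideals $A,B$ of $T$, $AB=\{0\}$ implies $A=\{0\}$ or $B=\{0\}$. A unital twisted partial action of a group $G$ (neutral element $e$) on a unital ring $R$ is a triple $(\{\alpha_g\}_{g\in G},\{D_g\}_{g\in G},\{w_{g,h}\}_{(g,h)\in G\times G})$ where for all $g,h\in G$, $D_g$ is an ideal of $R$ having a (not necessarily nonzero) multiplicative identity element $1_g\in Z(R)$, $\alpha_g:D_{g^{-1}}\to D_g$ is a ring isomorphism, and $w_{g,h}$ is an invertible element of $D_gD_{gh}$, such that for all $g,h,l\in G$: (UP1) $\alpha_e=\mathrm{id}_R$; (UP2) $\alpha_g(D_{g^{-1}}D_h)=D_gD_{gh}$; (UP3) if $r\in D_{h^{-1}}D_{(gh)^{-1}}$, then $\alpha_g(\alpha_h(r))=w_{g,h}\alpha_{gh}(r)w_{g,h}^{-1}$; (UP4) $w_{e,g}=w_{g,e}=1_g$; (UP5) if $r\in D_{g^{-1}}D_hD_{hl}$, then $\alpha_g(rw_{h,l})w_{g,hl}=\alpha_g(r)w_{g,h}w_{gh,l}$.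 The unital partial crossed product is $R\star_\alpha^wG:=\bigoplus_{g\in G}D_g\delta_g$, where the $\delta_g$ are formal symbols, with multiplication determined by $(r\delta_g)(r'\delta_h)=r\alpha_g(r'1_{g^{-1}})w_{g,h}\delta_{gh}$ for $r\in D_g$, $r'\in D_h$; it is an associative ring. An ideal $I$ of $R$ is $G$-invariant if $\alpha_g(I1_{g^{-1}})\subseteq I$ for every $g\in G$. $R$ is $G$-prime if for all $G$-invariant ideals $I,J$ of $R$, $IJ=\{0\}$ implies $I=\{0\}$ or $J=\{0\}$. *)

theory Defs
  imports "HOL-Algebra.Ideal_Product" "HOL-Algebra.QuotRing"
begin

definition torsion_free_group :: "('g, 'c) monoid_scheme \<Rightarrow> bool" where
  "torsion_free_group G \<longleftrightarrow> group G \<and>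
     (\<forall>g \<in> carrier G. \<forall>n::nat. 0 < n \<and> g [^]\<^bsub>G\<^esub> n = \<one>\<^bsub>G\<^esub> \<longrightarrow> g = \<one>\<^bsub>G\<^esub>)"

text \<open>Properness of the zero ideal only says that \<open>T\<close> is not the zero ring.\<close>

definition prime_ring :: "('a, 'b) ring_scheme \<Rightarrow> bool" where
  "prime_ring T \<longleftrightarrow> ring T \<and> {\<zero>\<^bsub>T\<^esub>} \<noteq> carrier T \<and>
     (\<forall>A B. ideal A T \<and> ideal B T \<and> A \<cdot>\<^bsub>T\<^esub> B = {\<zero>\<^bsub>T\<^esub>} \<longrightarrow> A = {\<zero>\<^bsub>T\<^esub>} \<or> B = {\<zero>\<^bsub>T\<^esub>})"

definition is_identity_of :: "('a, 'b) ring_scheme \<Rightarrow> 'a set \<Rightarrow> 'a \<Rightarrow> bool" where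
  "is_identity_of R I u \<longleftrightarrow> u \<in> I \<and> (\<forall>r \<in> I. u \<otimes>\<^bsub>R\<^esub> r = r \<and> r \<otimes>\<^bsub>R\<^esub> u = r)"

definition identity_of :: "('a, 'b) ring_scheme \<Rightarrow> 'a set \<Rightarrow> 'a" where
  "identity_of R I = (THE u. is_identity_of R I u)"

text \<open>An ideal with an identity element, regarded as a unital ring in its own right.
  It is only used for ideals satisfying \<open>\<exists>u. is_identity_of R I u\<close>.\<close>

definition ideal_ring :: "('a, 'b) ring_scheme \<Rightarrow> 'a set \<Rightarrow> ('a, 'b) ring_scheme" where
  "ideal_ring R I = R\<lparr>carrier := I, one := identity_of R I\<rparr>"

text \<open>The maps \<open>\<alpha> g\<close> are total HOL functions of which only the restriction to
  \<open>D (inv g)\<close> is relevant; therefore the equation \<open>\<alpha>\<^sub>e = id\<^sub>R\<close> has to include \<open>D\<^sub>e = R\<close>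
  explicitly.\<close>

locale unital_twisted_partial_action = group G + R: ring R
  for G :: "('g, 'c) monoid_scheme" (structure)
    and R :: "('a, 'b) ring_scheme" +
  fixes \<alpha> :: "'g \<Rightarrow> 'a \<Rightarrow> 'a"
    and D :: "'g \<Rightarrow> 'a set"
    and w :: "'g \<Rightarrow> 'g \<Rightarrow> 'a"
  assumes one_not_zero: "\<one>\<^bsub>R\<^esub> \<noteq> \<zero>\<^bsub>R\<^esub>"
    and D_ideal: "g \<in> carrier G \<Longrightarrow> ideal (D g) R"
    and D_identity: "g \<in> carrier G \<Longrightarrow>
      \<exists>u. is_identity_of R (D g) u \<and> (\<forall>r \<in> carrier R. u \<otimes>\<^bsub>R\<^esub> r = r \<otimes>\<^bsub>R\<^esub> u)"
    and alpha_iso: "g \<in> carrier G \<Longrightarrow>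
      \<alpha> g \<in> ring_iso (ideal_ring R (D (inv g))) (ideal_ring R (D g))"
    and w_unit: "\<lbrakk>g \<in> carrier G; h \<in> carrier G\<rbrakk> \<Longrightarrow>
      w g h \<in> Units (ideal_ring R (D g \<cdot>\<^bsub>R\<^esub> D (g \<otimes> h)))"
    and UP1: "D \<one> = carrier R \<and> (\<forall>r \<in> carrier R. \<alpha> \<one> r = r)"
    and UP2: "\<lbrakk>g \<in> carrier G; h \<in> carrier G\<rbrakk> \<Longrightarrow>
      \<alpha> g ` (D (inv g) \<cdot>\<^bsub>R\<^esub> D h) = D g \<cdot>\<^bsub>R\<^esub> D (g \<otimes> h)"
    and UP3: "\<lbrakk>g \<in> carrier G; h \<in> carrier G;
        r \<in> D (inv h) \<cdot>\<^bsub>R\<^esub> D (inv (g \<otimes> h))\<rbrakk> \<Longrightarrow>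
      \<alpha> g (\<alpha> h r) = w g h \<otimes>\<^bsub>R\<^esub> \<alpha> (g \<otimes> h) r
        \<otimes>\<^bsub>R\<^esub> inv\<^bsub>ideal_ring R (D g \<cdot>\<^bsub>R\<^esub> D (g \<otimes> h))\<^esub> (w g h)"
    and UP4: "g \<in> carrier G \<Longrightarrow>
      w \<one> g = identity_of R (D g) \<and> w g \<one> = identity_of R (D g)"
    and UP5: "\<lbrakk>g \<in> carrier G; h \<in> carrier G; l \<in> carrier G;
        r \<in> D (inv g) \<cdot>\<^bsub>R\<^esub> D h \<cdot>\<^bsub>R\<^esub> D (h \<otimes> l)\<rbrakk> \<Longrightarrow>
      \<alpha> g (r \<otimes>\<^bsub>R\<^esub> w h l) \<otimes>\<^bsub>R\<^esub> w g (h \<otimes> l)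
        = \<alpha> g r \<otimes>\<^bsub>R\<^esub> w g h \<otimes>\<^bsub>R\<^esub> w (g \<otimes> h) l"

definition coeff_support ::
    "('g, 'c) monoid_scheme \<Rightarrow> ('a, 'b) ring_scheme \<Rightarrow> ('g \<Rightarrow> 'a) \<Rightarrow> 'g set" where
  "coeff_support G R x = {g \<in> carrier G. x g \<noteq> \<zero>\<^bsub>R\<^esub>}"

text \<open>The formal sum \<open>\<Sum>g. r\<^sub>g \<delta>\<^sub>g\<close> is represented by its finitely supported coefficient
  family, which is \<^const>\<open>undefined\<close> outside \<^term>\<open>carrier G\<close>. The product is the biadditive extension of
  \<open>(r \<delta>\<^sub>g) (r' \<delta>\<^sub>h) = r \<alpha>\<^sub>g(r' 1\<^bsub>g\<inverse>\<^esub>) w\<^bsub>g,h\<^esub> \<delta>\<^bsub>gh\<^esub>\<close>.\<close>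

definition partial_crossed_product ::
    "('g, 'c) monoid_scheme \<Rightarrow> ('a, 'b) ring_scheme \<Rightarrow> ('g \<Rightarrow> 'a \<Rightarrow> 'a) \<Rightarrow>
     ('g \<Rightarrow> 'a set) \<Rightarrow> ('g \<Rightarrow> 'g \<Rightarrow> 'a) \<Rightarrow> ('g \<Rightarrow> 'a) ring" where
  "partial_crossed_product G R \<alpha> D w =
    \<lparr>carrier = {x \<in> \<Pi>\<^sub>E g \<in> carrier G. D g. finite (coeff_support G R x)},
     mult = (\<lambda>x y. \<lambda>k \<in> carrier G.
       finsum R
         (\<lambda>(g, h). x g \<otimes>\<^bsub>R\<^esub> \<alpha> g (y h \<otimes>\<^bsub>R\<^esub> identity_of R (D (inv\<^bsub>G\<^esub> g))) \<otimes>\<^bsub>R\<^esub> w g h)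
         {(g, h) \<in> coeff_support G R x \<times> coeff_support G R y. g \<otimes>\<^bsub>G\<^esub> h = k}),
     one = (\<lambda>g \<in> carrier G. if g = \<one>\<^bsub>G\<^esub> then \<one>\<^bsub>R\<^esub> else \<zero>\<^bsub>R\<^esub>),
     zero = (\<lambda>g \<in> carrier G. \<zero>\<^bsub>R\<^esub>),
     add = (\<lambda>x y. \<lambda>g \<in> carrier G. x g \<oplus>\<^bsub>R\<^esub> y g)\<rparr>"

definition G_invariant ::
    "('g, 'c) monoid_scheme \<Rightarrow> ('a, 'b) ring_scheme \<Rightarrow> ('g \<Rightarrow> 'a \<Rightarrow> 'a) \<Rightarrow>
     ('g \<Rightarrow> 'a set) \<Rightarrow> 'a set \<Rightarrow> bool" where
  "G_invariant G R \<alpha> D I \<longleftrightarrow>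
     (\<forall>g \<in> carrier G. \<alpha> g ` (I \<cdot>\<^bsub>R\<^esub> {identity_of R (D (inv\<^bsub>G\<^esub> g))}) \<subseteq> I)"

definition G_prime ::
    "('g, 'c) monoid_scheme \<Rightarrow> ('a, 'b) ring_scheme \<Rightarrow> ('g \<Rightarrow> 'a \<Rightarrow> 'a) \<Rightarrow>
     ('g \<Rightarrow> 'a set) \<Rightarrow> bool" where
  "G_prime G R \<alpha> D \<longleftrightarrow>
     (\<forall>I J. ideal I R \<and> G_invariant G R \<alpha> D I \<and> ideal J R \<and> G_invariant G R \<alpha> D J \<and>
        I \<cdot>\<^bsub>R\<^esub> J = {\<zero>\<^bsub>R\<^esub>} \<longrightarrow> I = {\<zero>\<^bsub>R\<^esub>} \<or> J = {\<zero>\<^bsub>R\<^esub>})"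

end

theory Submission
  imports Defs
begin

text \<open>
  If \<open>I\<close>, \<open>J\<close> are nonzero \<open>G\<close>-invariant ideals of \<open>R\<close> with \<open>IJ = 0\<close>, then the elements of the crossed
  product with all coefficients in \<open>I\<close>, respectively in \<open>J\<close>, form nonzero ideals with product zero.

  The converse is Passman's \<open>\<Delta>\<close>-method. The crossed product is a \<open>G\<close>-graded ring \<open>S\<close> in which
  \<open>S\<^sub>g S\<^bsub>g\<inverse>\<^esub>\<close> is a unital ideal of \<open>R = S\<^sub>1\<close>, and \<open>G\<close>-primeness says that \<open>I S J \<noteq> 0\<close> for nonzero
  ideals \<open>I\<close>, \<open>J\<close> of \<open>R\<close>. Let \<open>A\<close>, \<open>B\<close> be nonzero ideals of \<open>S\<close> with \<open>AB = 0\<close>, and let \<open>X\<close>, \<open>Y\<close> be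
  supports of minimal size of nonzero elements of \<open>A\<close>, \<open>B\<close>, shifted so as to contain \<open>1\<close>. A nonzero
  ideal \<open>I\<close> of \<open>R\<close> consists of coefficients at \<open>1\<close> of elements of both \<open>A\<close> and \<open>B\<close> with these supports.
  Among the pairs of a subgroup \<open>H\<close> and a nonzero ideal \<open>K \<subseteq> I\<close> such that \<open>K S\<^sub>h K \<noteq> 0\<close> only for
  \<open>h \<in> H\<close>, choose one for which as many elements of \<open>Y\<close> as possible have a finite orbit under conjugation
  by \<open>H\<close>. Minimality of the supports gives \<open>X, Y \<subseteq> H\<close>. The elements of \<open>H\<close> with finite \<open>H\<close>-orbit form
  a torsion-free FC group, which is abelian and orderable; so some product \<open>x\<^sub>0 y\<^sub>0\<close> of such elements of
  \<open>X\<close> and \<open>Y\<close> is attained only once. If \<open>k\<close> centralizes the finite orbit part of \<open>Y\<close> and avoids finitely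
  many cosets of centralizers of the remaining elements of \<open>Y\<close>, then the coefficient of \<open>a s b\<close> at
  \<open>x\<^sub>0 k y\<^sub>0\<close> is a single product, and minimality of the supports yields \<open>K S\<^sub>k K = 0\<close>. By the
  maximality of \<open>(H, K)\<close>, no nonzero ideal \<open>M \<subseteq> K\<close> satisfies \<open>M S\<^sub>h M = 0\<close> for all \<open>h\<close> outside finitely
  many such cosets, and a pigeonhole argument produces a \<open>k\<close> as above with \<open>K S\<^sub>k K \<noteq> 0\<close>.
\<close>

section \<open>Torsion-free groups\<close>

lemma (in group) mult_inv_cancel:
  "\<lbrakk>x \<in> carrier G; y \<in> carrier G\<rbrakk> \<Longrightarrow> inv x \<otimes> (x \<otimes> y) = y"
  "\<lbrakk>x \<in> carrier G; y \<in> carrier G\<rbrakk> \<Longrightarrow> x \<otimes> (inv x \<otimes> y) = y"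
  by (simp_all flip: m_assoc)

lemma (in group) conj_mult:
  "\<lbrakk>p \<in> carrier G; q \<in> carrier G; x \<in> carrier G\<rbrakk> \<Longrightarrow>
    (p \<otimes> q) \<otimes> x \<otimes> inv (p \<otimes> q) = p \<otimes> (q \<otimes> x \<otimes> inv q) \<otimes> inv p"
  by (simp add: m_assoc inv_mult_group)

lemma (in group) conj_cancel:
  "\<lbrakk>p \<in> carrier G; x \<in> carrier G; y \<in> carrier G\<rbrakk> \<Longrightarrow>
    p \<otimes> x \<otimes> inv p = p \<otimes> y \<otimes> inv p \<longleftrightarrow> x = y"
  by simp

text \<open>Two elements conjugate \<open>x\<close> alike exactly when they lie in the same left
  coset of its centralizer; cosets are handled below through such equations.\<close>

lemma (in group) conj_eq_iff:
  "\<lbrakk>p \<in> carrier G; q \<in> carrier G; x \<in> carrier G\<rbrakk> \<Longrightarrow>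
    p \<otimes> x \<otimes> inv p = q \<otimes> x \<otimes> inv q \<longleftrightarrow> (inv q \<otimes> p) \<otimes> x = x \<otimes> (inv q \<otimes> p)"
proof -
  assume c: "p \<in> carrier G" "q \<in> carrier G" "x \<in> carrier G"
  have "p \<otimes> x \<otimes> inv p = q \<otimes> x \<otimes> inv q \<longleftrightarrow>
      inv q \<otimes> (p \<otimes> x \<otimes> inv p) \<otimes> p = inv q \<otimes> (q \<otimes> x \<otimes> inv q) \<otimes> p"
    using c by simp
  also have "inv q \<otimes> (p \<otimes> x \<otimes> inv p) \<otimes> p = (inv q \<otimes> p) \<otimes> x"
    using c by (simp add: m_assoc)
  also have "inv q \<otimes> (q \<otimes> x \<otimes> inv q) \<otimes> p = x \<otimes> (inv q \<otimes> p)"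
    using c by (simp add: m_assoc inv_solve_left')
  finally show ?thesis .
qed

definition centralizer_of :: "('g, 'c) monoid_scheme \<Rightarrow> 'g set \<Rightarrow> 'g set" where
  "centralizer_of G A = {g \<in> carrier G. \<forall>a \<in> A. g \<otimes>\<^bsub>G\<^esub> a = a \<otimes>\<^bsub>G\<^esub> g}"

lemma (in group) subgroup_centralizer_of:
  assumes "A \<subseteq> carrier G"
  shows "subgroup (centralizer_of G A) G"
proof
  show "centralizer_of G A \<subseteq> carrier G" "\<one> \<in> centralizer_of G A"
    using assms by (auto simp: centralizer_of_def)
next
  fix x y assume xy: "x \<in> centralizer_of G A" "y \<in> centralizer_of G A"
  have "x \<otimes> y \<otimes> a = a \<otimes> (x \<otimes> y)" if "a \<in> A" for a
  proof -
    have c: "a \<in> carrier G" "x \<in> carrier G" "y \<in> carrier G" "x \<otimes> a = a \<otimes> x" "y \<otimes> a = a \<otimes> y"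
      using that assms xy by (auto simp: centralizer_of_def)
    have "x \<otimes> y \<otimes> a = x \<otimes> (a \<otimes> y)" using c(1-3) by (simp add: m_assoc c(5))
    also have "\<dots> = x \<otimes> a \<otimes> y" using c(1-3) by (simp add: m_assoc)
    also have "\<dots> = a \<otimes> x \<otimes> y" by (simp add: c(4))
    finally have "x \<otimes> y \<otimes> a = a \<otimes> (x \<otimes> y)" using c(1-3) by (simp add: m_assoc)
    then show ?thesis .
  qed
  then show "x \<otimes> y \<in> centralizer_of G A"
    using xy by (auto simp: centralizer_of_def)
next
  fix x assume x: "x \<in> centralizer_of G A"
  have "inv x \<otimes> a = a \<otimes> inv x" if "a \<in> A" for a
  proof -
    have c: "a \<in> carrier G" "x \<in> carrier G" "x \<otimes> a = a \<otimes> x"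
      using that assms x by (auto simp: centralizer_of_def)
    have "inv x \<otimes> a = inv x \<otimes> (a \<otimes> x) \<otimes> inv x" using c(1,2) by (simp add: m_assoc)
    also have "\<dots> = inv x \<otimes> (x \<otimes> a) \<otimes> inv x" by (simp add: c(3))
    also have "\<dots> = a \<otimes> inv x" using c(1,2) by (simp add: mult_inv_cancel)
    finally show ?thesis .
  qed
  then show "inv x \<in> centralizer_of G A"
    using x by (auto simp: centralizer_of_def)
qed

section \<open>Groups with finite conjugacy classes, and orders on torsion-free abelian
  groups\<close>

definition torsion_free :: "('g, 'c) monoid_scheme \<Rightarrow> bool" where
  "torsion_free G \<longleftrightarrow>
     (\<forall>g \<in> carrier G. \<forall>n::nat. 0 < n \<and> g [^]\<^bsub>G\<^esub> n = \<one>\<^bsub>G\<^esub> \<longrightarrow> g = \<one>\<^bsub>G\<^esub>)"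

text \<open>The transfer homomorphism \<open>V\<close> into a central subgroup \<open>Z\<close> of finite index is the
  \<open>|\<Omega>|\<close>-th power map on \<open>Z\<close>; hence it is injective when there is no torsion, and
  the group embeds into an abelian one.\<close>

lemma (in group) torsion_free_FC_commute:
  assumes tf: "torsion_free G"
    and fin: "\<And>x. x \<in> carrier G \<Longrightarrow> finite ((\<lambda>p. p \<otimes> x \<otimes> inv p) ` carrier G)"
    and x: "x \<in> carrier G" and y: "y \<in> carrier G"
  shows "x \<otimes> y = y \<otimes> x"
proof -
  \<comment> \<open>Both \<open>x\<close> and \<open>y\<close> have finitely many conjugates, so
    their common centralizer \<open>C\<close> has finite index. The centralizer \<open>P\<close> of
    \<open>C\<close> contains \<open>x\<close> and \<open>y\<close>, and \<open>Z\<close> is central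
    in \<open>P\<close>; the transfer is taken from \<open>P\<close> to \<open>Z\<close>.\<close>
  define C where "C = centralizer_of G {x, y}"
  define P where "P = centralizer_of G C"
  define Z where "Z = P \<inter> C"
  have subC: "subgroup C G" unfolding C_def using x y by (intro subgroup_centralizer_of) auto
  have CG: "C \<subseteq> carrier G" using subC by (rule subgroup.subset)
  have subP: "subgroup P G" unfolding P_def using CG by (rule subgroup_centralizer_of)
  have PG: "\<And>p. p \<in> P \<Longrightarrow> p \<in> carrier G" using subP by (rule subgroup.mem_carrier)
  have subZ: "subgroup Z G" unfolding Z_def using subP subC by (rule subgroups_Inter_pair)
  have xP: "x \<in> P" and yP: "y \<in> P"
    using x y by (auto simp: P_def C_def centralizer_of_def)
  have ZP: "Z \<subseteq> P" by (simp add: Z_def)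
  have cen: "p \<otimes> z = z \<otimes> p" if "p \<in> P" "z \<in> Z" for p z
    using that by (auto simp: Z_def P_def centralizer_of_def)
  interpret ZG: comm_group "G\<lparr>carrier := Z\<rparr>"
    using subgroup_imp_group[OF subZ] cen ZP by (intro group.group_comm_groupI) auto
  \<comment> \<open>An element of \<open>P\<close> lies in \<open>Z\<close> exactly when it commutes
    with \<open>x\<close> and \<open>y\<close>. Hence \<open>\<kappa> p\<close> encodes the left
    coset of \<open>Z\<close> containing \<open>p\<close>, and the finite set
    \<open>\<Omega>\<close> stands for the coset space.\<close>
  define \<kappa> where "\<kappa> p = (p \<otimes> x \<otimes> inv p, p \<otimes> y \<otimes> inv p)" for p
  define \<Omega> where "\<Omega> = \<kappa> ` P"
  define s where "s = inv_into P \<kappa>"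
  define act where "act g t = \<kappa> (g \<otimes> s t)" for g t
  \<comment> \<open>The transfer cocycle compares \<open>g\<close> times a coset representative with
    the representative of the resulting coset; \<open>V\<close> multiplies these elements of
    \<open>Z\<close> over all cosets.\<close>
  define c where "c g t = inv (s (act g t)) \<otimes> (g \<otimes> s t)" for g t
  define V where "V g = finprod (G\<lparr>carrier := Z\<rparr>) (c g) \<Omega>" for g
  have fin\<Omega>: "finite \<Omega>"
  proof (rule finite_subset)
    show "\<Omega> \<subseteq> (\<lambda>p. p \<otimes> x \<otimes> inv p) ` carrier G \<times> (\<lambda>p. p \<otimes> y \<otimes> inv p) ` carrier G"
      using PG by (auto simp: \<Omega>_def \<kappa>_def)
  qed (simp add: fin x y)
  have sP: "s t \<in> P" and \<kappa>s: "\<kappa> (s t) = t" if "t \<in> \<Omega>" for t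
    using that unfolding s_def \<Omega>_def by (auto intro: inv_into_into f_inv_into_f)
  have \<kappa>\<Omega>: "p \<in> P \<Longrightarrow> \<kappa> p \<in> \<Omega>" for p by (simp add: \<Omega>_def)
  have Pm: "p \<in> P \<Longrightarrow> q \<in> P \<Longrightarrow> p \<otimes> q \<in> P" and Pinv: "p \<in> P \<Longrightarrow> inv p \<in> P" for p q
    using subP by (auto intro: subgroup.m_closed subgroup.m_inv_closed)
  have \<kappa>eq: "\<kappa> p = \<kappa> q \<longleftrightarrow> inv q \<otimes> p \<in> Z" if "p \<in> P" "q \<in> P" for p q
    using that x y PG Pm Pinv conj_eq_iff[of p q x] conj_eq_iff[of p q y]
    by (auto simp: \<kappa>_def Z_def C_def centralizer_of_def)
  have \<kappa>mult: "\<kappa> (g \<otimes> p) = \<kappa> (g \<otimes> q) \<longleftrightarrow> \<kappa> p = \<kappa> q" if "p \<in> P" "q \<in> P" "g \<in> P" for g p q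
    using that x y PG by (simp add: \<kappa>_def conj_mult)
  have act\<Omega>: "act g t \<in> \<Omega>" if "g \<in> P" "t \<in> \<Omega>" for g t
    using that by (simp add: act_def \<kappa>\<Omega> Pm sP)
  have actm: "act (g \<otimes> h) t = act g (act h t)" if "g \<in> P" "h \<in> P" "t \<in> \<Omega>" for g h t
  proof -
    have "act g (act h t) = \<kappa> (g \<otimes> (h \<otimes> s t))"
      unfolding act_def using that by (subst \<kappa>mult) (auto simp: sP Pm \<kappa>\<Omega> \<kappa>s)
    then show ?thesis using that sP PG by (simp add: act_def m_assoc)
  qed
  have cZ: "c g t \<in> Z" if "g \<in> P" "t \<in> \<Omega>" for g t
    unfolding c_def using that
    by (subst \<kappa>eq[symmetric]) (auto simp: sP Pm act\<Omega> \<kappa>s, simp add: act_def)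
  have bij: "act h ` \<Omega> = \<Omega>" and inj: "inj_on (act h) \<Omega>" if h: "h \<in> P" for h
  proof -
    show "inj_on (act h) \<Omega>"
    proof (rule inj_onI)
      fix t t' assume t: "t \<in> \<Omega>" "t' \<in> \<Omega>" "act h t = act h t'"
      then have "\<kappa> (s t) = \<kappa> (s t')"
        using h \<kappa>mult[OF sP sP h] by (simp add: act_def)
      then show "t = t'" using t by (simp add: \<kappa>s)
    qed
    then show "act h ` \<Omega> = \<Omega>"
      using fin\<Omega> act\<Omega> h by (intro endo_inj_surj) auto
  qed
  have Vm: "V (g \<otimes> h) = V g \<otimes> V h" if g: "g \<in> P" and h: "h \<in> P" for g h
  proof -
    have "V (g \<otimes> h) = finprod (G\<lparr>carrier := Z\<rparr>) (\<lambda>t. c g (act h t) \<otimes>\<^bsub>G\<lparr>carrier := Z\<rparr>\<^esub> c h t) \<Omega>"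
      unfolding V_def
    proof (rule ZG.finprod_cong')
      show "(\<lambda>t. c g (act h t) \<otimes>\<^bsub>G\<lparr>carrier := Z\<rparr>\<^esub> c h t) \<in> \<Omega> \<rightarrow> carrier (G\<lparr>carrier := Z\<rparr>)"
        using g h cZ act\<Omega> ZG.m_closed by auto
      fix t assume t: "t \<in> \<Omega>"
      have "s (act h t) \<in> carrier G" "s (act g (act h t)) \<in> carrier G" "s t \<in> carrier G"
        "g \<in> carrier G" "h \<in> carrier G"
        using t g h by (auto simp: PG sP act\<Omega>)
      then show "c (g \<otimes> h) t = c g (act h t) \<otimes>\<^bsub>G\<lparr>carrier := Z\<rparr>\<^esub> c h t"
        using t g h
        by (simp add: c_def actm m_assoc) (simp flip: m_assoc)
    qed simp
    also have "\<dots> = finprod (G\<lparr>carrier := Z\<rparr>) (\<lambda>t. c g (act h t)) \<Omega> \<otimes> V h"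
      unfolding V_def using g h cZ act\<Omega> by (subst ZG.finprod_multf) auto
    also have "finprod (G\<lparr>carrier := Z\<rparr>) (\<lambda>t. c g (act h t)) \<Omega> = finprod (G\<lparr>carrier := Z\<rparr>) (c g) (act h ` \<Omega>)"
      using g h cZ bij inj by (subst ZG.finprod_reindex) auto
    finally show ?thesis using bij[OF h] by (simp add: V_def)
  qed
  have VZ: "V g \<in> Z" if "g \<in> P" for g
    unfolding V_def using ZG.finprod_closed[of "c g" \<Omega>] cZ that by auto
  have Vz: "V z = z [^] card \<Omega>" if z: "z \<in> Z" for z
  proof -
    have zP: "z \<in> P" using z ZP by auto
    \<comment> \<open>A central element fixes every coset, so each factor of its transfer is the
      element itself.\<close>
    have "c z t = z" if t: "t \<in> \<Omega>" for t
    proof -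
      have "act z t = t"
      proof -
        have "\<kappa> (z \<otimes> s t) = \<kappa> (s t \<otimes> z)" using cen[of "s t" z] z sP t by simp
        also have "\<dots> = \<kappa> (s t)"
          using \<kappa>eq[of "s t \<otimes> z" "s t"] sP[OF t] zP z PG by (simp add: Pm flip: m_assoc)
        finally show ?thesis using t by (simp add: act_def \<kappa>s)
      qed
      moreover have "z \<otimes> s t = s t \<otimes> z" using cen[of "s t" z] z sP t by simp
      ultimately show ?thesis
        using PG[OF sP[OF t]] PG[OF zP] by (simp add: c_def flip: m_assoc)
    qed
    then have "V z = finprod (G\<lparr>carrier := Z\<rparr>) (\<lambda>t. z) \<Omega>"
      unfolding V_def using z by (intro ZG.finprod_cong') auto
    also have "\<dots> = z [^]\<^bsub>G\<lparr>carrier := Z\<rparr>\<^esub> card \<Omega>"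
      using z by (intro ZG.finprod_const) auto
    finally show ?thesis by (simp add: nat_pow_consistent[symmetric])
  qed
  have one\<Omega>: "card \<Omega> > 0"
    using fin\<Omega> xP by (auto simp: card_gt_0_iff \<Omega>_def)
  \<comment> \<open>The transfer kills the commutator \<open>k\<close>. Two powers of
    \<open>k\<close> lie in the same coset of \<open>Z\<close>, so some power with positive exponent
    is in \<open>Z\<close>, where the transfer raises to the power \<open>card \<Omega>\<close>.
    Hence \<open>k\<close> has finite order.\<close>
  define k where "k = inv x \<otimes> inv y \<otimes> x \<otimes> y"
  have kP: "k \<in> P" unfolding k_def by (intro Pm Pinv xP yP)
  have kpP: "k [^] (n::nat) \<in> P" for n
    using kP subP by (induction n) (auto simp: Pm subgroup.one_closed)
  have V1: "V \<one> = \<one>"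
    using Vz[of \<one>] subgroup.one_closed[OF subZ] by simp
  have Vc: "V g \<otimes> V h = V h \<otimes> V g" if "g \<in> P" "h \<in> P" for g h
    using cen[of "V g" "V h"] VZ that ZP by blast
  have "V k = \<one>"
  proof -
    have cx: "V x \<in> carrier G" "V y \<in> carrier G" "V (inv x) \<in> carrier G" "V (inv y) \<in> carrier G"
      using VZ xP yP Pinv ZP PG by blast+
    have "V k = V (inv x) \<otimes> V (inv y) \<otimes> V x \<otimes> V y"
      by (simp add: k_def Vm Pm Pinv xP yP)
    also have "\<dots> = V (inv x) \<otimes> (V x \<otimes> V (inv y)) \<otimes> V y"
      using cx Vc[of "inv y" x] by (simp add: m_assoc Pinv xP yP)
    also have "\<dots> = V (inv x \<otimes> x) \<otimes> V (inv y \<otimes> y)"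
      using cx by (simp add: m_assoc Vm Pinv xP yP)
    finally show ?thesis by (simp add: V1 x y)
  qed
  then have Vkn: "V (k [^] (n::nat)) = \<one>" for n
    by (induction n) (auto simp: V1 Vm kpP kP)
  have "\<not> inj_on (\<lambda>n::nat. \<kappa> (k [^] n)) UNIV"
    using fin\<Omega> kpP \<kappa>\<Omega> by (intro notI) (metis finite_imageD finite_subset image_subsetI infinite_UNIV_nat)
  then obtain i j :: nat where ij: "i < j" "\<kappa> (k [^] i) = \<kappa> (k [^] j)"
    unfolding inj_on_def by (metis linorder_neqE_nat)
  have "inv (k [^] i) \<otimes> k [^] j = k [^] (j - i)"
    using ij(1) PG[OF kP] by (metis inv_solve_left' le_add_diff_inverse less_imp_le nat_pow_closed nat_pow_mult)
  then have "k [^] (j - i) \<in> Z"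
    using \<kappa>eq[of "k [^] j" "k [^] i"] ij kpP by simp
  then have "(k [^] (j - i)) [^] card \<Omega> = \<one>"
    using Vz Vkn by metis
  then have "k [^] ((j - i) * card \<Omega>) = \<one>"
    by (simp add: nat_pow_pow PG[OF kP])
  then have "k = \<one>"
    using tf[unfolded torsion_free_def, rule_format, OF PG[OF kP], of "(j - i) * card \<Omega>"] ij one\<Omega>
    by simp
  then have "y \<otimes> x \<otimes> k = y \<otimes> x" using x y by simp
  moreover have "y \<otimes> x \<otimes> k = x \<otimes> y"
    using x y by (simp add: k_def m_assoc) (simp flip: m_assoc)
  ultimately show ?thesis by simp
qed

text \<open>A maximal cone of a torsion-free abelian group is the set of nonnegative elements of a
  total order; the product of the two maxima is then attained only once.\<close>

lemma (in comm_group) torsion_free_total_cone: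
  assumes tf: "torsion_free G"
  obtains P where "P \<subseteq> carrier G" "\<one> \<in> P" "\<And>a b. a \<in> P \<Longrightarrow> b \<in> P \<Longrightarrow> a \<otimes> b \<in> P"
    "\<And>a. a \<in> P \<Longrightarrow> inv a \<in> P \<Longrightarrow> a = \<one>" "\<And>a. a \<in> carrier G \<Longrightarrow> a \<in> P \<or> inv a \<in> P"
proof -
  define cone where "cone P \<longleftrightarrow> P \<subseteq> carrier G \<and> \<one> \<in> P \<and> (\<forall>a \<in> P. \<forall>b \<in> P. a \<otimes> b \<in> P) \<and>
    (\<forall>a \<in> P. inv a \<in> P \<longrightarrow> a = \<one>)" for P
  have "\<exists>M \<in> {P. cone P}. \<forall>X \<in> {P. cone P}. M \<subseteq> X \<longrightarrow> X = M"
  proof (rule subset_Zorn_nonempty)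
    have "cone {\<one>}" by (auto simp: cone_def)
    then show "{P. cone P} \<noteq> {}" by auto
  next
    fix \<C> assume ne: "\<C> \<noteq> {}" and ch: "subset.chain {P. cone P} \<C>"
    have el: "cone P" if "P \<in> \<C>" for P using ch that by (auto simp: subset.chain_def)
    have two: "\<exists>P \<in> \<C>. a \<in> P \<and> b \<in> P" if ab: "a \<in> \<Union>\<C>" "b \<in> \<Union>\<C>" for a b
    proof -
      obtain A B where AB: "A \<in> \<C>" "a \<in> A" "B \<in> \<C>" "b \<in> B" using ab by auto
      then have "A \<subseteq> B \<or> B \<subseteq> A" using ch unfolding subset_chain_def by blast
      then show ?thesis using AB by blast
    qed
    have "cone (\<Union>\<C>)"
      unfolding cone_def
    proof (intro conjI ballI impI)
      show "\<Union>\<C> \<subseteq> carrier G" using el unfolding cone_def by blast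
      show "\<one> \<in> \<Union>\<C>" using el ne by (auto simp: cone_def)
    next
      fix a b assume "a \<in> \<Union>\<C>" "b \<in> \<Union>\<C>"
      then obtain P where P: "P \<in> \<C>" "a \<in> P" "b \<in> P" using two by blast
      then have "a \<otimes> b \<in> P" using el[of P] by (simp add: cone_def)
      then show "a \<otimes> b \<in> \<Union>\<C>" using P by blast
    next
      fix a assume "a \<in> \<Union>\<C>" "inv a \<in> \<Union>\<C>"
      then obtain P where P: "P \<in> \<C>" "a \<in> P" "inv a \<in> P" using two by blast
      then show "a = \<one>" using el[of P] by (simp add: cone_def)
    qed
    then show "\<Union>\<C> \<in> {P. cone P}" by simp
  qed
  then obtain P where P: "cone P" and max: "\<And>X. cone X \<Longrightarrow> P \<subseteq> X \<Longrightarrow> X = P" by auto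
  have PG: "a \<in> P \<Longrightarrow> a \<in> carrier G" and P1: "\<one> \<in> P"
    and Pm: "a \<in> P \<Longrightarrow> b \<in> P \<Longrightarrow> a \<otimes> b \<in> P"
    and Pa: "a \<in> P \<Longrightarrow> inv a \<in> P \<Longrightarrow> a = \<one>" for a b
    using P by (auto simp: cone_def)
  have Ppow: "a \<in> P \<Longrightarrow> a [^] (n::nat) \<in> P" for a n
    by (induction n) (auto simp: P1 Pm)
  \<comment> \<open>Were there no such \<open>n\<close>, adjoining the powers of \<open>g\<close> to
    \<open>P\<close> would give a larger cone: if \<open>x\<close> and \<open>inv x\<close> both lie
    in \<open>X\<close>, then the exponents of \<open>g\<close> in them must be zero.\<close>
  have ext: "\<exists>n::nat. 0 < n \<and> inv (g [^] n) \<in> P" if g: "g \<in> carrier G" "g \<notin> P" for g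
  proof (rule ccontr)
    assume no: "\<not> ?thesis"
    define X where "X = {a \<otimes> g [^] n | a n::nat. a \<in> P}"
    have "cone X"
      unfolding cone_def
    proof (intro conjI ballI impI)
      show "X \<subseteq> carrier G" using PG g by (auto simp: X_def)
      show "\<one> \<in> X" unfolding X_def using P1 by (auto intro!: exI[of _ \<one>] exI[of _ 0])
    next
      fix x y assume "x \<in> X" "y \<in> X"
      then obtain a b m n where ab: "a \<in> P" "b \<in> P" "x = a \<otimes> g [^] (m::nat)" "y = b \<otimes> g [^] (n::nat)"
        by (auto simp: X_def)
      then have "x \<otimes> y = (a \<otimes> b) \<otimes> g [^] (m + n)"
        using PG g by (simp add: nat_pow_mult[symmetric] m_ac)
      then show "x \<otimes> y \<in> X" using ab Pm by (auto simp: X_def)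
    next
      fix x assume "x \<in> X" "inv x \<in> X"
      then obtain a b m n where ab: "a \<in> P" "b \<in> P" "x = a \<otimes> g [^] (m::nat)" "inv x = b \<otimes> g [^] (n::nat)"
        by (auto simp: X_def)
      have c: "a \<in> carrier G" "b \<in> carrier G" using ab PG by auto
      have "x \<in> carrier G" using ab c g by simp
      then have "\<one> = x \<otimes> inv x" by simp
      also have "\<dots> = (a \<otimes> b) \<otimes> g [^] (m + n)"
        unfolding ab(4) unfolding ab(3) using c g by (simp add: nat_pow_mult[symmetric] m_ac)
      finally have e: "\<one> = (a \<otimes> b) \<otimes> g [^] (m + n)" .
      then have "inv (g [^] (m + n)) = a \<otimes> b"
        using c g by (simp add: inv_equality)
      then have "m + n = 0" using no Pm[OF ab(1,2)] by (metis gr0I)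
      then have "x = a" "inv x = b" using ab c by auto
      then show "x = \<one>" using Pa[of a] ab(1,2) by simp
    qed
    moreover have "P \<subseteq> X"
    proof
      fix a assume "a \<in> P"
      then have "a = a \<otimes> g [^] (0::nat)" using PG by simp
      then show "a \<in> X" using \<open>a \<in> P\<close> unfolding X_def by blast
    qed
    moreover have "g \<in> X"
    proof -
      have "g = \<one> \<otimes> g [^] (1::nat)" using g by simp
      then show ?thesis using P1 unfolding X_def by blast
    qed
    ultimately show False using max g by blast
  qed
  have "a \<in> P \<or> inv a \<in> P" if a: "a \<in> carrier G" for a
  proof (rule ccontr)
    assume na: "\<not> ?thesis"
    \<comment> \<open>Raised to the common exponent \<open>n * m\<close>, these memberships put a
      power of \<open>a\<close> and its inverse into \<open>P\<close>. So that power is trivial, and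
      \<open>a\<close> is trivial too.\<close>
    then obtain m n :: nat where mn: "0 < m" "0 < n" "inv (a [^] m) \<in> P" "inv (inv a [^] n) \<in> P"
      using ext[of a] ext[of "inv a"] a by auto
    have "inv (inv a [^] n) = a [^] n" using a by (simp add: nat_pow_inv)
    then have 1: "a [^] (n * m) \<in> P" using Ppow[OF mn(4), of m] a by (simp add: nat_pow_pow)
    have "inv (a [^] (n * m)) = (inv (a [^] m)) [^] n"
      using a by (simp add: nat_pow_inv nat_pow_pow mult.commute)
    then have "inv (a [^] (n * m)) \<in> P" using Ppow[OF mn(3), of n] by simp
    then have "a [^] (n * m) = \<one>" using Pa 1 by blast
    then have "a = \<one>" using tf[unfolded torsion_free_def, rule_format, OF a, of "n * m"] mn by simp
    then show False using P1 na by simp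
  qed
  then show ?thesis using that[of P] PG P1 Pm Pa by blast
qed

lemma (in comm_group) torsion_free_unique_product:
  assumes tf: "torsion_free G"
    and X: "finite X" "X \<noteq> {}" "X \<subseteq> carrier G" and Y: "finite Y" "Y \<noteq> {}" "Y \<subseteq> carrier G"
  obtains x0 y0 where "x0 \<in> X" "y0 \<in> Y"
    "\<And>x y. x \<in> X \<Longrightarrow> y \<in> Y \<Longrightarrow> x \<otimes> y = x0 \<otimes> y0 \<Longrightarrow> x = x0 \<and> y = y0"
proof -
  obtain P where PG: "P \<subseteq> carrier G" and P1: "\<one> \<in> P"
    and Pm: "\<And>a b. a \<in> P \<Longrightarrow> b \<in> P \<Longrightarrow> a \<otimes> b \<in> P"
    and Pa: "\<And>a. a \<in> P \<Longrightarrow> inv a \<in> P \<Longrightarrow> a = \<one>"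
    and Pt: "\<And>a. a \<in> carrier G \<Longrightarrow> a \<in> P \<or> inv a \<in> P"
    using torsion_free_total_cone[OF tf] by metis
  have max: "\<exists>x0 \<in> A. \<forall>x \<in> A. inv x \<otimes> x0 \<in> P"
    if "finite A" "A \<noteq> {}" "A \<subseteq> carrier G" for A
    using that
  proof (induction A rule: finite_ne_induct)
    case (singleton x)
    then show ?case using P1 by simp
  next
    case (insert a A)
    then obtain x0 where x0: "x0 \<in> A" "\<And>x. x \<in> A \<Longrightarrow> inv x \<otimes> x0 \<in> P" by auto
    have c: "a \<in> carrier G" "x0 \<in> carrier G" using insert x0 by auto
    consider "inv a \<otimes> x0 \<in> P" | "inv x0 \<otimes> a \<in> P"
      using Pt[of "inv a \<otimes> x0"] c by (auto simp: inv_mult_group)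
    then show ?case
    proof cases
      case 1
      then show ?thesis using x0 by auto
    next
      case 2
      have "inv x \<otimes> a \<in> P" if "x \<in> A" for x
      proof -
        have "x \<in> carrier G" using that insert by auto
        then have "inv x \<otimes> a = (inv x \<otimes> x0) \<otimes> (inv x0 \<otimes> a)"
          using c by (simp add: m_assoc mult_inv_cancel)
        then show ?thesis using Pm[OF x0(2)[OF that] 2] by simp
      qed
      then show ?thesis using P1 c by auto
    qed
  qed
  obtain x0 where x0: "x0 \<in> X" "\<And>x. x \<in> X \<Longrightarrow> inv x \<otimes> x0 \<in> P" using max X by meson
  obtain y0 where y0: "y0 \<in> Y" "\<And>y. y \<in> Y \<Longrightarrow> inv y \<otimes> y0 \<in> P" using max Y by meson
  \<comment> \<open>With maxima \<open>x0\<close> and \<open>y0\<close>, the quotients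
    \<open>inv x \<otimes> x0\<close> and \<open>inv y \<otimes> y0\<close> lie in the cone and are
    inverse to each other, so both are trivial.\<close>
  have "x = x0 \<and> y = y0" if xy: "x \<in> X" "y \<in> Y" "x \<otimes> y = x0 \<otimes> y0" for x y
  proof -
    have c: "x \<in> carrier G" "y \<in> carrier G" "x0 \<in> carrier G" "y0 \<in> carrier G"
      using xy x0 y0 X Y by auto
    have "(inv x \<otimes> x0) \<otimes> (inv y \<otimes> y0) = inv (x \<otimes> y) \<otimes> (x0 \<otimes> y0)"
      using c by (simp add: inv_mult m_ac)
    then have e: "(inv x \<otimes> x0) \<otimes> (inv y \<otimes> y0) = \<one>" using xy c by simp
    then have i: "inv (inv y \<otimes> y0) = inv x \<otimes> x0" using c by (simp add: inv_equality)
    then have "inv y \<otimes> y0 = \<one>" using Pa x0(2) y0(2) xy by metis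
    moreover from this have "inv x \<otimes> x0 = \<one>" using i by simp
    ultimately show ?thesis using c by (metis inv_inv inv_equality inv_closed)
  qed
  then show ?thesis using that x0(1) y0(1) by blast
qed

section \<open>Elements with finitely many conjugates under a subgroup\<close>

definition finite_orbit :: "('g, 'c) monoid_scheme \<Rightarrow> 'g set \<Rightarrow> 'g set" where
  "finite_orbit G H = {y \<in> carrier G. finite ((\<lambda>h. h \<otimes>\<^bsub>G\<^esub> y \<otimes>\<^bsub>G\<^esub> inv\<^bsub>G\<^esub> h) ` H)}"

text \<open>Conjugates of a product are products of conjugates, and conjugates of an inverse are
  inverses of conjugates, so finiteness of orbits is inherited.\<close>

lemma (in group) subgroup_finite_orbit:
  assumes H: "H \<subseteq> carrier G"
  shows "subgroup (finite_orbit G H) G"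
proof
  show "finite_orbit G H \<subseteq> carrier G" by (auto simp: finite_orbit_def)
  have "(\<lambda>h. h \<otimes> \<one> \<otimes> inv h) ` H \<subseteq> {\<one>}" using H by auto
  then have "finite ((\<lambda>h. h \<otimes> \<one> \<otimes> inv h) ` H)" by (rule finite_subset) simp
  then show "\<one> \<in> finite_orbit G H" by (simp add: finite_orbit_def)
next
  fix x y assume xy: "x \<in> finite_orbit G H" "y \<in> finite_orbit G H"
  then have c: "x \<in> carrier G" "y \<in> carrier G" by (auto simp: finite_orbit_def)
  have "(\<lambda>h. h \<otimes> (x \<otimes> y) \<otimes> inv h) ` H \<subseteq>
      (\<lambda>(a, b). a \<otimes> b) ` ((\<lambda>h. h \<otimes> x \<otimes> inv h) ` H \<times> (\<lambda>h. h \<otimes> y \<otimes> inv h) ` H)"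
  proof (rule image_subsetI)
    fix h assume h: "h \<in> H"
    then have "h \<otimes> (x \<otimes> y) \<otimes> inv h = (h \<otimes> x \<otimes> inv h) \<otimes> (h \<otimes> y \<otimes> inv h)"
      using H c by (simp add: subset_iff m_assoc mult_inv_cancel)
    then show "h \<otimes> (x \<otimes> y) \<otimes> inv h \<in>
      (\<lambda>(a, b). a \<otimes> b) ` ((\<lambda>h. h \<otimes> x \<otimes> inv h) ` H \<times> (\<lambda>h. h \<otimes> y \<otimes> inv h) ` H)"
      using h by (intro image_eqI[of _ _ "(h \<otimes> x \<otimes> inv h, h \<otimes> y \<otimes> inv h)"]) auto
  qed
  then have "finite ((\<lambda>h. h \<otimes> (x \<otimes> y) \<otimes> inv h) ` H)"
    by (rule finite_subset) (use xy in \<open>auto simp: finite_orbit_def\<close>)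
  then show "x \<otimes> y \<in> finite_orbit G H" using c by (simp add: finite_orbit_def)
next
  fix x assume x: "x \<in> finite_orbit G H"
  then have c: "x \<in> carrier G" by (auto simp: finite_orbit_def)
  have "(\<lambda>h. h \<otimes> inv x \<otimes> inv h) ` H \<subseteq> m_inv G ` (\<lambda>h. h \<otimes> x \<otimes> inv h) ` H"
  proof (rule image_subsetI)
    fix h assume h: "h \<in> H"
    then have "h \<otimes> inv x \<otimes> inv h = inv (h \<otimes> x \<otimes> inv h)"
      using H c by (simp add: subset_iff m_assoc inv_mult_group)
    then show "h \<otimes> inv x \<otimes> inv h \<in> m_inv G ` (\<lambda>h. h \<otimes> x \<otimes> inv h) ` H" using h by blast
  qed
  then have "finite ((\<lambda>h. h \<otimes> inv x \<otimes> inv h) ` H)"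
    by (rule finite_subset) (use x in \<open>auto simp: finite_orbit_def\<close>)
  then show "inv x \<in> finite_orbit G H" using c by (simp add: finite_orbit_def)
qed

text \<open>\<open>H \<inter> finite_orbit G H\<close> is the FC centre of \<open>H\<close>. Its own
  conjugacy classes are finite, so torsion-freeness makes it abelian, and the result for
  torsion-free abelian groups applies inside it.\<close>

lemma (in group) unique_product_finite_orbit:
  assumes tf: "torsion_free G" and H: "subgroup H G"
    and X: "finite X" "X \<noteq> {}" "X \<subseteq> H \<inter> finite_orbit G H"
    and Y: "finite Y" "Y \<noteq> {}" "Y \<subseteq> H \<inter> finite_orbit G H"
  obtains x0 y0 where "x0 \<in> X" "y0 \<in> Y"
    "\<And>x y. x \<in> X \<Longrightarrow> y \<in> Y \<Longrightarrow> x \<otimes> y = x0 \<otimes> y0 \<Longrightarrow> x = x0 \<and> y = y0"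
proof -
  define N where "N = H \<inter> finite_orbit G H"
  have HG: "H \<subseteq> carrier G" using H by (rule subgroup.subset)
  have N: "subgroup N G"
    unfolding N_def by (rule subgroups_Inter_pair[OF H subgroup_finite_orbit[OF HG]])
  define GN where "GN = G\<lparr>carrier := N\<rparr>"
  interpret GN: group GN unfolding GN_def by (rule subgroup_imp_group[OF N])
  have NG: "N \<subseteq> carrier G" using N by (rule subgroup.subset)
  have tfN: "torsion_free GN"
    unfolding torsion_free_def
  proof (intro ballI allI impI)
    fix g n assume g: "g \<in> carrier GN" and n: "0 < (n::nat) \<and> g [^]\<^bsub>GN\<^esub> n = \<one>\<^bsub>GN\<^esub>"
    then have "g [^] n = \<one>" by (simp add: GN_def nat_pow_consistent[symmetric])
    then show "g = \<one>\<^bsub>GN\<^esub>"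
      using tf[unfolded torsion_free_def, rule_format, of g n] g n NG by (auto simp: GN_def)
  qed
  have "x \<otimes>\<^bsub>GN\<^esub> y = y \<otimes>\<^bsub>GN\<^esub> x" if "x \<in> carrier GN" "y \<in> carrier GN" for x y
  proof (rule GN.torsion_free_FC_commute[OF tfN _ that])
    fix x assume x: "x \<in> carrier GN"
    have "(\<lambda>p. p \<otimes>\<^bsub>GN\<^esub> x \<otimes>\<^bsub>GN\<^esub> inv\<^bsub>GN\<^esub> p) ` carrier GN \<subseteq> (\<lambda>h. h \<otimes> x \<otimes> inv h) ` H"
    proof (rule image_subsetI)
      fix p assume p: "p \<in> carrier GN"
      have "inv\<^bsub>GN\<^esub> p = inv p"
        using p by (simp add: GN_def m_inv_consistent[OF N])
      then show "p \<otimes>\<^bsub>GN\<^esub> x \<otimes>\<^bsub>GN\<^esub> inv\<^bsub>GN\<^esub> p \<in> (\<lambda>h. h \<otimes> x \<otimes> inv h) ` H"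
        using p by (simp add: GN_def N_def)
    qed
    then show "finite ((\<lambda>p. p \<otimes>\<^bsub>GN\<^esub> x \<otimes>\<^bsub>GN\<^esub> inv\<^bsub>GN\<^esub> p) ` carrier GN)"
      by (rule finite_subset) (use x in \<open>auto simp: GN_def N_def finite_orbit_def\<close>)
  qed
  then interpret GN: comm_group GN by (rule GN.group_comm_groupI)
  have "X \<subseteq> carrier GN" "Y \<subseteq> carrier GN" using X Y by (auto simp: GN_def N_def)
  from GN.torsion_free_unique_product[OF tfN X(1,2) this(1) Y(1,2) this(2)]
  obtain x0 y0 where "x0 \<in> X" "y0 \<in> Y"
    "\<And>x y. x \<in> X \<Longrightarrow> y \<in> Y \<Longrightarrow> x \<otimes>\<^bsub>GN\<^esub> y = x0 \<otimes>\<^bsub>GN\<^esub> y0 \<Longrightarrow> x = x0 \<and> y = y0"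
    by metis
  then show ?thesis using that by (simp add: GN_def)
qed

section \<open>Graded rings with local units\<close>

text \<open>\<open>pr g\<close> is the projection onto the component \<open>S\<^sub>g\<close>. The last assumption makes \<open>S\<^sub>g S\<^bsub>g\<inverse>\<^esub>\<close>
  an ideal of \<open>S\<^sub>1\<close> with identity element \<open>uv\<close>; the component \<open>S\<^sub>g\<close> may be zero.\<close>

locale locally_unital_graded_ring = group G + S: ring S
  for G :: "('g, 'c) monoid_scheme" (structure) and S :: "('s, 'd) ring_scheme" +
  fixes pr :: "'g \<Rightarrow> 's \<Rightarrow> 's"
  assumes pr_closed: "\<lbrakk>g \<in> carrier G; x \<in> carrier S\<rbrakk> \<Longrightarrow> pr g x \<in> carrier S"
    and pr_add: "\<lbrakk>g \<in> carrier G; x \<in> carrier S; y \<in> carrier S\<rbrakk> \<Longrightarrow>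
      pr g (x \<oplus>\<^bsub>S\<^esub> y) = pr g x \<oplus>\<^bsub>S\<^esub> pr g y"
    and pr_pr: "\<lbrakk>g \<in> carrier G; h \<in> carrier G; x \<in> carrier S\<rbrakk> \<Longrightarrow>
      pr g (pr h x) = (if g = h then pr h x else \<zero>\<^bsub>S\<^esub>)"
    and finite_pr: "x \<in> carrier S \<Longrightarrow> finite {g \<in> carrier G. pr g x \<noteq> \<zero>\<^bsub>S\<^esub>}"
    and pr_eq_zero: "\<lbrakk>x \<in> carrier S; \<And>g. g \<in> carrier G \<Longrightarrow> pr g x = \<zero>\<^bsub>S\<^esub>\<rbrakk> \<Longrightarrow> x = \<zero>\<^bsub>S\<^esub>"
    and pr_homog_mult: "\<lbrakk>g \<in> carrier G; h \<in> carrier G; s \<in> carrier S; pr g s = s; x \<in> carrier S\<rbrakk> \<Longrightarrow>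
      pr h (s \<otimes>\<^bsub>S\<^esub> x) = s \<otimes>\<^bsub>S\<^esub> pr (inv g \<otimes> h) x"
    and pr_mult_homog: "\<lbrakk>g \<in> carrier G; h \<in> carrier G; s \<in> carrier S; pr g s = s; x \<in> carrier S\<rbrakk> \<Longrightarrow>
      pr h (x \<otimes>\<^bsub>S\<^esub> s) = pr (h \<otimes> inv g) x \<otimes>\<^bsub>S\<^esub> s"
    and ex_local_unit: "g \<in> carrier G \<Longrightarrow>
      \<exists>u \<in> carrier S. \<exists>v \<in> carrier S. pr g u = u \<and> pr (inv g) v = v \<and>
        (\<forall>s \<in> carrier S. pr g s = s \<longrightarrow> u \<otimes>\<^bsub>S\<^esub> v \<otimes>\<^bsub>S\<^esub> s = s) \<and>
        (\<forall>s \<in> carrier S. pr (inv g) s = s \<longrightarrow> s \<otimes>\<^bsub>S\<^esub> (u \<otimes>\<^bsub>S\<^esub> v) = s)"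
begin

abbreviation smult (infixl \<open>\<bullet>\<close> 70) where "x \<bullet> y \<equiv> x \<otimes>\<^bsub>S\<^esub> y"
abbreviation szero (\<open>\<o>\<close>) where "\<o> \<equiv> \<zero>\<^bsub>S\<^esub>"

section \<open>Homogeneous components and local units\<close>

definition comp :: "'g \<Rightarrow> 's set" where
  "comp g = {s \<in> carrier S. pr g s = s}"

definition supp :: "'s \<Rightarrow> 'g set" where
  "supp x = {g \<in> carrier G. pr g x \<noteq> \<o>}"

lemma comp_carrier: "s \<in> comp g \<Longrightarrow> s \<in> carrier S"
  by (simp add: comp_def)

lemma pr_comp: "s \<in> comp g \<Longrightarrow> pr g s = s"
  by (simp add: comp_def)

lemma pr_in_comp [simp]: "g \<in> carrier G \<Longrightarrow> x \<in> carrier S \<Longrightarrow> pr g x \<in> comp g"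
  by (simp add: comp_def pr_closed pr_pr)

lemma pr_left:
  "\<lbrakk>s \<in> comp g; g \<in> carrier G; h \<in> carrier G; x \<in> carrier S\<rbrakk> \<Longrightarrow> pr h (s \<bullet> x) = s \<bullet> pr (inv g \<otimes> h) x"
  by (simp add: comp_def pr_homog_mult)

lemma pr_right:
  "\<lbrakk>s \<in> comp g; g \<in> carrier G; h \<in> carrier G; x \<in> carrier S\<rbrakk> \<Longrightarrow> pr h (x \<bullet> s) = pr (h \<otimes> inv g) x \<bullet> s"
  by (simp add: comp_def pr_mult_homog)

lemma pr_zero [simp]: "g \<in> carrier G \<Longrightarrow> pr g \<o> = \<o>"
  using pr_add[of g \<o> \<o>] pr_closed[of g \<o>] by (simp add: S.add.l_cancel_one)

lemma pr_minus [simp]: "g \<in> carrier G \<Longrightarrow> x \<in> carrier S \<Longrightarrow> pr g (\<ominus>\<^bsub>S\<^esub> x) = \<ominus>\<^bsub>S\<^esub> pr g x"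
  using pr_add[of g "\<ominus>\<^bsub>S\<^esub> x" x] pr_closed
  by (simp add: S.l_neg) (metis S.a_inv_closed S.minus_equality)

lemma comp_mult:
  assumes "s \<in> comp g" "t \<in> comp h" "g \<in> carrier G" "h \<in> carrier G" "k = g \<otimes> h"
  shows "s \<bullet> t \<in> comp k"
proof -
  have "pr k (s \<bullet> t) = s \<bullet> pr (inv g \<otimes> k) t"
    using assms comp_carrier by (simp add: pr_left)
  also have "inv g \<otimes> k = h"
    using assms by (simp add: mult_inv_cancel)
  finally show ?thesis using assms by (simp add: pr_comp) (simp add: comp_def)
qed

lemma comp_zero [simp]: "g \<in> carrier G \<Longrightarrow> \<o> \<in> comp g"
  by (simp add: comp_def)

lemma comp_add: "g \<in> carrier G \<Longrightarrow> s \<in> comp g \<Longrightarrow> t \<in> comp g \<Longrightarrow> s \<oplus>\<^bsub>S\<^esub> t \<in> comp g"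
  by (simp add: comp_def pr_add)

lemma comp_minus: "g \<in> carrier G \<Longrightarrow> s \<in> comp g \<Longrightarrow> \<ominus>\<^bsub>S\<^esub> s \<in> comp g"
  by (simp add: comp_def)

lemma finite_supp: "x \<in> carrier S \<Longrightarrow> finite (supp x)"
  by (simp add: supp_def finite_pr)

lemma supp_empty: "x \<in> carrier S \<Longrightarrow> supp x = {} \<Longrightarrow> x = \<o>"
  using pr_eq_zero by (auto simp: supp_def)

text \<open>A chosen factorization of the identity element of S_g S_(inv g), with
  \<open>lu g\<close> in S_g and \<open>ru g\<close> in S_(inv g). If the component is zero, both
  factors are zero.\<close>

definition unit_pair :: "'g \<Rightarrow> 's \<times> 's" where
  "unit_pair g = (SOME (u, v). u \<in> comp g \<and> v \<in> comp (inv g) \<and>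
    (\<forall>s \<in> comp g. u \<bullet> v \<bullet> s = s) \<and> (\<forall>s \<in> comp (inv g). s \<bullet> (u \<bullet> v) = s))"

definition lu :: "'g \<Rightarrow> 's" where "lu g = fst (unit_pair g)"
definition ru :: "'g \<Rightarrow> 's" where "ru g = snd (unit_pair g)"

lemma unit_pair:
  assumes g: "g \<in> carrier G"
  shows lu_comp [simp]: "lu g \<in> comp g" and ru_comp [simp]: "ru g \<in> comp (inv g)"
    and lu_ru_left0: "s \<in> comp g \<Longrightarrow> lu g \<bullet> ru g \<bullet> s = s"
    and lu_ru_right: "t \<in> comp (inv g) \<Longrightarrow> t \<bullet> (lu g \<bullet> ru g) = t"
proof -
  have "\<exists>p. case p of (u, v) \<Rightarrow> u \<in> comp g \<and> v \<in> comp (inv g) \<and>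
    (\<forall>s \<in> comp g. u \<bullet> v \<bullet> s = s) \<and> (\<forall>s \<in> comp (inv g). s \<bullet> (u \<bullet> v) = s)"
    using ex_local_unit[OF g] by (auto simp: comp_def)
  from someI_ex[OF this] show "lu g \<in> comp g" "ru g \<in> comp (inv g)"
    "s \<in> comp g \<Longrightarrow> lu g \<bullet> ru g \<bullet> s = s" "t \<in> comp (inv g) \<Longrightarrow> t \<bullet> (lu g \<bullet> ru g) = t"
    unfolding lu_def ru_def unit_pair_def by (auto split: prod.splits)
qed

declare comp_carrier [simp]

lemma lu_ru_left:
  assumes g: "g \<in> carrier G" and s: "s \<in> comp g"
  shows "lu g \<bullet> (ru g \<bullet> s) = s" and "x \<in> carrier S \<Longrightarrow> lu g \<bullet> (ru g \<bullet> (s \<bullet> x)) = s \<bullet> x"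
proof -
  have c: "lu g \<in> carrier S" "ru g \<in> carrier S" "s \<in> carrier S"
    using comp_carrier[OF lu_comp[OF g]] comp_carrier[OF ru_comp[OF g]] s by auto
  show 1: "lu g \<bullet> (ru g \<bullet> s) = s"
    using lu_ru_left0[OF g s] c by (simp add: S.m_assoc)
  show "lu g \<bullet> (ru g \<bullet> (s \<bullet> x)) = s \<bullet> x" if "x \<in> carrier S"
    using c that by (simp flip: S.m_assoc) (simp add: lu_ru_left0[OF g s])
qed

lemma lu_carrier [simp]: "g \<in> carrier G \<Longrightarrow> lu g \<in> carrier S"
  and ru_carrier [simp]: "g \<in> carrier G \<Longrightarrow> ru g \<in> carrier S"
  using comp_carrier lu_comp ru_comp by blast+

text \<open>Multiplying back by \<open>ru (inv g)\<close> recovers \<open>t\<close>. The lemma moves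
  a nonzero element of S_g into S_1 without losing it; the next one does so from the other
  side.\<close>

lemma ex_right_unit:
  assumes g: "g \<in> carrier G" and t: "t \<in> comp g" "t \<noteq> \<o>"
  shows "t \<bullet> lu (inv g) \<noteq> \<o>"
proof
  assume 0: "t \<bullet> lu (inv g) = \<o>"
  have "t = t \<bullet> lu (inv g) \<bullet> ru (inv g)"
    using lu_ru_right[of "inv g" t] g t by (simp add: S.m_assoc)
  then show False using 0 g t by simp
qed

lemma ex_left_unit:
  assumes g: "g \<in> carrier G" and t: "t \<in> comp g" "t \<noteq> \<o>"
  shows "ru g \<bullet> t \<noteq> \<o>"
proof
  assume 0: "ru g \<bullet> t = \<o>"
  have "t = lu g \<bullet> (ru g \<bullet> t)"
    using lu_ru_left[of g t] g t by simp
  then show False using 0 g t by simp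
qed

section \<open>Ideals of the identity component and their conjugates\<close>

definition eideal :: "'s set \<Rightarrow> bool" where
  "eideal I \<longleftrightarrow> I \<subseteq> comp \<one> \<and> \<o> \<in> I \<and> (\<forall>x \<in> I. \<forall>y \<in> I. x \<oplus>\<^bsub>S\<^esub> y \<in> I) \<and> (\<forall>x \<in> I. \<ominus>\<^bsub>S\<^esub> x \<in> I) \<and>
    (\<forall>r \<in> comp \<one>. \<forall>x \<in> I. r \<bullet> x \<in> I \<and> x \<bullet> r \<in> I)"

lemma eidealD:
  assumes "eideal I"
  shows eideal_comp: "x \<in> I \<Longrightarrow> x \<in> comp \<one>" and eideal_carrier: "x \<in> I \<Longrightarrow> x \<in> carrier S"
    and eideal_zero: "\<o> \<in> I"
    and eideal_add: "x \<in> I \<Longrightarrow> y \<in> I \<Longrightarrow> x \<oplus>\<^bsub>S\<^esub> y \<in> I"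
    and eideal_minus: "x \<in> I \<Longrightarrow> \<ominus>\<^bsub>S\<^esub> x \<in> I"
    and eideal_left: "x \<in> I \<Longrightarrow> r \<in> comp \<one> \<Longrightarrow> r \<bullet> x \<in> I"
    and eideal_right: "x \<in> I \<Longrightarrow> r \<in> comp \<one> \<Longrightarrow> x \<bullet> r \<in> I"
  using assms comp_carrier by (auto simp: eideal_def)

lemma eideal_Int: "eideal I \<Longrightarrow> eideal J \<Longrightarrow> eideal (I \<inter> J)"
  by (auto simp: eideal_def)

lemma eideal_nonzero: "eideal I \<Longrightarrow> I \<noteq> {\<o>} \<longleftrightarrow> (\<exists>x \<in> I. x \<noteq> \<o>)"
  using eideal_zero by blast

text \<open>This is the condition that I S_h J is nonzero: a sum of products vanishes if each of
  them does, so a single product serves as witness.\<close>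

definition nz :: "'s set \<Rightarrow> 'g \<Rightarrow> 's set \<Rightarrow> bool" where
  "nz I h J \<longleftrightarrow> (\<exists>i \<in> I. \<exists>s \<in> comp h. \<exists>j \<in> J. i \<bullet> s \<bullet> j \<noteq> \<o>)"

lemma nz_mono: "nz I h J \<Longrightarrow> I \<subseteq> I' \<Longrightarrow> J \<subseteq> J' \<Longrightarrow> nz I' h J'"
  unfolding nz_def by blast

text \<open>The conjugate \<open>S\<^sub>h J S\<^bsub>h\<inverse>\<^esub>\<close>, in a form that avoids sums of products.\<close>

definition cj :: "'g \<Rightarrow> 's set \<Rightarrow> 's set" where
  "cj h J = {r \<in> comp \<one>. lu h \<bullet> (ru h \<bullet> r) = r \<and> (\<forall>s \<in> comp (inv h). \<forall>t \<in> comp h. s \<bullet> r \<bullet> t \<in> J)}"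

lemma eideal_cj:
  assumes h: "h \<in> carrier G" and J: "eideal J"
  shows "eideal (cj h J)"
  unfolding eideal_def
proof (intro conjI ballI)
  show "cj h J \<subseteq> comp \<one>" by (auto simp: cj_def)
  show "\<o> \<in> cj h J" using h eideal_zero[OF J] by (simp add: cj_def)
  show "x \<oplus>\<^bsub>S\<^esub> y \<in> cj h J" if "x \<in> cj h J" "y \<in> cj h J" for x y
    using that h eideal_add[OF J] by (auto simp: cj_def comp_add S.r_distr S.l_distr)
  show "\<ominus>\<^bsub>S\<^esub> x \<in> cj h J" if "x \<in> cj h J" for x
    using that h eideal_minus[OF J] by (auto simp: cj_def comp_minus S.r_minus S.l_minus)
  fix q r assume q: "q \<in> comp \<one>" and r: "r \<in> cj h J"
  have rr: "r \<in> comp \<one>" "lu h \<bullet> (ru h \<bullet> r) = r"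
    and sr: "\<And>s t. s \<in> comp (inv h) \<Longrightarrow> t \<in> comp h \<Longrightarrow> s \<bullet> r \<bullet> t \<in> J"
    using r by (auto simp: cj_def)
  \<comment> \<open>Written as \<open>(q \<bullet> lu h) \<bullet> (ru h \<bullet> r)\<close>, the
    product \<open>q \<bullet> r\<close> begins with an element of S_h, and the local unit fixes
    whatever begins so.\<close>
  have "q \<bullet> lu h \<in> comp h" using q h by - (rule comp_mult[of _ \<one> _ h], auto)
  then have "lu h \<bullet> (ru h \<bullet> ((q \<bullet> lu h) \<bullet> (ru h \<bullet> r))) = (q \<bullet> lu h) \<bullet> (ru h \<bullet> r)"
    using h rr by (intro lu_ru_left(2)) auto
  then have "lu h \<bullet> (ru h \<bullet> (q \<bullet> r)) = q \<bullet> r"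
    using h rr q by (simp add: S.m_assoc)
  moreover have "s \<bullet> (q \<bullet> r) \<bullet> t \<in> J" if "s \<in> comp (inv h)" "t \<in> comp h" for s t
  proof -
    have "s \<bullet> q \<in> comp (inv h)" using q h that by - (rule comp_mult[of _ "inv h" _ \<one>], auto)
    from sr[OF this that(2)] show ?thesis using that q rr by (simp add: S.m_assoc)
  qed
  ultimately show "q \<bullet> r \<in> cj h J"
    using comp_mult[of q \<one> r \<one> \<one>] q rr by (simp add: cj_def)
  have "lu h \<bullet> (ru h \<bullet> (r \<bullet> q)) = r \<bullet> q"
    using rr q h by (simp flip: S.m_assoc)
  moreover have "s \<bullet> (r \<bullet> q) \<bullet> t \<in> J" if "s \<in> comp (inv h)" "t \<in> comp h" for s t
  proof -
    have "q \<bullet> t \<in> comp h" using q h that by - (rule comp_mult[of _ \<one> _ h], auto)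
    from sr[OF that(1) this] show ?thesis using that q rr by (simp add: S.m_assoc)
  qed
  ultimately show "r \<bullet> q \<in> cj h J"
    using comp_mult[of r \<one> q \<one> \<one>] q rr by (simp add: cj_def)
qed

text \<open>The local unit fixes \<open>r\<close> on the left by definition. On the right it fixes
  \<open>ru h \<bullet> r\<close>, an element of S_(inv h). So \<open>r\<close> is recovered from a
  single element of \<open>J\<close>, without sums.\<close>

lemma cj_decomp:
  assumes h: "h \<in> carrier G" and r: "r \<in> cj h J"
  shows "ru h \<bullet> r \<bullet> lu h \<in> J" and "r = lu h \<bullet> (ru h \<bullet> r \<bullet> lu h) \<bullet> ru h"
proof -
  show "ru h \<bullet> r \<bullet> lu h \<in> J" using r h by (auto simp: cj_def)
  have rr: "r \<in> comp \<one>" "lu h \<bullet> (ru h \<bullet> r) = r" using r by (auto simp: cj_def)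
  have "ru h \<bullet> r \<in> comp (inv h)" using rr h by - (rule comp_mult[of _ "inv h" _ \<one>], auto)
  from lu_ru_right[OF h this] have "ru h \<bullet> r \<bullet> (lu h \<bullet> ru h) = ru h \<bullet> r" .
  then have "lu h \<bullet> (ru h \<bullet> r \<bullet> (lu h \<bullet> ru h)) = r" using rr by simp
  then show "r = lu h \<bullet> (ru h \<bullet> r \<bullet> lu h) \<bullet> ru h"
    using rr h by (simp add: S.m_assoc)
qed

text \<open>A nonzero product i s j in S_h stays nonzero when \<open>lu (inv h)\<close> brings it
  into S_1. The result \<open>m\<close> lies in \<open>I\<close> because of its first factor, and in
  \<open>cj h J\<close> because \<open>j\<close> is flanked by elements of S_h and S_(inv
  h).\<close>

lemma nz_Int_cj:
  assumes h: "h \<in> carrier G" and I: "eideal I" and J: "eideal J" and nz: "nz I h J"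
  shows "I \<inter> cj h J \<noteq> {\<o>}"
proof -
  obtain i s j where isj: "i \<in> I" "s \<in> comp h" "j \<in> J" "i \<bullet> s \<bullet> j \<noteq> \<o>"
    using nz by (auto simp: nz_def)
  have ic: "i \<in> comp \<one>" "j \<in> comp \<one>" using isj I J eideal_comp by auto
  define t where "t = lu (inv h)"
  have t: "t \<in> comp (inv h)" using h by (simp add: t_def)
  have isc: "i \<bullet> s \<in> comp h" using ic isj h by - (rule comp_mult[of _ \<one> _ h], auto)
  have isj1: "i \<bullet> s \<bullet> j \<in> comp h" using ic isc h by - (rule comp_mult[of _ h _ \<one>], auto)
  define m where "m = i \<bullet> s \<bullet> j \<bullet> t"
  have m0: "m \<noteq> \<o>" unfolding m_def t_def using ex_right_unit[OF h isj1 isj(4)] .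
  have m1: "m \<in> comp \<one>" unfolding m_def using isj1 t h by - (rule comp_mult[of _ h _ "inv h"], auto)
  have c: "i \<in> carrier S" "s \<in> carrier S" "j \<in> carrier S" "t \<in> carrier S" "m \<in> carrier S"
    using ic isj t m1 comp_carrier by blast+
  have "s \<bullet> j \<in> comp h" using ic isj h by - (rule comp_mult[of _ h _ \<one>], auto)
  then have "s \<bullet> j \<bullet> t \<in> comp \<one>" using t h by - (rule comp_mult[of _ h _ "inv h"], auto)
  from eideal_right[OF I isj(1) this] have "m \<in> I" using c by (simp add: m_def S.m_assoc)
  moreover have "m \<in> cj h J"
    unfolding cj_def
  proof (intro CollectI conjI ballI m1)
    show "lu h \<bullet> (ru h \<bullet> m) = m"
      using lu_ru_left(2)[OF h isc, of "j \<bullet> t"] c h by (simp add: m_def S.m_assoc)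
    fix s1 t1 assume st: "s1 \<in> comp (inv h)" "t1 \<in> comp h"
    have "s1 \<bullet> (i \<bullet> s) \<in> comp \<one>" using st isc h by - (rule comp_mult[of _ "inv h" _ h], auto)
    moreover have "t \<bullet> t1 \<in> comp \<one>" using st t h by - (rule comp_mult[of _ "inv h" _ h], auto)
    ultimately have "s1 \<bullet> (i \<bullet> s) \<bullet> j \<bullet> (t \<bullet> t1) \<in> J"
      using isj(3) by (intro eideal_right[OF J] eideal_left[OF J])
    then show "s1 \<bullet> m \<bullet> t1 \<in> J" using c st by (simp add: m_def S.m_assoc)
  qed
  ultimately show ?thesis using m0 by blast
qed

text \<open>Elements of \<open>cj g J\<close> factor as
  \<open>lu g \<bullet> j \<bullet> ru g\<close>, and the left factor \<open>lu g\<close> can be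
  absorbed into the middle element, which shifts its degree by \<open>g\<close>. In
  \<open>nz_cj_left\<close> the factor \<open>ru g\<close> is absorbed from the left.\<close>

lemma nz_cj_right:
  assumes g: "g \<in> carrier G" and h: "h \<in> carrier G" and I: "I \<subseteq> carrier S" and nz: "nz I h (cj g J)"
  shows "nz I (h \<otimes> g) J"
proof -
  obtain i s r where isr: "i \<in> I" "s \<in> comp h" "r \<in> cj g J" "i \<bullet> s \<bullet> r \<noteq> \<o>"
    using nz by (auto simp: nz_def)
  define j where "j = ru g \<bullet> r \<bullet> lu g"
  have j: "j \<in> J" "r = lu g \<bullet> j \<bullet> ru g" using cj_decomp[OF g isr(3)] by (simp_all add: j_def)
  have c: "i \<in> carrier S" "s \<in> carrier S" "r \<in> carrier S" "j \<in> carrier S"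
    using isr I g by (auto simp: cj_def j_def)
  have "i \<bullet> (s \<bullet> lu g) \<bullet> j \<noteq> \<o>"
  proof
    assume "i \<bullet> (s \<bullet> lu g) \<bullet> j = \<o>"
    then have "i \<bullet> (s \<bullet> lu g) \<bullet> j \<bullet> ru g = \<o>" using g by simp
    then show False using isr(4) c g by (simp add: j(2) S.m_assoc)
  qed
  moreover have "s \<bullet> lu g \<in> comp (h \<otimes> g)" using isr g h by - (rule comp_mult, auto)
  ultimately show ?thesis using isr j unfolding nz_def by blast
qed

lemma nz_cj_left:
  assumes g: "g \<in> carrier G" and h: "h \<in> carrier G" and J: "J \<subseteq> carrier S" and nz: "nz (cj g I) h J"
  shows "nz I (inv g \<otimes> h) J"
proof -
  obtain r s j where isr: "r \<in> cj g I" "s \<in> comp h" "j \<in> J" "r \<bullet> s \<bullet> j \<noteq> \<o>"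
    using nz by (auto simp: nz_def)
  define i where "i = ru g \<bullet> r \<bullet> lu g"
  have i: "i \<in> I" "r = lu g \<bullet> i \<bullet> ru g" using cj_decomp[OF g isr(1)] by (simp_all add: i_def)
  have c: "i \<in> carrier S" "s \<in> carrier S" "r \<in> carrier S" "j \<in> carrier S"
    using isr J g by (auto simp: cj_def i_def)
  have "i \<bullet> (ru g \<bullet> s) \<bullet> j \<noteq> \<o>"
  proof
    assume "i \<bullet> (ru g \<bullet> s) \<bullet> j = \<o>"
    then have "lu g \<bullet> (i \<bullet> (ru g \<bullet> s) \<bullet> j) = \<o>" using g by simp
    then show False using isr(4) c g by (simp add: i(2) S.m_assoc)
  qed
  moreover have "ru g \<bullet> s \<in> comp (inv g \<otimes> h)" using isr g h by - (rule comp_mult, auto)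
  ultimately show ?thesis using isr i unfolding nz_def by blast
qed

text \<open>Together with \<open>cj_inv_nonzero\<close>, this says that an ideal inside
  \<open>cj g J\<close> can be conjugated back into \<open>J\<close> without becoming zero.\<close>

lemma cj_inv_sub:
  assumes g: "g \<in> carrier G" and L: "L \<subseteq> cj g J"
  shows "cj (inv g) L \<subseteq> J"
proof
  fix q assume q: "q \<in> cj (inv g) L"
  define p where "p = ru (inv g) \<bullet> q \<bullet> lu (inv g)"
  have p: "p \<in> cj g J" "q = lu (inv g) \<bullet> p \<bullet> ru (inv g)"
    using cj_decomp[OF _ q] g L by (auto simp: p_def)
  then show "q \<in> J" using g ru_comp[of "inv g"] by (auto simp: cj_def)
qed

text \<open>For nonzero \<open>r\<close> in \<open>L\<close>, the element
  \<open>ru g \<bullet> r \<bullet> lu g\<close> is nonzero, since \<open>r\<close> is recovered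
  from it; this recovery is what \<open>L \<subseteq> cj g J\<close> provides.\<close>

lemma cj_inv_nonzero:
  assumes g: "g \<in> carrier G" and L: "eideal L" "L \<noteq> {\<o>}" "L \<subseteq> cj g J"
  shows "cj (inv g) L \<noteq> {\<o>}"
proof -
  obtain r where r: "r \<in> L" "r \<noteq> \<o>" using L eideal_nonzero by blast
  then have rJ: "r \<in> cj g J" and r1: "r \<in> comp \<one>" using L eideal_comp by auto
  define q where "q = ru g \<bullet> r \<bullet> lu g"
  have "r = lu g \<bullet> q \<bullet> ru g" unfolding q_def by (rule cj_decomp[OF g rJ])
  then have q0: "q \<noteq> \<o>" using r g by auto
  have "ru g \<bullet> r \<in> comp (inv g)" using r1 g by - (rule comp_mult[of _ "inv g" _ \<one>], auto)
  then have q1: "q \<in> comp \<one>" unfolding q_def by (rule comp_mult[of _ "inv g" _ g]) (use g in auto)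
  have "q \<in> cj (inv g) L"
    unfolding cj_def
  proof (intro CollectI conjI ballI q1)
    show "lu (inv g) \<bullet> (ru (inv g) \<bullet> q) = q"
      using lu_ru_left(2)[of "inv g" "ru g" "r \<bullet> lu g"] g r1 by (simp add: q_def S.m_assoc)
    fix s t assume st: "s \<in> comp (inv (inv g))" "t \<in> comp (inv g)"
    have "s \<bullet> ru g \<in> comp \<one>" using st g by - (rule comp_mult[of _ g _ "inv g"], auto)
    moreover have "lu g \<bullet> t \<in> comp \<one>" using st g by - (rule comp_mult[of _ g _ "inv g"], auto)
    ultimately have "s \<bullet> ru g \<bullet> r \<bullet> (lu g \<bullet> t) \<in> L"
      using r(1) by (intro eideal_right[OF L(1)] eideal_left[OF L(1)])
    then show "s \<bullet> q \<bullet> t \<in> L" using g st r1 by (simp add: q_def S.m_assoc)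
  qed
  then show ?thesis using q0 by blast
qed

end

section \<open>Graded prime rings\<close>

locale prime_graded_ring = locally_unital_graded_ring +
  assumes ex_nz: "\<lbrakk>eideal I; I \<noteq> {\<o>}; eideal J; J \<noteq> {\<o>}\<rbrakk> \<Longrightarrow> \<exists>h \<in> carrier G. nz I h J"
begin

text \<open>The elements of S_1 annihilated on the left by K S form an ideal \<open>N\<close> of
  S_1. If K S annihilated \<open>t\<close>, then \<open>N\<close> would contain the nonzero element
  \<open>t \<bullet> lu (inv g)\<close>, whereas K S N must be nonzero.\<close>

lemma ex_mult_left_nonzero:
  assumes K: "eideal K" "K \<noteq> {\<o>}" and g: "g \<in> carrier G" and t: "t \<in> comp g" "t \<noteq> \<o>"
  shows "\<exists>h \<in> carrier G. \<exists>k \<in> K. \<exists>s \<in> comp h. k \<bullet> s \<bullet> t \<noteq> \<o>"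
proof (rule ccontr)
  assume no: "\<not> ?thesis"
  define N where "N = {r \<in> comp \<one>. \<forall>h \<in> carrier G. \<forall>k \<in> K. \<forall>s \<in> comp h. k \<bullet> s \<bullet> r = \<o>}"
  have kc: "k \<in> carrier S" if "k \<in> K" for k using that eideal_carrier[OF K(1)] by blast
  have "eideal N"
    unfolding eideal_def
  proof (intro conjI ballI)
    show "N \<subseteq> comp \<one>" by (auto simp: N_def)
    show "\<o> \<in> N" using kc by (auto simp: N_def)
    show "x \<oplus>\<^bsub>S\<^esub> y \<in> N" if "x \<in> N" "y \<in> N" for x y
      using that kc by (auto simp: N_def comp_add S.r_distr)
    show "\<ominus>\<^bsub>S\<^esub> x \<in> N" if "x \<in> N" for x
      using that kc by (auto simp: N_def comp_minus S.r_minus)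
    fix q r assume q: "q \<in> comp \<one>" and r: "r \<in> N"
    have r1: "r \<in> comp \<one>" using r by (simp add: N_def)
    have "k \<bullet> s \<bullet> (q \<bullet> r) = \<o>" if "h \<in> carrier G" "k \<in> K" "s \<in> comp h" for h k s
    proof -
      have "s \<bullet> q \<in> comp h" using that q by - (rule comp_mult[of _ h _ \<one>], auto)
      then have "k \<bullet> (s \<bullet> q) \<bullet> r = \<o>" using r that by (auto simp: N_def)
      then show ?thesis using that q r1 kc by (simp add: S.m_assoc)
    qed
    moreover have "q \<bullet> r \<in> comp \<one>" using q r1 by - (rule comp_mult[of _ \<one> _ \<one>], auto)
    ultimately show "q \<bullet> r \<in> N" by (auto simp: N_def)
    have "k \<bullet> s \<bullet> (r \<bullet> q) = \<o>" if "h \<in> carrier G" "k \<in> K" "s \<in> comp h" for h k s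
    proof -
      have "k \<bullet> s \<bullet> (r \<bullet> q) = k \<bullet> s \<bullet> r \<bullet> q" using that q r1 kc by (simp add: S.m_assoc)
      also have "k \<bullet> s \<bullet> r = \<o>" using that r by (auto simp: N_def)
      finally show ?thesis using q by simp
    qed
    moreover have "r \<bullet> q \<in> comp \<one>" using q r1 by - (rule comp_mult[of _ \<one> _ \<one>], auto)
    ultimately show "r \<bullet> q \<in> N" by (auto simp: N_def)
  qed
  moreover have "N \<noteq> {\<o>}"
  proof -
    have "t \<bullet> lu (inv g) \<in> comp \<one>" using t g by - (rule comp_mult[of _ g _ "inv g"], auto)
    moreover have "k \<bullet> s \<bullet> (t \<bullet> lu (inv g)) = \<o>" if "h \<in> carrier G" "k \<in> K" "s \<in> comp h" for h k s
    proof -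
      have "k \<bullet> s \<bullet> (t \<bullet> lu (inv g)) = k \<bullet> s \<bullet> t \<bullet> lu (inv g)"
        using that t kc g by (simp add: S.m_assoc)
      also have "k \<bullet> s \<bullet> t = \<o>" using no that by blast
      finally show ?thesis using g by simp
    qed
    ultimately have "t \<bullet> lu (inv g) \<in> N" by (auto simp: N_def)
    then show ?thesis using ex_right_unit[OF g t] by blast
  qed
  ultimately obtain h where "h \<in> carrier G" "nz K h N" using ex_nz[OF K] by blast
  then show False by (auto simp: nz_def N_def)
qed

text \<open>Mirror image of the previous argument: \<open>N\<close> now consists of the elements
  annihilating S K, and \<open>ru g \<bullet> t\<close> is its nonzero element.\<close>

lemma ex_mult_right_nonzero:
  assumes K: "eideal K" "K \<noteq> {\<o>}" and g: "g \<in> carrier G" and t: "t \<in> comp g" "t \<noteq> \<o>"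
  shows "\<exists>h \<in> carrier G. \<exists>s \<in> comp h. \<exists>k \<in> K. t \<bullet> s \<bullet> k \<noteq> \<o>"
proof (rule ccontr)
  assume no: "\<not> ?thesis"
  define N where "N = {r \<in> comp \<one>. \<forall>h \<in> carrier G. \<forall>k \<in> K. \<forall>s \<in> comp h. r \<bullet> s \<bullet> k = \<o>}"
  have kc: "k \<in> carrier S" if "k \<in> K" for k using that eideal_carrier[OF K(1)] by blast
  have "eideal N"
    unfolding eideal_def
  proof (intro conjI ballI)
    show "N \<subseteq> comp \<one>" by (auto simp: N_def)
    show "\<o> \<in> N" using kc by (auto simp: N_def)
    show "x \<oplus>\<^bsub>S\<^esub> y \<in> N" if "x \<in> N" "y \<in> N" for x y
      using that kc by (auto simp: N_def comp_add S.l_distr)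
    show "\<ominus>\<^bsub>S\<^esub> x \<in> N" if "x \<in> N" for x
      using that kc by (auto simp: N_def comp_minus S.l_minus)
    fix q r assume q: "q \<in> comp \<one>" and r: "r \<in> N"
    have r1: "r \<in> comp \<one>" using r by (simp add: N_def)
    have "(r \<bullet> q) \<bullet> s \<bullet> k = \<o>" if "h \<in> carrier G" "k \<in> K" "s \<in> comp h" for h k s
    proof -
      have "q \<bullet> s \<in> comp h" using that q by - (rule comp_mult[of _ \<one> _ h], auto)
      then have "r \<bullet> (q \<bullet> s) \<bullet> k = \<o>" using r that by (auto simp: N_def)
      then show ?thesis using that q r1 kc by (simp add: S.m_assoc)
    qed
    moreover have "r \<bullet> q \<in> comp \<one>" using q r1 by - (rule comp_mult[of _ \<one> _ \<one>], auto)
    ultimately show "r \<bullet> q \<in> N" by (auto simp: N_def)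
    have "q \<bullet> r \<bullet> s \<bullet> k = \<o>" if "h \<in> carrier G" "k \<in> K" "s \<in> comp h" for h k s
    proof -
      have "q \<bullet> r \<bullet> s \<bullet> k = q \<bullet> (r \<bullet> s \<bullet> k)" using that q r1 kc by (simp add: S.m_assoc)
      also have "r \<bullet> s \<bullet> k = \<o>" using that r by (auto simp: N_def)
      finally show ?thesis using q by simp
    qed
    moreover have "q \<bullet> r \<in> comp \<one>" using q r1 by - (rule comp_mult[of _ \<one> _ \<one>], auto)
    ultimately show "q \<bullet> r \<in> N" by (auto simp: N_def)
  qed
  moreover have "N \<noteq> {\<o>}"
  proof -
    have "ru g \<bullet> t \<in> comp \<one>" using t g by - (rule comp_mult[of _ "inv g" _ g], auto)
    moreover have "ru g \<bullet> t \<bullet> s \<bullet> k = \<o>" if "h \<in> carrier G" "k \<in> K" "s \<in> comp h" for h k s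
    proof -
      have "ru g \<bullet> t \<bullet> s \<bullet> k = ru g \<bullet> (t \<bullet> s \<bullet> k)"
        using that t kc g by (simp add: S.m_assoc)
      also have "t \<bullet> s \<bullet> k = \<o>" using no that by blast
      finally show ?thesis using g by simp
    qed
    ultimately have "ru g \<bullet> t \<in> N" by (auto simp: N_def)
    then show ?thesis using ex_left_unit[OF g t] by blast
  qed
  ultimately obtain h where "h \<in> carrier G" "nz N h K" using ex_nz[OF _ _ K] by blast
  then show False by (auto simp: nz_def N_def)
qed

section \<open>Covers by cosets of centralizers\<close>

abbreviation cn where "cn h x \<equiv> h \<otimes> x \<otimes> inv h"

text \<open>A finite set \<open>f\<close> of pairs describes the left coset \<open>{h. \<forall>(y, z) \<in> f. h y h\<^sup>-\<^sup>1 = z}\<close> of the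
  centralizer of \<open>fst ` f\<close>. The ideal \<open>K\<close> is chosen such that a cover of
  \<open>{h. K S\<^sub>h I \<noteq> 0}\<close> by such cosets has, first, as many pairs as possible in each coset and,
  second, the fewest cosets with exactly that number of pairs. Passing from \<open>K\<close> to
  \<open>K \<inter> K\<^sup>x\<close> intersects the cover with its \<open>x\<close>-translate; when \<open>K S\<^sub>x K \<noteq> 0\<close>, minimality
  forces \<open>x\<close> to permute the smallest cosets.\<close>

lemma stabilizer_of_cover:
  assumes I: "eideal I" "I \<noteq> {\<o>}" and Y: "finite Y" "Y \<subseteq> carrier G" and Z: "finite Z"
    and cov: "\<And>h. h \<in> carrier G \<Longrightarrow> nz I h I \<Longrightarrow> \<exists>y \<in> Y. cn h y \<in> Z"
  obtains K H y where "eideal K" "K \<noteq> {\<o>}" "K \<subseteq> I" "subgroup H G" "y \<in> Y"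
    "\<And>h. h \<in> carrier G \<Longrightarrow> nz K h K \<Longrightarrow> h \<in> H" "finite ((\<lambda>h. cn h y) ` H)"
proof -
  define U where "U f = {h \<in> carrier G. \<forall>(y, z) \<in> f. cn h y = z}" for f :: "('a \<times> 'a) set"
  \<comment> \<open>The right-hand ideal \<open>I\<close> stays fixed while \<open>K\<close> varies:
    then replacing \<open>K\<close> by \<open>cj x K\<close> can be compared with translating
    \<open>V K\<close> by \<open>x\<close>.\<close>
  define V where "V K = {h \<in> carrier G. nz K h I}" for K
  define cover where "cover K F \<longleftrightarrow> eideal K \<and> K \<noteq> {\<o>} \<and> finite F \<and>
    (\<forall>f \<in> F. finite f \<and> f \<subseteq> Y \<times> carrier G) \<and> V K \<subseteq> \<Union>(U ` F)" for K F
  define Q where "Q m \<longleftrightarrow> (\<exists>K F. cover K F \<and> (\<forall>f \<in> F. m \<le> card f))" for m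
  have IS: "I \<subseteq> carrier S" using eideal_carrier[OF I(1)] by blast
  have V_ne: "V K \<noteq> {}" if "eideal K" "K \<noteq> {\<o>}" for K
    using ex_nz[OF that I] by (auto simp: V_def)
  \<comment> \<open>Some coset of the cover contains an element \<open>h\<close>, so its pairs
    belong to the graph of conjugation by \<open>h\<close> on \<open>Y\<close>. This bounds
    \<open>m\<close>, and a greatest \<open>m\<close> exists.\<close>
  have Q_le: "m \<le> card Y" if Qm: "Q m" for m
  proof -
    obtain K F where KF: "cover K F" "\<forall>f \<in> F. m \<le> card f" using Qm by (auto simp: Q_def)
    then have "V K \<noteq> {}" using V_ne[of K] by (simp add: cover_def)
    then obtain h where "h \<in> V K" by blast
    moreover have "V K \<subseteq> \<Union>(U ` F)" using KF by (simp add: cover_def)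
    ultimately obtain f where f: "f \<in> F" "h \<in> U f" by blast
    then have "f \<subseteq> (\<lambda>y. (y, cn h y)) ` Y" using KF by (fastforce simp: U_def cover_def)
    then have "card f \<le> card Y"
      using Y by (meson card_image_le card_mono finite_imageI le_trans)
    then show ?thesis using KF f by fastforce
  qed
  \<comment> \<open>The hypothesis \<open>cov\<close> is itself a cover of \<open>V I\<close> by
    cosets with one prescribed pair each.\<close>
  have "Q 1"
    unfolding Q_def
  proof (intro exI conjI)
    show "cover I ((\<lambda>p. {p}) ` (Y \<times> (Z \<inter> carrier G)))"
      unfolding cover_def
    proof (intro conjI I)
      show "V I \<subseteq> \<Union>(U ` (\<lambda>p. {p}) ` (Y \<times> (Z \<inter> carrier G)))"
      proof
        fix h assume h: "h \<in> V I"
        then obtain y where "y \<in> Y" "cn h y \<in> Z" using cov by (auto simp: V_def)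
        then show "h \<in> \<Union>(U ` (\<lambda>p. {p}) ` (Y \<times> (Z \<inter> carrier G)))"
          using h Y by (auto simp: U_def V_def)
      qed
    qed (use Y Z in auto)
  qed auto
  then obtain m where m: "Q m" and m_max: "\<And>m'. Q m' \<Longrightarrow> m' \<le> m"
    using ex_has_greatest_nat[of Q 1 "\<lambda>x. x" "Suc (card Y)"] Q_le by (auto simp: less_Suc_eq_le)
  define R where "R n \<longleftrightarrow> (\<exists>K F. cover K F \<and> (\<forall>f \<in> F. m \<le> card f) \<and> card {f \<in> F. card f = m} = n)" for n
  have "\<exists>n. R n" using m by (auto simp: Q_def R_def)
  then obtain n where n: "R n" and n_min: "\<And>n'. R n' \<Longrightarrow> n \<le> n'"
    by (metis LeastI_ex Least_le)
  then obtain K F where KF: "cover K F" and mF: "\<And>f. f \<in> F \<Longrightarrow> m \<le> card f"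
    and nF: "card {f \<in> F. card f = m} = n" by (auto simp: R_def)
  have K: "eideal K" "K \<noteq> {\<o>}" and finF: "finite F"
    and F: "\<And>f. f \<in> F \<Longrightarrow> finite f" "\<And>f. f \<in> F \<Longrightarrow> f \<subseteq> Y \<times> carrier G"
    and VF: "V K \<subseteq> \<Union>(U ` F)"
    using KF by (simp_all add: cover_def)
  have VK: "\<exists>f \<in> F. h \<in> U f" if "h \<in> V K" for h using VF that by blast
  define Fm where "Fm = {f \<in> F. card f = m}"
  have finFm: "finite Fm" using finF by (simp add: Fm_def)
  have m1: "1 \<le> m" using m_max[OF \<open>Q 1\<close>] .
  have "Fm \<noteq> {}"
  proof
    assume "Fm = {}"
    then have "Suc m \<le> card f" if "f \<in> F" for f
      using mF[OF that] that by (auto simp: Fm_def Suc_le_eq order.strict_iff_order)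
    then have "Q (Suc m)" using KF by (auto simp: Q_def)
    then show False using m_max by fastforce
  qed
  then obtain f1 where f1: "f1 \<in> Fm" by blast
  \<comment> \<open>If the coset of \<open>f1\<close> contained no element of \<open>V K\<close>,
    dropping it would leave a cover with fewer cosets of the smallest number of pairs.\<close>
  have "\<exists>y1. y1 \<in> V K \<and> y1 \<in> U f1"
  proof (rule ccontr)
    assume no: "\<not> ?thesis"
    have "cover K (F - {f1})"
      unfolding cover_def
    proof (intro conjI K)
      show "V K \<subseteq> \<Union>(U ` (F - {f1}))" using VK no by fastforce
    qed (use finF F in auto)
    then have "R (card {f \<in> F - {f1}. card f = m})"
      unfolding R_def using mF by (intro exI[of _ K] exI[of _ "F - {f1}"]) auto
    then have "n \<le> card {f \<in> F - {f1}. card f = m}" by (rule n_min)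
    moreover have "{f \<in> F - {f1}. card f = m} = Fm - {f1}" by (auto simp: Fm_def)
    ultimately show False
      using f1 finFm nF card_Diff1_less[of Fm f1] by (simp add: Fm_def)
  qed
  then obtain y1 where y1: "y1 \<in> V K" "y1 \<in> U f1" by blast
  have y1G: "y1 \<in> carrier G" using y1 by (simp add: V_def)
  have "card f1 \<ge> 1" using f1 m1 by (auto simp: Fm_def)
  \<comment> \<open>As \<open>m\<close> is at least 1, the set \<open>f1\<close> is nonempty. The
    first component of any of its pairs serves as the required element of \<open>Y\<close>, and
    \<open>y1\<close> conjugates it to \<open>z\<close>.\<close>
  then obtain y z where yz: "(y, z) \<in> f1"
    by (metis One_nat_def card.empty equals0I not_one_le_zero surj_pair)
  have yY: "y \<in> Y" and zG: "z \<in> carrier G" and yG: "y \<in> carrier G" using F yz f1 Y by (auto simp: Fm_def)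
  have zy: "z = cn y1 y" using y1 yz by (auto simp: U_def)

  \<comment> \<open>Left translation of a coset by \<open>x\<close> conjugates the prescribed
    values: \<open>cf x f\<close> describes x times the coset described by \<open>f\<close>.\<close>
  define cf where "cf x f = (\<lambda>(y, z). (y, cn x z)) ` f" for x and f :: "('a \<times> 'a) set"
  have cf_sub: "cf x f \<subseteq> Y \<times> carrier G" if "x \<in> carrier G" "f \<subseteq> Y \<times> carrier G" for x f
    using that by (auto simp: cf_def)
  have cf_card: "card (cf x f) = card f" if "x \<in> carrier G" "f \<subseteq> Y \<times> carrier G" for x f
  proof -
    have "b = c" if "(a, b) \<in> f" "(a, c) \<in> f" "cn x b = cn x c" for a b c
      using that \<open>x \<in> carrier G\<close> \<open>f \<subseteq> Y \<times> carrier G\<close> conj_cancel[of x b c] by blast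
    then show ?thesis unfolding cf_def by (intro card_image) (auto simp: inj_on_def)
  qed
  have cf_mult: "cf (x \<otimes> y) f = cf x (cf y f)" if "x \<in> carrier G" "y \<in> carrier G" "f \<subseteq> Y \<times> carrier G" for x y f
    unfolding cf_def image_image using that by (intro image_cong) (auto simp: conj_mult)
  have cf_one: "cf \<one> f = f" if "f \<subseteq> Y \<times> carrier G" for f
    unfolding cf_def using that by (force simp: image_iff)
  have U_cf: "h \<in> U (cf x f)" if "x \<in> carrier G" "h \<in> carrier G" "inv x \<otimes> h \<in> U f" "f \<subseteq> Y \<times> carrier G" for x h f
  proof -
    have "cn h y = cn x z" if p: "(y, z) \<in> f" for y z
    proof -
      have c: "y \<in> carrier G" using p Y \<open>f \<subseteq> Y \<times> carrier G\<close> by auto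
      have "z = cn (inv x \<otimes> h) y" using p \<open>inv x \<otimes> h \<in> U f\<close> by (auto simp: U_def)
      then have "cn x z = cn (x \<otimes> (inv x \<otimes> h)) y"
        using c \<open>x \<in> carrier G\<close> \<open>h \<in> carrier G\<close> by (simp add: conj_mult)
      then show ?thesis using \<open>x \<in> carrier G\<close> \<open>h \<in> carrier G\<close> by (simp add: mult_inv_cancel)
    qed
    then show ?thesis using that by (auto simp: U_def cf_def)
  qed
  have FmF: "f \<in> Fm \<Longrightarrow> f \<subseteq> Y \<times> carrier G" for f using F by (auto simp: Fm_def)

  have stab: "cf x ` Fm = Fm" if x: "x \<in> carrier G" and nz: "nz K x K" for x
  proof -
    define K' where "K' = K \<inter> cj x K"
    \<comment> \<open>\<open>V K'\<close> is contained in \<open>V K\<close> and in its translate by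
      \<open>x\<close>. It is therefore covered by intersections of a coset with a translated coset,
      and a union of pair sets describes such an intersection.\<close>
    define F' where "F' = (\<lambda>(f, g). f \<union> cf x g) ` (F \<times> F)"
    have K': "eideal K'" "K' \<noteq> {\<o>}"
      using eideal_Int[OF K(1) eideal_cj[OF x K(1)]] nz_Int_cj[OF x K(1) K(1) nz] by (auto simp: K'_def)
    have "cover K' F'"
      unfolding cover_def
    proof (intro conjI K')
      show "finite F'" using finF by (simp add: F'_def)
      show "\<forall>f \<in> F'. finite f \<and> f \<subseteq> Y \<times> carrier G"
      proof
        fix f assume "f \<in> F'"
        then obtain a b where ab: "a \<in> F" "b \<in> F" "f = a \<union> cf x b" by (auto simp: F'_def)
        then have "finite f" using F(1) by (simp add: cf_def)
        moreover have "f \<subseteq> Y \<times> carrier G"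
          unfolding ab(3) using F(2)[OF ab(1)] cf_sub[OF x F(2)[OF ab(2)]] by (rule Un_least)
        ultimately show "finite f \<and> f \<subseteq> Y \<times> carrier G" ..
      qed
      show "V K' \<subseteq> \<Union>(U ` F')"
      proof
        fix h assume h: "h \<in> V K'"
        have hG: "h \<in> carrier G" and nzh: "nz K' h I" using h by (auto simp: V_def)
        have "nz K h I" using nzh by (rule nz_mono) (auto simp: K'_def)
        then have "h \<in> V K" using hG by (simp add: V_def)
        then obtain f where f: "f \<in> F" "h \<in> U f" using VK by blast
        have "nz (cj x K) h I" using nzh by (rule nz_mono) (auto simp: K'_def)
        then have "nz K (inv x \<otimes> h) I" by (rule nz_cj_left[OF x hG IS])
        then have "inv x \<otimes> h \<in> V K" using hG x by (simp add: V_def)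
        then obtain g where g: "g \<in> F" "inv x \<otimes> h \<in> U g" using VK by blast
        then have "h \<in> U (cf x g)" using U_cf[OF x hG _ F(2)] by simp
        then have "h \<in> U (f \<union> cf x g)" using f by (auto simp: U_def)
        then show "h \<in> \<Union>(U ` F')" using f g unfolding F'_def by blast
      qed
    qed
    moreover have mF': "m \<le> card f" if f': "f \<in> F'" for f
    proof -
      obtain a b where ab: "a \<in> F" "b \<in> F" "f = a \<union> cf x b" using f' by (auto simp: F'_def)
      have "card a \<le> card f" using ab F by (intro card_mono) (auto simp: cf_def)
      then show ?thesis using mF[OF ab(1)] by simp
    qed
    ultimately have "R (card {f \<in> F'. card f = m})" unfolding R_def by blast
    then have "n \<le> card {f \<in> F'. card f = m}" by (rule n_min)
    also have "\<dots> \<le> card (Fm \<inter> cf x ` Fm)"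
    proof (rule card_mono)
      \<comment> \<open>A union with exactly \<open>m\<close> pairs equals each of its two parts,
        because each already has at least \<open>m\<close>. So it belongs both to \<open>Fm\<close>
        and to the translate of \<open>Fm\<close>.\<close>
      show "{f \<in> F'. card f = m} \<subseteq> Fm \<inter> cf x ` Fm"
      proof
        fix f assume "f \<in> {f \<in> F'. card f = m}"
        then obtain a b where ab: "a \<in> F" "b \<in> F" "f = a \<union> cf x b" and fm: "card f = m"
          by (auto simp: F'_def)
        have finf: "finite f" using ab F by (auto simp: cf_def)
        have "a = f" using card_seteq[of f a] finf mF[OF ab(1)] fm ab by auto
        have cb: "cf x b = f"
          using card_seteq[of f "cf x b"] finf mF[OF ab(2)] fm ab cf_card[OF x F(2)[OF ab(2)]] by auto
        have "a \<in> Fm" using ab(1) fm \<open>a = f\<close> by (simp add: Fm_def)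
        moreover have "b \<in> Fm" using ab(2) fm cb cf_card[OF x F(2)[OF ab(2)]] by (simp add: Fm_def)
        ultimately show "f \<in> Fm \<inter> cf x ` Fm"
          using \<open>a = f\<close> cb[symmetric] by blast
      qed
    qed (use finFm in auto)
    finally have "card Fm \<le> card (Fm \<inter> cf x ` Fm)" using nF by (simp add: Fm_def)
    then have "Fm \<inter> cf x ` Fm = Fm" using card_seteq[of Fm "Fm \<inter> cf x ` Fm"] finFm by auto
    then show ?thesis
      using card_seteq[of "cf x ` Fm" Fm] finFm card_image_le[OF finFm, of "cf x"] by auto
  qed

  \<comment> \<open>The stabilizer of \<open>Fm\<close> keeps the conjugates of \<open>z\<close> in
    a finite set. Conjugated back by \<open>y1\<close>, it does the same for \<open>y\<close>, since
    \<open>z\<close> is the conjugate of \<open>y\<close> by \<open>y1\<close>.\<close>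
  define H where "H = {h \<in> carrier G. cf (cn y1 h) ` Fm = Fm}"
  have H_sub: "subgroup H G"
  proof
    show "H \<subseteq> carrier G" by (auto simp: H_def)
    show "\<one> \<in> H" using y1G cf_one FmF by (auto simp: H_def image_iff)
    have im: "cf (u \<otimes> v) ` Fm = cf u ` cf v ` Fm" if "u \<in> carrier G" "v \<in> carrier G" for u v
      unfolding image_image using cf_mult[OF that FmF] by (rule image_cong[OF refl])
    show "a \<otimes> b \<in> H" if "a \<in> H" "b \<in> H" for a b
    proof -
      have "cn y1 (a \<otimes> b) = cn y1 a \<otimes> cn y1 b"
        using that y1G by (simp add: H_def m_assoc mult_inv_cancel)
      then show ?thesis using that y1G im[of "cn y1 a" "cn y1 b"] by (auto simp: H_def)
    qed
    show "inv a \<in> H" if "a \<in> H" for a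
    proof -
      have aG: "a \<in> carrier G" and a: "cf (cn y1 a) ` Fm = Fm" using that by (auto simp: H_def)
      have "cf (cn y1 (inv a)) ` Fm = cf (cn y1 (inv a) \<otimes> cn y1 a) ` Fm"
        using im[of "cn y1 (inv a)" "cn y1 a"] aG y1G a by simp
      also have "cn y1 (inv a) \<otimes> cn y1 a = \<one>"
        using aG y1G by (simp add: m_assoc mult_inv_cancel)
      also have "cf \<one> ` Fm = Fm" using cf_one FmF by (auto simp: image_iff)
      finally show ?thesis using aG by (simp add: H_def)
    qed
  qed
  \<comment> \<open>\<open>K\<close> need not lie in \<open>I\<close>. As K S_y1 I is nonzero,
    \<open>K\<close> meets the conjugate of \<open>I\<close> by \<open>y1\<close>, and conjugating
    this intersection back gives the ideal \<open>K2\<close> inside \<open>I\<close> whose degrees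
    are controlled by \<open>H\<close>.\<close>
  define K1 where "K1 = K \<inter> cj y1 I"
  have K1: "eideal K1" "K1 \<noteq> {\<o>}"
    using eideal_Int[OF K(1) eideal_cj[OF y1G I(1)]] nz_Int_cj[OF y1G K(1) I(1)] y1
    by (auto simp: K1_def V_def)
  define K2 where "K2 = cj (inv y1) K1"
  have K2: "eideal K2" using eideal_cj[OF _ K1(1)] y1G by (simp add: K2_def)
  have "K2 \<noteq> {\<o>}" unfolding K2_def using cj_inv_nonzero[OF y1G K1, of I] by (simp add: K1_def)
  moreover have "K2 \<subseteq> I" unfolding K2_def using cj_inv_sub[OF y1G, of K1 I] by (simp add: K1_def)
  moreover have "h \<in> H" if hG: "h \<in> carrier G" and nz: "nz K2 h K2" for h
  proof -
    have "nz K1 (inv (inv y1) \<otimes> h) K2"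
      using nz_cj_left[of "inv y1" h K2 K1] nz hG y1G eideal_carrier[OF K2] by (auto simp: K2_def)
    then have "nz K1 (y1 \<otimes> h \<otimes> inv y1) K1"
      using nz_cj_right[of "inv y1" "y1 \<otimes> h" K1 K1] hG y1G eideal_carrier[OF K1(1)] by (auto simp: K2_def)
    then have "nz K (cn y1 h) K" by (rule nz_mono) (auto simp: K1_def)
    then show ?thesis using stab[of "cn y1 h"] hG y1G by (simp add: H_def)
  qed
  moreover have "finite ((\<lambda>h. cn h y) ` H)"
  proof (rule finite_subset)
    show "(\<lambda>h. cn h y) ` H \<subseteq> cn (inv y1) ` snd ` \<Union>Fm"
    proof (rule image_subsetI)
      fix h assume "h \<in> H"
      then have hG: "h \<in> carrier G" and st: "cf (cn y1 h) ` Fm = Fm" by (auto simp: H_def)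
      \<comment> \<open>Elements of the stabilizer carry the pair \<open>(y, z)\<close> to pairs in
        members of \<open>Fm\<close>, and these have finitely many second components.\<close>
      have "(y, cn (cn y1 h) z) \<in> cf (cn y1 h) f1" using yz by (force simp: cf_def)
      moreover have "cf (cn y1 h) f1 \<in> Fm" using st f1 by blast
      ultimately have "(y, cn (cn y1 h) z) \<in> \<Union>Fm" by blast
      then have "snd (y, cn (cn y1 h) z) \<in> snd ` \<Union>Fm" by (rule imageI)
      then have "cn (cn y1 h) z \<in> snd ` \<Union>Fm" by simp
      moreover have "cn h y = cn (inv y1) (cn (cn y1 h) z)"
        unfolding zy using hG y1G yG by (simp add: m_assoc inv_mult_group mult_inv_cancel)
      ultimately show "cn h y \<in> cn (inv y1) ` snd ` \<Union>Fm" by blast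
    qed
    show "finite (cn (inv y1) ` snd ` \<Union>Fm)" using finFm F by (auto simp: Fm_def)
  qed
  ultimately show ?thesis using that K2 H_sub yY by blast
qed

end

context locally_unital_graded_ring
begin

section \<open>Coefficients of products, and elements of minimal support\<close>

lemma pr_remove:
  assumes "a \<in> carrier S" "x \<in> carrier G" "g \<in> carrier G"
  shows "pr g (a \<ominus>\<^bsub>S\<^esub> pr x a) = (if g = x then \<o> else pr g a)"
proof -
  have "pr g (a \<ominus>\<^bsub>S\<^esub> pr x a) = pr g a \<oplus>\<^bsub>S\<^esub> \<ominus>\<^bsub>S\<^esub> pr g (pr x a)"
    using assms by (simp add: a_minus_def pr_add pr_closed)
  then show ?thesis using assms by (simp add: pr_pr pr_closed S.r_neg)
qed

text \<open>One term of the convolution formula is split off. Used repeatedly, it replaces the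
  expression of a coefficient as a finite sum.\<close>

lemma pr_mult_remove:
  assumes "a \<in> carrier S" "b \<in> carrier S" "x \<in> carrier G" "z \<in> carrier G"
  shows "pr z (a \<bullet> b) = pr z ((a \<ominus>\<^bsub>S\<^esub> pr x a) \<bullet> b) \<oplus>\<^bsub>S\<^esub> pr x a \<bullet> pr (inv x \<otimes> z) b"
proof -
  have c: "pr x a \<in> carrier S" using assms by (simp add: pr_closed)
  have "a = (a \<ominus>\<^bsub>S\<^esub> pr x a) \<oplus>\<^bsub>S\<^esub> pr x a"
    using assms c by (simp add: a_minus_def S.a_assoc S.l_neg)
  then have "a \<bullet> b = (a \<ominus>\<^bsub>S\<^esub> pr x a) \<bullet> b \<oplus>\<^bsub>S\<^esub> pr x a \<bullet> b"
    using assms c by (metis S.l_distr S.minus_closed)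
  then have "pr z (a \<bullet> b) = pr z ((a \<ominus>\<^bsub>S\<^esub> pr x a) \<bullet> b) \<oplus>\<^bsub>S\<^esub> pr z (pr x a \<bullet> b)"
    using assms c by (simp add: pr_add)
  then show ?thesis using assms pr_left[of "pr x a" x z b] by simp
qed

text \<open>Each term of the convolution vanishes, so the support of \<open>a\<close> can be emptied
  one element at a time without changing the coefficient.\<close>

lemma pr_mult_zero:
  assumes "a \<in> carrier S" "b \<in> carrier S" "z \<in> carrier G"
    and "\<And>x. x \<in> carrier G \<Longrightarrow> pr x a \<bullet> pr (inv x \<otimes> z) b = \<o>"
  shows "pr z (a \<bullet> b) = \<o>"
  using assms
proof (induction "card (supp a)" arbitrary: a rule: less_induct)
  case less
  show ?case
  proof (cases "supp a = {}")
    case True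
    then have "a = \<o>" using supp_empty less by blast
    then show ?thesis using less by simp
  next
    case False
    then obtain x where x: "x \<in> supp a" by blast
    then have xG: "x \<in> carrier G" by (simp add: supp_def)
    define a' where "a' = a \<ominus>\<^bsub>S\<^esub> pr x a"
    have a': "a' \<in> carrier S" using less xG by (simp add: a'_def pr_closed)
    have pra': "pr g a' = (if g = x then \<o> else pr g a)" if "g \<in> carrier G" for g
      unfolding a'_def using pr_remove less xG that by blast
    then have "supp a' = supp a - {x}" by (auto simp: supp_def split: if_splits)
    then have "card (supp a') < card (supp a)"
      using x finite_supp less.prems(1) by (metis card_Diff1_less)
    moreover have "pr g a' \<bullet> pr (inv g \<otimes> z) b = \<o>" if "g \<in> carrier G" for g
      using pra'[OF that] less.prems that xG by (simp add: pr_closed)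
    ultimately have "pr z (a' \<bullet> b) = \<o>" using less a' by blast
    then show ?thesis
      using pr_mult_remove[OF less.prems(1,2) xG less.prems(3)] less.prems xG by (simp add: a'_def)
  qed
qed

lemma pr_mult_single:
  assumes "a \<in> carrier S" "b \<in> carrier S" "z \<in> carrier G" "x \<in> carrier G"
    and "\<And>p. p \<in> carrier G \<Longrightarrow> p \<noteq> x \<Longrightarrow> pr p a \<bullet> pr (inv p \<otimes> z) b = \<o>"
  shows "pr z (a \<bullet> b) = pr x a \<bullet> pr (inv x \<otimes> z) b"
proof -
  have "pr z ((a \<ominus>\<^bsub>S\<^esub> pr x a) \<bullet> b) = \<o>"
    using assms by (intro pr_mult_zero) (auto simp: pr_closed pr_remove)
  then show ?thesis
    using pr_mult_remove[of a b x z] assms by (simp add: pr_closed)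
qed

lemma pr_left_right:
  assumes "s \<in> comp g" "t \<in> comp h" "a \<in> carrier S" "g \<in> carrier G" "h \<in> carrier G" "z \<in> carrier G"
  shows "pr z (s \<bullet> a \<bullet> t) = s \<bullet> pr (inv g \<otimes> z \<otimes> inv h) a \<bullet> t"
  using assms pr_right[of t h z "s \<bullet> a"] pr_left[of s g "z \<otimes> inv h" a] by (simp add: m_assoc)

lemma supp_left_right:
  assumes "s \<in> comp g" "t \<in> comp h" "a \<in> carrier S" "g \<in> carrier G" "h \<in> carrier G"
  shows "supp (s \<bullet> a \<bullet> t) \<subseteq> (\<lambda>x. g \<otimes> x \<otimes> h) ` supp a"
proof
  fix z assume z: "z \<in> supp (s \<bullet> a \<bullet> t)"
  then have zG: "z \<in> carrier G" by (simp add: supp_def)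
  define x where "x = inv g \<otimes> z \<otimes> inv h"
  have xG: "x \<in> carrier G" using assms zG by (simp add: x_def)
  have "pr x a \<noteq> \<o>" using z pr_left_right[OF assms zG] assms by (auto simp: supp_def x_def)
  moreover have "z = g \<otimes> x \<otimes> h" using assms zG by (simp add: x_def m_assoc mult_inv_cancel)
  ultimately show "z \<in> (\<lambda>x. g \<otimes> x \<otimes> h) ` supp a" using xG by (auto simp: supp_def)
qed

text \<open>Minimality forces a nonzero element of \<open>A\<close> supported in \<open>X\<close> to
  have support exactly \<open>X\<close>. Asking for all of \<open>I\<close> to be realized with one
  \<open>X\<close>, rather than for one element, lets \<open>I\<close> be shrunk later while
  \<open>X\<close> stays.\<close>

definition witness :: "'s set \<Rightarrow> 'g set \<Rightarrow> 's set \<Rightarrow> bool" where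
  "witness A X I \<longleftrightarrow> finite X \<and> X \<subseteq> carrier G \<and> \<one> \<in> X \<and>
    (\<forall>c \<in> I. \<exists>a \<in> A. supp a \<subseteq> X \<and> pr \<one> a = c) \<and> (\<forall>a \<in> A. a \<noteq> \<o> \<longrightarrow> card X \<le> card (supp a))"

lemma witness_mono: "witness A X I \<Longrightarrow> J \<subseteq> I \<Longrightarrow> witness A X J"
  by (auto simp: witness_def)

text \<open>This is how minimality is used: an image of \<open>X\<close> with a point removed has
  fewer than \<open>card X\<close> elements, too few for the support of a nonzero element of
  \<open>A\<close>.\<close>

lemma witness_zero:
  assumes w: "witness A X I" and a: "a \<in> A" and s: "supp a \<subseteq> f ` (X - {x})" and x: "x \<in> X"
  shows "a = \<o>"
proof (rule ccontr)
  assume "a \<noteq> \<o>"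
  then have "card X \<le> card (supp a)" using w a by (auto simp: witness_def)
  also have "\<dots> \<le> card (f ` (X - {x}))" using s w by (intro card_mono) (auto simp: witness_def)
  also have "\<dots> \<le> card (X - {x})" using w by (intro card_image_le) (auto simp: witness_def)
  also have "\<dots> < card X" using w x by (intro card_Diff1_less) (auto simp: witness_def)
  finally show False by simp
qed

lemma idealD:
  assumes "ideal A S"
  shows ideal_carr: "a \<in> A \<Longrightarrow> a \<in> carrier S"
    and ideal_l: "a \<in> A \<Longrightarrow> s \<in> carrier S \<Longrightarrow> s \<bullet> a \<in> A"
    and ideal_r: "a \<in> A \<Longrightarrow> s \<in> carrier S \<Longrightarrow> a \<bullet> s \<in> A"
    and ideal_add: "a \<in> A \<Longrightarrow> b \<in> A \<Longrightarrow> a \<oplus>\<^bsub>S\<^esub> b \<in> A"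
    and ideal_zero: "\<o> \<in> A"
    and ideal_neg: "a \<in> A \<Longrightarrow> \<ominus>\<^bsub>S\<^esub> a \<in> A"
  using ideal.Icarr[OF assms] ideal.I_l_closed[OF assms] ideal.I_r_closed[OF assms]
    additive_subgroup.a_closed[OF ideal.axioms(1)[OF assms]]
    additive_subgroup.zero_closed[OF ideal.axioms(1)[OF assms]]
    additive_subgroup.a_inv_closed[OF ideal.axioms(1)[OF assms]]
  by simp_all

text \<open>An element of \<open>A\<close> with smallest support is multiplied by a local unit
  factor, which shifts a chosen support point to the identity and does not enlarge the support. The
  coefficients at the identity of all elements of \<open>A\<close> supported in the resulting
  \<open>X\<close> form the ideal.\<close>

lemma ex_witness:
  assumes A: "ideal A S" "A \<noteq> {\<o>}"
  obtains X I where "eideal I" "I \<noteq> {\<o>}" "witness A X I"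
proof -
  have "\<exists>a. a \<in> A \<and> a \<noteq> \<o>" using A ideal_zero by blast
  then obtain a where a: "a \<in> A" "a \<noteq> \<o>"
    and min: "\<And>b. b \<in> A \<Longrightarrow> b \<noteq> \<o> \<Longrightarrow> card (supp a) \<le> card (supp b)"
    using ex_has_least_nat[of "\<lambda>a. a \<in> A \<and> a \<noteq> \<o>" _ "\<lambda>a. card (supp a)"] by metis
  have aS: "a \<in> carrier S" using a A ideal_carr by blast
  obtain x where x: "x \<in> supp a" using a aS supp_empty by blast
  then have xG: "x \<in> carrier G" and pxa: "pr x a \<noteq> \<o>" by (auto simp: supp_def)
  define t where "t = lu (inv x)"
  have t: "t \<in> comp (inv x)" using xG by (simp add: t_def)
  define a' where "a' = a \<bullet> t"
  have a'A: "a' \<in> A" using ideal_r[OF A(1) a(1)] t by (simp add: a'_def)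
  have pra': "pr z a' = pr (z \<otimes> x) a \<bullet> t" if "z \<in> carrier G" for z
    using pr_right[OF t _ that aS] xG by (simp add: a'_def)
  have pr1: "pr \<one> a' \<noteq> \<o>"
    using pra'[of \<one>] xG ex_right_unit[OF xG pr_in_comp[OF xG aS] pxa] by (simp add: t_def)
  have "supp a' \<subseteq> (\<lambda>z. z \<otimes> inv x) ` supp a"
  proof
    fix z assume z: "z \<in> supp a'"
    then have zG: "z \<in> carrier G" by (simp add: supp_def)
    have "pr (z \<otimes> x) a \<noteq> \<o>" using z pra'[OF zG] t by (auto simp: supp_def)
    then show "z \<in> (\<lambda>z. z \<otimes> inv x) ` supp a"
      using zG xG by (intro image_eqI[of _ _ "z \<otimes> x"]) (auto simp: supp_def m_assoc)
  qed
  then have "card (supp a') \<le> card (supp a)"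
    using finite_supp[OF aS] by (meson card_image_le card_mono finite_imageI le_trans)
  moreover define X where "X = supp a'"
  ultimately have cX: "card X \<le> card (supp b)" if "b \<in> A" "b \<noteq> \<o>" for b
    using min[OF that] by simp
  have a'S: "a' \<in> carrier S" using a'A A ideal_carr by blast
  define I where "I = {pr \<one> b | b. b \<in> A \<and> supp b \<subseteq> X}"
  have "witness A X I"
    using cX finite_supp[OF a'S] pr1 by (auto simp: witness_def X_def I_def supp_def)
  moreover have "pr \<one> a' \<in> I" using a'A by (auto simp: I_def X_def)
  then have "I \<noteq> {\<o>}" using pr1 by blast
  moreover have "eideal I"
    unfolding eideal_def
  proof (intro conjI ballI)
    show "I \<subseteq> comp \<one>" using A ideal_carr by (auto simp: I_def)
    have "supp \<o> \<subseteq> X" by (auto simp: supp_def)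
    then have "pr \<one> \<o> \<in> I" using ideal_zero[OF A(1)] unfolding I_def by blast
    then show "\<o> \<in> I" by simp
  next
    fix x y assume "x \<in> I" "y \<in> I"
    then obtain b c where bc: "b \<in> A" "supp b \<subseteq> X" "x = pr \<one> b" "c \<in> A" "supp c \<subseteq> X" "y = pr \<one> c"
      by (auto simp: I_def)
    have c: "b \<in> carrier S" "c \<in> carrier S" using bc A ideal_carr by auto
    have "z \<in> X" if "z \<in> supp (b \<oplus>\<^bsub>S\<^esub> c)" for z
    proof (rule ccontr)
      have zG: "z \<in> carrier G" using that by (simp add: supp_def)
      assume "z \<notin> X"
      then have "pr z b = \<o>" "pr z c = \<o>" using bc zG by (auto simp: supp_def)
      then show False using that c zG by (simp add: supp_def pr_add)
    qed
    then have "supp (b \<oplus>\<^bsub>S\<^esub> c) \<subseteq> X" by blast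
    moreover have "x \<oplus>\<^bsub>S\<^esub> y = pr \<one> (b \<oplus>\<^bsub>S\<^esub> c)" using bc c by (simp add: pr_add)
    ultimately show "x \<oplus>\<^bsub>S\<^esub> y \<in> I" using ideal_add[OF A(1) bc(1,4)] by (auto simp: I_def)
  next
    fix x assume "x \<in> I"
    then obtain b where b: "b \<in> A" "supp b \<subseteq> X" "x = pr \<one> b" by (auto simp: I_def)
    have c: "b \<in> carrier S" using b A ideal_carr by auto
    have "supp (\<ominus>\<^bsub>S\<^esub> b) \<subseteq> X" using b c by (auto simp: supp_def)
    moreover have "\<ominus>\<^bsub>S\<^esub> x = pr \<one> (\<ominus>\<^bsub>S\<^esub> b)" using b c by simp
    ultimately show "\<ominus>\<^bsub>S\<^esub> x \<in> I" using ideal_neg[OF A(1) b(1)] by (auto simp: I_def)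
  next
    fix r x assume r: "r \<in> comp \<one>" and "x \<in> I"
    then obtain b where b: "b \<in> A" "supp b \<subseteq> X" "x = pr \<one> b" by (auto simp: I_def)
    have c: "b \<in> carrier S" using b A ideal_carr by auto
    have l: "pr z (r \<bullet> b) = r \<bullet> pr z b" and rr: "pr z (b \<bullet> r) = pr z b \<bullet> r" if "z \<in> carrier G" for z
      using pr_left[OF r _ that c] pr_right[OF r _ that c] that by simp_all
    have "supp (r \<bullet> b) \<subseteq> X" "supp (b \<bullet> r) \<subseteq> X" using b l rr r by (auto simp: supp_def)
    moreover have "r \<bullet> b \<in> A" "b \<bullet> r \<in> A" using b A(1) r ideal_l ideal_r by auto
    ultimately show "r \<bullet> x \<in> I" "x \<bullet> r \<in> I"
      using l[of \<one>] rr[of \<one>] b(3) unfolding I_def by (metis (mono_tags, lifting) mem_Collect_eq one_closed)+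
  qed
  ultimately show ?thesis using that by blast
qed

text \<open>Placing an element of \<open>A\<close> between \<open>lu h\<close> and
  \<open>ru h\<close> conjugates its support, and by \<open>cj_decomp\<close> every element of
  \<open>cj h I\<close> arises as the new coefficient at the identity.\<close>

lemma witness_cj:
  assumes A: "ideal A S" and w: "witness A X I" and h: "h \<in> carrier G"
  shows "witness A ((\<lambda>x. h \<otimes> x \<otimes> inv h) ` X) (cj h I)"
  unfolding witness_def
proof (intro conjI ballI impI)
  have X: "finite X" "X \<subseteq> carrier G" "\<one> \<in> X" using w by (auto simp: witness_def)
  let ?Y = "(\<lambda>x. h \<otimes> x \<otimes> inv h) ` X"
  show "finite ?Y" "?Y \<subseteq> carrier G" using X h by auto
  show "\<one> \<in> ?Y" using X(3) h by (intro image_eqI[of _ _ \<one>]) auto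
  show "card ?Y \<le> card (supp a)" if "a \<in> A" "a \<noteq> \<o>" for a
    using that w card_image_le[OF X(1), of "\<lambda>x. h \<otimes> x \<otimes> inv h"] by (fastforce simp: witness_def)
  fix c assume c: "c \<in> cj h I"
  have "ru h \<bullet> c \<bullet> lu h \<in> I" by (rule cj_decomp(1)[OF h c])
  then obtain a where a: "a \<in> A" "supp a \<subseteq> X" "pr \<one> a = ru h \<bullet> c \<bullet> lu h"
    using w unfolding witness_def by metis
  have aS: "a \<in> carrier S" using a A ideal_carr by blast
  define b where "b = lu h \<bullet> a \<bullet> ru h"
  have "b \<in> A" unfolding b_def using h by (intro ideal_r[OF A ideal_l[OF A a(1)]]) auto
  moreover have "supp b \<subseteq> ?Y"
    using supp_left_right[OF lu_comp[OF h] ru_comp[OF h] aS] h a(2) unfolding b_def by blast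
  moreover have "pr \<one> b = c"
    using pr_left_right[OF lu_comp[OF h] ru_comp[OF h] aS h _ one_closed] h a(3)
      cj_decomp(2)[OF h c] by (simp add: b_def)
  ultimately show "\<exists>b \<in> A. supp b \<subseteq> ?Y \<and> pr \<one> b = c" by blast
qed

end

context prime_graded_ring
begin

text \<open>Multiply a witness on both sides by homogeneous elements of degrees \<open>u\<close> and
  \<open>v\<close> that end in factors from \<open>K\<close> and keep its coefficient at the
  identity alive. Both degrees lie in \<open>H\<close>, and a coefficient at \<open>x\<close> can
  survive only if \<open>u \<otimes> x \<otimes> v\<close> lies in \<open>H\<close>, that is, if
  \<open>x\<close> does. Minimality of \<open>X\<close> forbids losing any point.\<close>

lemma witness_subset_subgroup:
  assumes A: "ideal A S" and w: "witness A X K" and K: "eideal K" "K \<noteq> {\<o>}"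
    and H: "subgroup H G" and KH: "\<And>h. h \<in> carrier G \<Longrightarrow> nz K h K \<Longrightarrow> h \<in> H"
  shows "X \<subseteq> H"
proof -
  have X: "finite X" "X \<subseteq> carrier G" using w by (auto simp: witness_def)
  obtain c where c: "c \<in> K" "c \<noteq> \<o>" using K eideal_nonzero by blast
  have c1: "c \<in> comp \<one>" using c K eideal_comp by blast
  obtain u k s where u: "u \<in> carrier G" "k \<in> K" "s \<in> comp u" "k \<bullet> s \<bullet> c \<noteq> \<o>"
    using ex_mult_left_nonzero[OF K one_closed c1 c(2)] by blast
  have k1: "k \<in> comp \<one>" using u K eideal_comp by blast
  have uH: "u \<in> H" using KH[OF u(1)] u c by (auto simp: nz_def)
  have ks: "k \<bullet> s \<in> comp u" using k1 u by - (rule comp_mult[of _ \<one> _ u], auto)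
  have ksc: "k \<bullet> s \<bullet> c \<in> comp u" using ks c1 u by - (rule comp_mult[of _ u _ \<one>], auto)
  obtain v s' k' where v: "v \<in> carrier G" "s' \<in> comp v" "k' \<in> K" "k \<bullet> s \<bullet> c \<bullet> s' \<bullet> k' \<noteq> \<o>"
    using ex_mult_right_nonzero[OF K u(1) ksc u(4)] by blast
  have k'1: "k' \<in> comp \<one>" using v K eideal_comp by blast
  have sk': "s' \<bullet> k' \<in> comp v" using k'1 v by - (rule comp_mult[of _ v _ \<one>], auto)
  have car: "k \<in> carrier S" "s \<in> carrier S" "c \<in> carrier S" "s' \<in> carrier S" "k' \<in> carrier S"
    using k1 k'1 u v c1 comp_carrier by blast+
  have "c \<bullet> s' \<bullet> k' \<noteq> \<o>"
  proof
    assume "c \<bullet> s' \<bullet> k' = \<o>"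
    then have "k \<bullet> s \<bullet> (c \<bullet> s' \<bullet> k') = \<o>" using car by simp
    then show False using v(4) car by (simp add: S.m_assoc)
  qed
  then have vH: "v \<in> H" using KH[OF v(1)] v c by (auto simp: nz_def)
  obtain a where a: "a \<in> A" "supp a \<subseteq> X" "pr \<one> a = c" using w c(1) unfolding witness_def by metis
  have aS: "a \<in> carrier S" using a A ideal_carr by blast
  define a' where "a' = k \<bullet> s \<bullet> a \<bullet> (s' \<bullet> k')"
  have a'A: "a' \<in> A"
    unfolding a'_def using car by (intro ideal_r[OF A ideal_l[OF A a(1)]]) auto
  have pra': "pr z a' = k \<bullet> s \<bullet> pr (inv u \<otimes> z \<otimes> inv v) a \<bullet> (s' \<bullet> k')" if "z \<in> carrier G" for z
    unfolding a'_def using pr_left_right[OF ks sk' aS u(1) v(1) that] .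
  have "pr (u \<otimes> v) a' \<noteq> \<o>"
  proof -
    have "inv u \<otimes> (u \<otimes> v) \<otimes> inv v = \<one>" using u v by (simp add: m_assoc mult_inv_cancel)
    then have "pr (u \<otimes> v) a' = k \<bullet> s \<bullet> c \<bullet> (s' \<bullet> k')" using pra'[of "u \<otimes> v"] u v a(3) by simp
    then show ?thesis using v(4) car by (simp add: S.m_assoc)
  qed
  then have "a' \<noteq> \<o>" using u v by auto
  then have "card X \<le> card (supp a')" using w a'A by (auto simp: witness_def)
  also have "\<dots> \<le> card ((\<lambda>x. u \<otimes> x \<otimes> v) ` (X \<inter> H))"
  proof (rule card_mono)
    show "supp a' \<subseteq> (\<lambda>x. u \<otimes> x \<otimes> v) ` (X \<inter> H)"
    proof
      fix z assume z: "z \<in> supp a'"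
      then have zG: "z \<in> carrier G" by (simp add: supp_def)
      obtain x where x: "x \<in> supp a" "z = u \<otimes> x \<otimes> v"
        using supp_left_right[OF ks sk' aS u(1) v(1)] z unfolding a'_def by blast
      have xX: "x \<in> X" and xG: "x \<in> carrier G" using x a(2) X by auto
      have "inv u \<otimes> z \<otimes> inv v = x" using x u v xG by (simp add: m_assoc mult_inv_cancel)
      then have ne: "k \<bullet> s \<bullet> pr x a \<bullet> (s' \<bullet> k') \<noteq> \<o>" using z pra'[OF zG] by (simp add: supp_def)
      have px: "pr x a \<in> comp x" "pr x a \<in> carrier S" using aS xG by (auto simp: pr_closed)
      have "k \<bullet> (s \<bullet> pr x a \<bullet> s') \<bullet> k' \<noteq> \<o>" using ne car px by (simp add: S.m_assoc)
      moreover have "s \<bullet> pr x a \<in> comp (u \<otimes> x)" using u(1,3) px xG by - (rule comp_mult, auto)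
      then have "s \<bullet> pr x a \<bullet> s' \<in> comp (u \<otimes> x \<otimes> v)" by (rule comp_mult) (use u v xG in auto)
      ultimately have "nz K (u \<otimes> x \<otimes> v) K" using u v unfolding nz_def by blast
      then have zH: "u \<otimes> x \<otimes> v \<in> H" using KH u v xG by simp
      have "x = inv u \<otimes> (u \<otimes> x \<otimes> v) \<otimes> inv v" using u v xG by (simp add: m_assoc mult_inv_cancel)
      also have "\<dots> \<in> H"
        by (rule subgroup.m_closed[OF H subgroup.m_closed[OF H _ zH]])
          (use uH vH H in \<open>auto intro: subgroup.m_inv_closed\<close>)
      finally show "z \<in> (\<lambda>x. u \<otimes> x \<otimes> v) ` (X \<inter> H)" using x xX by blast
    qed
  qed (use X in auto)
  also have "\<dots> \<le> card (X \<inter> H)" using X by (intro card_image_le) auto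
  finally show ?thesis using card_seteq[of X "X \<inter> H"] X by blast
qed

end

section \<open>Products of nonzero ideals\<close>

context prime_graded_ring
begin

lemma cj_mono: "L \<subseteq> J \<Longrightarrow> cj h L \<subseteq> cj h J"
  by (auto simp: cj_def)

text \<open>Take c s d nonzero, with \<open>a\<close> and \<open>b\<close> having coefficients
  \<open>c\<close> and \<open>d\<close> at the identity. The coefficient of a s b = 0 at
  \<open>x0 \<otimes> k \<otimes> y0\<close> is a single product. Its vanishing removes a point from
  one support after the other, until c s d itself vanishes.\<close>

lemma no_annihilation_off_cosets:
  assumes A: "ideal A S" "witness A X K" and B: "ideal B S" "witness B Y K"
    and AB: "\<And>a b. a \<in> A \<Longrightarrow> b \<in> B \<Longrightarrow> a \<bullet> b = \<o>"
    and k: "k \<in> carrier G"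
    and x0: "x0 \<in> X" and y0: "y0 \<in> Y"
    and uniq: "\<And>x y. x \<in> X \<Longrightarrow> y \<in> Y \<Longrightarrow> x \<otimes> k \<otimes> y = x0 \<otimes> k \<otimes> y0 \<Longrightarrow> x = x0"
  shows "\<not> nz K k K"
proof
  assume "nz K k K"
  then obtain c s d where csd: "c \<in> K" "s \<in> comp k" "d \<in> K" "c \<bullet> s \<bullet> d \<noteq> \<o>"
    by (auto simp: nz_def)
  have X: "X \<subseteq> carrier G" and Y: "Y \<subseteq> carrier G" using A B by (auto simp: witness_def)
  have x0G: "x0 \<in> carrier G" and y0G: "y0 \<in> carrier G" using x0 y0 X Y by auto
  obtain a where a: "a \<in> A" "supp a \<subseteq> X" "pr \<one> a = c" using A csd unfolding witness_def by metis
  obtain b where b: "b \<in> B" "supp b \<subseteq> Y" "pr \<one> b = d" using B csd unfolding witness_def by metis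
  have aS: "a \<in> carrier S" and bS: "b \<in> carrier S" using a b A B ideal_carr by auto
  have cS: "c \<in> carrier S" "c \<in> comp \<one>"
    using pr_in_comp[OF one_closed aS] unfolding a(3) by simp_all
  have sS: "s \<in> carrier S" using csd(2) by simp
  have asA: "a \<bullet> s \<in> A" using ideal_r[OF A(1) a(1) sS] .
  have as: "pr p (a \<bullet> s) = pr (p \<otimes> inv k) a \<bullet> s" if "p \<in> carrier G" for p
    using pr_right[OF csd(2) k that aS] .
  define z where "z = x0 \<otimes> k \<otimes> y0"
  have "pr z (a \<bullet> s \<bullet> b) = pr (x0 \<otimes> k) (a \<bullet> s) \<bullet> pr (inv (x0 \<otimes> k) \<otimes> z) b"
  proof (rule pr_mult_single)
    fix p assume p: "p \<in> carrier G" "p \<noteq> x0 \<otimes> k"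
    show "pr p (a \<bullet> s) \<bullet> pr (inv p \<otimes> z) b = \<o>"
    proof (rule ccontr)
      assume ne: "\<not> ?thesis"
      have c: "p \<otimes> inv k \<in> carrier G" "inv p \<otimes> z \<in> carrier G"
        using p k x0G y0G by (auto simp: z_def)
      have "pr (p \<otimes> inv k) a \<noteq> \<o>"
        using ne as[OF p(1)] c sS bS by (auto simp: pr_closed)
      then have "p \<otimes> inv k \<in> X" using a(2) c by (auto simp: supp_def)
      moreover have "pr (inv p \<otimes> z) b \<noteq> \<o>"
        using ne c p aS sS by (auto simp: pr_closed)
      then have "inv p \<otimes> z \<in> Y" using b(2) c by (auto simp: supp_def)
      moreover have "(p \<otimes> inv k) \<otimes> k \<otimes> (inv p \<otimes> z) = x0 \<otimes> k \<otimes> y0"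
        using p k x0G y0G by (simp add: z_def m_assoc mult_inv_cancel)
      ultimately have "p \<otimes> inv k = x0" by (rule uniq)
      then have "p = x0 \<otimes> k" using p k x0G by (metis inv_solve_right)
      then show False using p by simp
    qed
  qed (use aS sS bS k x0G y0G in \<open>auto simp: z_def\<close>)
  also have "inv (x0 \<otimes> k) \<otimes> z = y0"
    using k x0G y0G by (simp add: z_def mult_inv_cancel)
  also have "pr (x0 \<otimes> k) (a \<bullet> s) = pr x0 a \<bullet> s"
    using as[of "x0 \<otimes> k"] k x0G by (simp add: m_assoc)
  finally have 0: "pr x0 a \<bullet> s \<bullet> pr y0 b = \<o>"
    using AB[OF asA b(1)] k x0G y0G by (simp add: z_def)

  \<comment> \<open>The coefficient of \<open>a\<close> at \<open>x0\<close> annihilates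
    \<open>t\<close>, so \<open>a \<bullet> t\<close> has lost a support point and is zero. Its
    coefficient at the degree of \<open>t\<close> gives \<open>c \<bullet> t = \<o>\<close>.\<close>
  define t where "t = s \<bullet> pr y0 b"
  have t: "t \<in> comp (k \<otimes> y0)" unfolding t_def using csd k y0G bS by - (rule comp_mult, auto)
  have at: "pr p (a \<bullet> t) = pr (p \<otimes> inv (k \<otimes> y0)) a \<bullet> t" if "p \<in> carrier G" for p
    using pr_right[OF t _ that aS] k y0G by simp
  have "a \<bullet> t = \<o>"
  proof (rule witness_zero[OF A(2) _ _ x0])
    show "a \<bullet> t \<in> A" using ideal_r[OF A(1) a(1)] t by simp
    show "supp (a \<bullet> t) \<subseteq> (\<lambda>x. x \<otimes> (k \<otimes> y0)) ` (X - {x0})"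
    proof
      fix p assume p: "p \<in> supp (a \<bullet> t)"
      then have pG: "p \<in> carrier G" by (simp add: supp_def)
      define x where "x = p \<otimes> inv (k \<otimes> y0)"
      have xG: "x \<in> carrier G" and px: "p = x \<otimes> (k \<otimes> y0)"
        using pG k y0G by (auto simp: x_def m_assoc)
      have ne: "pr x a \<bullet> t \<noteq> \<o>" using p at[OF pG] by (simp add: supp_def x_def)
      then have "pr x a \<noteq> \<o>" using t by auto
      then have "x \<in> X" using a(2) xG by (auto simp: supp_def)
      moreover have "x \<noteq> x0"
        using ne 0 aS sS bS x0G y0G by (auto simp: t_def S.m_assoc pr_closed)
      ultimately show "p \<in> (\<lambda>x. x \<otimes> (k \<otimes> y0)) ` (X - {x0})" using px by blast
    qed
  qed
  then have ct: "c \<bullet> t = \<o>"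
    using at[of "k \<otimes> y0"] k y0G a(3) by simp
  \<comment> \<open>The same argument in \<open>B\<close>: now \<open>r\<close> annihilates the
    coefficient of \<open>b\<close> at \<open>y0\<close>, so \<open>r \<bullet> b\<close> is
    zero.\<close>
  define r where "r = c \<bullet> s"
  have r: "r \<in> comp k" unfolding r_def using cS csd k by - (rule comp_mult[of _ \<one> _ k], auto)
  have rb: "pr p (r \<bullet> b) = r \<bullet> pr (inv k \<otimes> p) b" if "p \<in> carrier G" for p
    using pr_left[OF r k that bS] .
  have "r \<bullet> b = \<o>"
  proof (rule witness_zero[OF B(2) _ _ y0])
    show "r \<bullet> b \<in> B" using ideal_l[OF B(1) b(1)] r by simp
    show "supp (r \<bullet> b) \<subseteq> (\<lambda>y. k \<otimes> y) ` (Y - {y0})"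
    proof
      fix p assume p: "p \<in> supp (r \<bullet> b)"
      then have pG: "p \<in> carrier G" by (simp add: supp_def)
      define y where "y = inv k \<otimes> p"
      have yG: "y \<in> carrier G" and py: "p = k \<otimes> y"
        using pG k by (auto simp: y_def mult_inv_cancel)
      have ne: "r \<bullet> pr y b \<noteq> \<o>" using p rb[OF pG] by (simp add: supp_def y_def)
      then have "pr y b \<noteq> \<o>" using r by auto
      then have "y \<in> Y" using b(2) yG by (auto simp: supp_def)
      moreover have "y \<noteq> y0"
        using ne ct cS sS bS y0G by (auto simp: t_def r_def S.m_assoc pr_closed)
      ultimately show "p \<in> (\<lambda>y. k \<otimes> y) ` (Y - {y0})" using py by blast
    qed
  qed
  then have "r \<bullet> pr \<one> b = \<o>" using rb[OF k] k by simp
  then show False using csd(4) b(3) by (simp add: r_def)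
qed

theorem ideal_product_nonzero:
  assumes tf: "torsion_free G"
    and A: "ideal A S" "A \<noteq> {\<o>}" and B: "ideal B S" "B \<noteq> {\<o>}"
  shows "\<exists>a \<in> A. \<exists>b \<in> B. a \<bullet> b \<noteq> \<o>"
proof (rule ccontr)
  assume "\<not> ?thesis"
  then have AB: "\<And>a b. a \<in> A \<Longrightarrow> b \<in> B \<Longrightarrow> a \<bullet> b = \<o>" by blast
  obtain X I0 where I0: "eideal I0" "I0 \<noteq> {\<o>}" "witness A X I0" using ex_witness[OF A] by metis
  obtain Y' J0 where J0: "eideal J0" "J0 \<noteq> {\<o>}" "witness B Y' J0" using ex_witness[OF B] by metis
  obtain g where g: "g \<in> carrier G" "nz I0 g J0" using ex_nz[OF I0(1,2) J0(1,2)] by blast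
  \<comment> \<open>The two witnesses need a common ideal. Conjugating the one for \<open>B\<close>
    by \<open>g\<close> makes the ideals meet nontrivially, because I0 S_g J0 is nonzero.\<close>
  define I where "I = I0 \<inter> cj g J0"
  define Y where "Y = cn g ` Y'"
  have I: "eideal I" "I \<noteq> {\<o>}"
    using eideal_Int[OF I0(1) eideal_cj[OF g(1) J0(1)]] nz_Int_cj[OF g(1) I0(1) J0(1) g(2)]
    by (auto simp: I_def)
  have wA: "witness A X I" using I0(3) by (rule witness_mono) (auto simp: I_def)
  have wB: "witness B Y I"
    unfolding Y_def using witness_cj[OF B(1) J0(3) g(1)] by (rule witness_mono) (auto simp: I_def)
  have X: "finite X" "X \<subseteq> carrier G" "\<one> \<in> X" and Y: "finite Y" "Y \<subseteq> carrier G" "\<one> \<in> Y"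
    using wA wB by (auto simp: witness_def)

  define good where "good H K \<longleftrightarrow> subgroup H G \<and> eideal K \<and> K \<noteq> {\<o>} \<and> K \<subseteq> I \<and>
    (\<forall>h \<in> carrier G. nz K h K \<longrightarrow> h \<in> H)" for H K
  have "good (carrier G) I" using I by (auto simp: good_def subgroup_self)
  then have "case_prod good (carrier G, I)" by simp
  then have "\<exists>p. case_prod good p \<and> (\<forall>q. case_prod good q \<longrightarrow>
      card (Y \<inter> finite_orbit G (fst q)) \<le> card (Y \<inter> finite_orbit G (fst p)))"
    by (rule ex_has_greatest_nat[where b = "Suc (card Y)"])
      (use Y in \<open>auto simp: less_Suc_eq_le intro!: card_mono\<close>)
  then obtain H K where "good H K" and max: "\<And>H' K'. good H' K' \<Longrightarrow>
      card (Y \<inter> finite_orbit G H') \<le> card (Y \<inter> finite_orbit G H)"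
    by auto
  then have H: "subgroup H G" and K: "eideal K" "K \<noteq> {\<o>}" "K \<subseteq> I"
    and KH: "\<And>h. h \<in> carrier G \<Longrightarrow> nz K h K \<Longrightarrow> h \<in> H"
    by (auto simp: good_def)
  have HG: "H \<subseteq> carrier G" using H by (rule subgroup.subset)
  \<comment> \<open>Otherwise the degrees \<open>h\<close> with M S_h M nonzero are covered by
    finitely many cosets. The subgroup from \<open>stabilizer_of_cover\<close>, intersected with
    \<open>H\<close>, would then have one more element of \<open>Y\<close> with finite orbit,
    against the choice of \<open>H\<close>.\<close>
  have generic: "\<exists>h \<in> carrier G. nz M h M \<and> (\<forall>y \<in> Y - finite_orbit G H. cn h y \<notin> Z)"
    if M: "eideal M" "M \<noteq> {\<o>}" "M \<subseteq> K" and Z: "finite Z" for M Z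
  proof (rule ccontr)
    assume no: "\<not> ?thesis"
    have cov: "\<exists>y \<in> Y - finite_orbit G H. cn h y \<in> Z" if "h \<in> carrier G" "nz M h M" for h
      using no that by blast
    have fy: "finite (Y - finite_orbit G H)" "Y - finite_orbit G H \<subseteq> carrier G" using Y by auto
    obtain K' H' y where K': "eideal K'" "K' \<noteq> {\<o>}" "K' \<subseteq> M" and H': "subgroup H' G"
      and y: "y \<in> Y - finite_orbit G H"
      and KH': "\<And>h. h \<in> carrier G \<Longrightarrow> nz K' h K' \<Longrightarrow> h \<in> H'"
      and fin: "finite ((\<lambda>h. cn h y) ` H')"
      by (rule stabilizer_of_cover[OF M(1,2) fy Z cov]) (assumption | rule that | blast)+
    have "good (H \<inter> H') K'"
      unfolding good_def
    proof (intro conjI ballI impI K'(1,2))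
      show "subgroup (H \<inter> H') G" using H H' by (rule subgroups_Inter_pair)
      show "K' \<subseteq> I" using K' M K by blast
      fix h assume h: "h \<in> carrier G" "nz K' h K'"
      then have "nz K h K" using K'(3) M(3) by (auto intro: nz_mono)
      then show "h \<in> H \<inter> H'" using KH[OF h(1)] KH'[OF h] by blast
    qed
    then have "card (Y \<inter> finite_orbit G (H \<inter> H')) \<le> card (Y \<inter> finite_orbit G H)" by (rule max)
    moreover have "Y \<inter> finite_orbit G H \<subset> Y \<inter> finite_orbit G (H \<inter> H')"
    proof (rule psubsetI)
      show "Y \<inter> finite_orbit G H \<subseteq> Y \<inter> finite_orbit G (H \<inter> H')"
        by (auto simp: finite_orbit_def intro: finite_subset[OF image_mono[OF Int_lower1]])
      have "y \<in> finite_orbit G (H \<inter> H')"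
        using y fin Y by (auto simp: finite_orbit_def intro: finite_subset[OF image_mono[OF Int_lower2]])
      then show "Y \<inter> finite_orbit G H \<noteq> Y \<inter> finite_orbit G (H \<inter> H')" using y by blast
    qed
    then have "card (Y \<inter> finite_orbit G H) < card (Y \<inter> finite_orbit G (H \<inter> H'))"
      by (rule psubset_card_mono[rotated]) (use Y in simp)
    ultimately show False by simp
  qed

  have wAK: "witness A X K" and wBK: "witness B Y K" using wA wB K witness_mono by blast+
  have XH: "X \<subseteq> H" and YH: "Y \<subseteq> H"
    using witness_subset_subgroup[OF A(1) wAK K(1,2) H KH]
      witness_subset_subgroup[OF B(1) wBK K(1,2) H KH] by auto
  have fo: "subgroup (finite_orbit G H) G" using subgroup_finite_orbit[OF HG] .
  define X0 where "X0 = X \<inter> finite_orbit G H"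
  define Y0 where "Y0 = Y \<inter> finite_orbit G H"
  have X0: "finite X0" "X0 \<noteq> {}" "X0 \<subseteq> H \<inter> finite_orbit G H"
    and Y0: "finite Y0" "Y0 \<noteq> {}" "Y0 \<subseteq> H \<inter> finite_orbit G H"
    using X Y XH YH subgroup.one_closed[OF fo] by (auto simp: X0_def Y0_def)
  obtain x0 y0 where xy0: "x0 \<in> X0" "y0 \<in> Y0"
    and uniq: "\<And>x y. x \<in> X0 \<Longrightarrow> y \<in> Y0 \<Longrightarrow> x \<otimes> y = x0 \<otimes> y0 \<Longrightarrow> x = x0 \<and> y = y0"
    using unique_product_finite_orbit[OF tf H X0 Y0] by metis
  have x0: "x0 \<in> X" "x0 \<in> carrier G" "x0 \<in> finite_orbit G H"
    and y0: "y0 \<in> Y" "y0 \<in> carrier G" "y0 \<in> finite_orbit G H"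
    using xy0 X Y by (auto simp: X0_def Y0_def)
  \<comment> \<open>These are the values that \<open>cn k y\<close> would have to take if some
    further \<open>x \<in> X\<close>, with \<open>y\<close> of infinite orbit, gave the product
    \<open>x0 \<otimes> k \<otimes> y0\<close>.\<close>
  define Z0 where "Z0 = (\<lambda>x. inv x \<otimes> (x0 \<otimes> y0)) ` X"
  \<comment> \<open>As \<open>k\<close> commutes with \<open>y0\<close>, a second factorization
    reads x k y = x0 y0 k. For \<open>y\<close> in \<open>Y0\<close> it reduces to x y = x0 y0,
    which the unique product settles; for the other \<open>y\<close> it forces \<open>cn k y\<close>
    into \<open>Z0\<close>.\<close>
  have key: "\<not> nz K k K"
    if k: "k \<in> carrier G" and comm: "\<And>y. y \<in> Y0 \<Longrightarrow> k \<otimes> y = y \<otimes> k"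
      and off: "\<And>y. y \<in> Y - finite_orbit G H \<Longrightarrow> cn k y \<notin> Z0" for k
  proof (rule no_annihilation_off_cosets[OF A(1) wAK B(1) wBK AB k x0(1) y0(1)])
    fix x y assume xy: "x \<in> X" "y \<in> Y" "x \<otimes> k \<otimes> y = x0 \<otimes> k \<otimes> y0"
    have c: "x \<in> carrier G" "y \<in> carrier G" using xy X Y by auto
    have e: "x \<otimes> (k \<otimes> y) = x0 \<otimes> y0 \<otimes> k"
      using xy(3) comm[OF xy0(2)] c k x0 y0 by (simp add: m_assoc)
    show "x = x0"
    proof (cases "y \<in> finite_orbit G H")
      case True
      then have yY0: "y \<in> Y0" using xy by (simp add: Y0_def)
      have "x \<otimes> y \<otimes> k = x0 \<otimes> y0 \<otimes> k" using e comm[OF yY0] c k by (simp add: m_assoc)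
      then have xy': "x \<otimes> y = x0 \<otimes> y0" using c k x0 y0 by simp
      then have "x = x0 \<otimes> y0 \<otimes> inv y" using c x0 y0 by (simp add: inv_solve_right)
      also have "\<dots> \<in> finite_orbit G H"
        using True x0 y0 fo by (meson subgroup.m_closed subgroup.m_inv_closed)
      finally have "x \<in> X0" using xy by (simp add: X0_def)
      then show ?thesis using uniq yY0 xy' by blast
    next
      case False
      have "k \<otimes> y = inv x \<otimes> (x0 \<otimes> y0 \<otimes> k)"
        using e[symmetric] c k x0 y0 by (simp add: mult_inv_cancel)
      then have "cn k y = inv x \<otimes> (x0 \<otimes> y0)"
        using c k x0 y0 by (simp add: m_assoc)
      then show ?thesis using off False xy by (auto simp: Z0_def)
    qed
  qed

  \<comment> \<open>\<open>\<rho> h\<close> encodes the coset of \<open>h\<close> modulo the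
    centralizer of \<open>Y0\<close>. On \<open>H\<close> there are finitely many values, since the
    elements of \<open>Y0\<close> have finite orbits.\<close>
  define \<rho> where "\<rho> h = restrict (\<lambda>y. cn h y) Y0" for h
  have fin\<rho>: "finite (\<rho> ` H)"
  proof (rule finite_subset)
    show "\<rho> ` H \<subseteq> (\<Pi>\<^sub>E y \<in> Y0. (\<lambda>h. cn h y) ` H)" by (auto simp: \<rho>_def)
    show "finite (\<Pi>\<^sub>E y \<in> Y0. (\<lambda>h. cn h y) ` H)"
      using Y0 by (intro finite_PiE) (auto simp: finite_orbit_def)
  qed
  \<comment> \<open>The pigeonhole principle is phrased as a maximum: \<open>\<Sigma> M\<close>
    collects the classes of those \<open>s\<close> whose conjugate of \<open>K\<close> contains
    \<open>M\<close>. It grows as \<open>M\<close> shrinks, so it becomes stable at some nonzero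
    \<open>M\<close>.\<close>
  define \<Sigma> where "\<Sigma> M = \<rho> ` {s \<in> H. M \<subseteq> cj s K}" for M
  have fin\<Sigma>: "finite (\<Sigma> M)" for M using fin\<rho> by (rule rev_finite_subset) (auto simp: \<Sigma>_def)
  define nice where "nice M \<longleftrightarrow> eideal M \<and> M \<noteq> {\<o>} \<and> M \<subseteq> K" for M
  have "nice K" using K by (simp add: nice_def)
  then have "\<exists>M. nice M \<and> (\<forall>M'. nice M' \<longrightarrow> card (\<Sigma> M') \<le> card (\<Sigma> M))"
    by (rule ex_has_greatest_nat[where b = "Suc (card (\<rho> ` H))"])
      (auto simp: less_Suc_eq_le \<Sigma>_def intro!: card_mono fin\<rho>)
  then obtain M where M: "eideal M" "M \<noteq> {\<o>}" "M \<subseteq> K"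
    and Mmax: "\<And>M'. nice M' \<Longrightarrow> card (\<Sigma> M') \<le> card (\<Sigma> M)"
    by (auto simp: nice_def)
  have "\<forall>r \<in> \<Sigma> M. \<exists>s. s \<in> H \<and> M \<subseteq> cj s K \<and> \<rho> s = r" by (auto simp: \<Sigma>_def)
  then obtain \<sigma> where \<sigma>: "\<And>r. r \<in> \<Sigma> M \<Longrightarrow> \<sigma> r \<in> H \<and> M \<subseteq> cj (\<sigma> r) K \<and> \<rho> (\<sigma> r) = r"
    by metis
  \<comment> \<open>The element to be found is \<open>inv s \<otimes> t\<close> for a representative
    \<open>s\<close> not known before \<open>t\<close>. Excluding the conjugates of
    \<open>Z0\<close> by all representatives covers every case.\<close>
  define Z where "Z = (\<Union>r \<in> \<Sigma> M. cn (\<sigma> r) ` Z0)"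
  have "finite Z" using fin\<Sigma> X by (auto simp: Z_def Z0_def)
  from generic[OF M this] obtain t where t: "t \<in> carrier G"
    and "nz M t M \<and> (\<forall>y \<in> Y - finite_orbit G H. cn t y \<notin> Z)" by (rule bexE)
  then have nzt: "nz M t M" and tZ: "\<And>y. y \<in> Y - finite_orbit G H \<Longrightarrow> cn t y \<notin> Z"
    by simp_all
  have tH: "t \<in> H" using KH[OF t] nz_mono[OF nzt M(3) M(3)] by blast
  \<comment> \<open>\<open>M'\<close> lies in the conjugate of \<open>K\<close> by \<open>t\<close>,
    so the class of \<open>t\<close> is in \<open>\<Sigma> M'\<close>. By maximality it was already
    in \<open>\<Sigma> M\<close>, which yields \<open>s\<close> in the same class with
    \<open>M \<subseteq> cj s K\<close>.\<close>
  define M' where "M' = M \<inter> cj t M"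
  have "nice M'"
    using eideal_Int[OF M(1) eideal_cj[OF t M(1)]] nz_Int_cj[OF t M(1) M(1) nzt] M(3)
    by (auto simp: nice_def M'_def)
  then have "card (\<Sigma> M') \<le> card (\<Sigma> M)" by (rule Mmax)
  moreover have "\<Sigma> M \<subseteq> \<Sigma> M'" by (auto simp: \<Sigma>_def M'_def)
  ultimately have "\<Sigma> M' = \<Sigma> M" using card_seteq[OF fin\<Sigma>] by blast
  moreover have "M' \<subseteq> cj t K" using cj_mono[OF M(3)] by (auto simp: M'_def)
  then have "\<rho> t \<in> \<Sigma> M'" using tH by (auto simp: \<Sigma>_def)
  ultimately have \<rho>t: "\<rho> t \<in> \<Sigma> M" by simp
  define s where "s = \<sigma> (\<rho> t)"
  have s: "s \<in> H" "M \<subseteq> cj s K" "\<rho> s = \<rho> t" using \<sigma>[OF \<rho>t] by (auto simp: s_def)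
  have sG: "s \<in> carrier G" using s HG by auto
  \<comment> \<open>Equal classes make \<open>k\<close> commute with \<open>Y0\<close>. Removing the
    conjugation by \<open>s\<close> from the left ideal turns degree \<open>t\<close> into degree
    \<open>k\<close>.\<close>
  define k where "k = inv s \<otimes> t"
  have kG: "k \<in> carrier G" using sG t by (simp add: k_def)
  have "nz (cj s K) t K" using nz_mono[OF nzt s(2) M(3)] .
  then have "nz K k K"
    unfolding k_def using nz_cj_left[OF sG t _ _] eideal_carrier[OF K(1)] by blast
  moreover have "\<not> nz K k K"
  proof (rule key[OF kG])
    fix y assume y: "y \<in> Y0"
    then have yG: "y \<in> carrier G" using Y by (auto simp: Y0_def)
    have "cn t y = cn s y" using fun_cong[OF s(3), of y] y by (simp add: \<rho>_def)
    then show "k \<otimes> y = y \<otimes> k" using conj_eq_iff[OF t sG yG] by (simp add: k_def)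
  next
    fix y assume y: "y \<in> Y - finite_orbit G H"
    then have yG: "y \<in> carrier G" using Y by auto
    have "cn t y = cn s (cn k y)"
      using conj_mult[OF sG kG yG] sG t by (simp add: k_def mult_inv_cancel)
    then show "cn k y \<notin> Z0" using tZ[OF y] \<rho>t by (auto simp: Z_def s_def)
  qed
  ultimately show False by blast
qed

end

section \<open>Unital twisted partial actions\<close>

lemma (in ring) finsum_in_ideal:
  assumes I: "ideal I R" and f: "\<And>x. x \<in> A \<Longrightarrow> f x \<in> I"
  shows "finsum R f A \<in> I"
  using f
proof (induction A rule: infinite_finite_induct)
  case (infinite A)
  then show ?case using additive_subgroup.zero_closed[OF ideal.axioms(1)[OF I]] by simp
next
  case empty
  then show ?case using additive_subgroup.zero_closed[OF ideal.axioms(1)[OF I]] by simp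
next
  case (insert x A)
  have "f \<in> A \<rightarrow> carrier R" "f x \<in> carrier R" using insert.prems ideal.Icarr[OF I] by auto
  then have "finsum R f (insert x A) = f x \<oplus> finsum R f A" using insert.hyps by simp
  then show ?case
    using insert.IH insert.prems additive_subgroup.a_closed[OF ideal.axioms(1)[OF I]] by simp
qed

lemma identity_of_eq:
  assumes "is_identity_of R I u"
  shows "identity_of R I = u"
  unfolding identity_of_def
proof (rule the_equality)
  show "is_identity_of R I u" by (rule assms)
  show "v = u" if "is_identity_of R I v" for v
    using assms that unfolding is_identity_of_def by metis
qed

text \<open>The monoid laws already suffice for the inverse of the twist inside the ideal to behave
  as an inverse.\<close>

lemma (in ring) monoid_ideal_ring:
  assumes I: "ideal I R" and u: "is_identity_of R I u"
  shows "monoid (ideal_ring R I)"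
proof -
  have "identity_of R I = u" using u by (rule identity_of_eq)
  then show ?thesis
    using u ideal.Icarr[OF I] ideal.I_l_closed[OF I]
    by (intro monoidI) (auto simp: ideal_ring_def is_identity_of_def m_assoc)
qed

context unital_twisted_partial_action
begin

abbreviation rmult (infixl \<open>\<odot>\<close> 70) where "x \<odot> y \<equiv> x \<otimes>\<^bsub>R\<^esub> y"
abbreviation radd (infixl \<open>\<oplus>r\<close> 65) where "x \<oplus>r y \<equiv> x \<oplus>\<^bsub>R\<^esub> y"
abbreviation rzero (\<open>\<o>\<close>) where "\<o> \<equiv> \<zero>\<^bsub>R\<^esub>"

section \<open>The partial isomorphisms extended to the whole ring\<close>

definition e :: "'g \<Rightarrow> 'a" where "e g = identity_of R (D g)"

lemma D_carrier: "g \<in> carrier G \<Longrightarrow> r \<in> D g \<Longrightarrow> r \<in> carrier R"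
  by (rule ideal.Icarr[OF D_ideal])

lemma e_props:
  assumes g: "g \<in> carrier G"
  shows e_D: "e g \<in> D g" and e_left: "r \<in> D g \<Longrightarrow> e g \<odot> r = r"
    and e_right: "r \<in> D g \<Longrightarrow> r \<odot> e g = r" and e_comm: "s \<in> carrier R \<Longrightarrow> e g \<odot> s = s \<odot> e g"
proof -
  obtain u where u: "is_identity_of R (D g) u" "\<forall>r \<in> carrier R. u \<odot> r = r \<odot> u"
    using D_identity[OF g] by blast
  then have "e g = u" by (simp add: e_def identity_of_eq)
  then show "e g \<in> D g" "r \<in> D g \<Longrightarrow> e g \<odot> r = r" "r \<in> D g \<Longrightarrow> r \<odot> e g = r"
    "s \<in> carrier R \<Longrightarrow> e g \<odot> s = s \<odot> e g"
    using u by (auto simp: is_identity_of_def)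
qed

lemma e_carrier [simp]: "g \<in> carrier G \<Longrightarrow> e g \<in> carrier R"
  using e_D D_carrier by blast

lemma D_mult_left: "g \<in> carrier G \<Longrightarrow> r \<in> carrier R \<Longrightarrow> s \<in> D g \<Longrightarrow> r \<odot> s \<in> D g"
  and D_mult_right: "g \<in> carrier G \<Longrightarrow> r \<in> carrier R \<Longrightarrow> s \<in> D g \<Longrightarrow> s \<odot> r \<in> D g"
  using ideal.I_l_closed[OF D_ideal] ideal.I_r_closed[OF D_ideal] by auto

lemma D_zero: "g \<in> carrier G \<Longrightarrow> \<o> \<in> D g"
  and D_add: "g \<in> carrier G \<Longrightarrow> r \<in> D g \<Longrightarrow> s \<in> D g \<Longrightarrow> r \<oplus>r s \<in> D g"
  and D_minus: "g \<in> carrier G \<Longrightarrow> r \<in> D g \<Longrightarrow> \<ominus>\<^bsub>R\<^esub> r \<in> D g"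
  using additive_subgroup.zero_closed[OF ideal.axioms(1)[OF D_ideal]]
    additive_subgroup.a_closed[OF ideal.axioms(1)[OF D_ideal]]
    additive_subgroup.a_inv_closed[OF ideal.axioms(1)[OF D_ideal]]
  by auto

lemma D_one: "D \<one> = carrier R"
  using UP1 by simp

lemma e_one: "e \<one> = \<one>\<^bsub>R\<^esub>"
  unfolding e_def by (rule identity_of_eq) (simp add: is_identity_of_def D_one)

text \<open>An element of the intersection is its own product with the identity \<open>e h\<close>,
  so products of these ideals can be replaced by intersections throughout.\<close>

lemma D_prod: "g \<in> carrier G \<Longrightarrow> h \<in> carrier G \<Longrightarrow> D g \<cdot>\<^bsub>R\<^esub> D h = D g \<inter> D h"
proof (rule antisym)
  assume gh: "g \<in> carrier G" "h \<in> carrier G"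
  show "D g \<cdot>\<^bsub>R\<^esub> D h \<subseteq> D g \<inter> D h" using gh R.ideal_prod_inter D_ideal by blast
  show "D g \<inter> D h \<subseteq> D g \<cdot>\<^bsub>R\<^esub> D h"
  proof
    fix r assume r: "r \<in> D g \<inter> D h"
    then have "r \<odot> e h \<in> D g \<cdot>\<^bsub>R\<^esub> D h" using e_D gh by (intro ideal_prod.prod) auto
    then show "r \<in> D g \<cdot>\<^bsub>R\<^esub> D h" using r e_right gh by simp
  qed
qed

lemma ee_identity:
  assumes "g \<in> carrier G" "h \<in> carrier G"
  shows "is_identity_of R (D g \<inter> D h) (e g \<odot> e h)"
  using assms e_left e_right e_D D_carrier D_mult_left D_mult_right
  by (auto simp: is_identity_of_def R.m_assoc) (metis R.m_assoc e_carrier)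

lemma alpha_props:
  assumes g: "g \<in> carrier G"
  shows alpha_closed: "r \<in> D (inv g) \<Longrightarrow> \<alpha> g r \<in> D g"
    and alpha_mult: "r \<in> D (inv g) \<Longrightarrow> s \<in> D (inv g) \<Longrightarrow> \<alpha> g (r \<odot> s) = \<alpha> g r \<odot> \<alpha> g s"
    and alpha_add: "r \<in> D (inv g) \<Longrightarrow> s \<in> D (inv g) \<Longrightarrow> \<alpha> g (r \<oplus>r s) = \<alpha> g r \<oplus>r \<alpha> g s"
    and alpha_e: "\<alpha> g (e (inv g)) = e g"
    and alpha_image: "\<alpha> g ` D (inv g) = D g"
  using alpha_iso[OF g] by (auto simp: ring_iso_def ring_hom_def ideal_ring_def e_def bij_betw_def)

text \<open>Multiplying first by a central idempotent turns the partial isomorphism into an additive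
  and multiplicative map on all of \<open>R\<close>, sending the identity to \<open>e g\<close>.
  Domain conditions thereby become identities between idempotents.\<close>

definition al :: "'g \<Rightarrow> 'a \<Rightarrow> 'a" where "al g s = \<alpha> g (s \<odot> e (inv g))"

lemma se_D: "g \<in> carrier G \<Longrightarrow> s \<in> carrier R \<Longrightarrow> s \<odot> e (inv g) \<in> D (inv g)"
  using D_mult_left e_D by simp

lemma al_D: "g \<in> carrier G \<Longrightarrow> s \<in> carrier R \<Longrightarrow> al g s \<in> D g"
  by (simp add: al_def alpha_closed se_D)

lemma al_carrier [simp]: "g \<in> carrier G \<Longrightarrow> s \<in> carrier R \<Longrightarrow> al g s \<in> carrier R"
  using al_D D_carrier by blast

lemma al_mult:
  assumes "g \<in> carrier G" "r \<in> carrier R" "s \<in> carrier R"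
  shows "al g (r \<odot> s) = al g r \<odot> al g s"
proof -
  have "r \<odot> s \<odot> e (inv g) = (r \<odot> e (inv g)) \<odot> (s \<odot> e (inv g))"
    using assms e_right[OF _ se_D, of g s] e_comm[of "inv g" "s \<odot> e (inv g)"] by (simp add: R.m_assoc)
  then show ?thesis using assms by (simp add: al_def alpha_mult se_D)
qed

lemma al_add:
  assumes "g \<in> carrier G" "r \<in> carrier R" "s \<in> carrier R"
  shows "al g (r \<oplus>r s) = al g r \<oplus>r al g s"
  using assms by (simp add: al_def R.l_distr alpha_add se_D)

lemma al_one: "s \<in> carrier R \<Longrightarrow> al \<one> s = s"
  using UP1 by (simp add: al_def e_one)

lemma al_unit: "g \<in> carrier G \<Longrightarrow> al g \<one>\<^bsub>R\<^esub> = e g"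
  using alpha_e by (simp add: al_def)

lemma al_D_inv: "g \<in> carrier G \<Longrightarrow> s \<in> D (inv g) \<Longrightarrow> al g s = \<alpha> g s"
  using e_right by (simp add: al_def)

lemma al_zero: "g \<in> carrier G \<Longrightarrow> al g \<o> = \<o>"
  using al_add[of g \<o> \<o>] al_carrier[of g \<o>] by (simp add: R.add.l_cancel_one)

text \<open>By \<open>UP2\<close> the isomorphism maps \<open>D (inv g) \<inter> D h\<close> onto
  \<open>D g \<inter> D (g \<otimes> h)\<close>, and it must carry the identity of the first ideal
  to that of the second.\<close>

lemma al_e:
  assumes g: "g \<in> carrier G" and h: "h \<in> carrier G"
  shows "al g (e h) = e g \<odot> e (g \<otimes> h)"
proof -
  define x where "x = e h \<odot> e (inv g)"
  have im: "\<alpha> g ` (D (inv g) \<inter> D h) = D g \<inter> D (g \<otimes> h)"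
    using UP2[OF g h] g h by (simp add: D_prod)
  have x: "x \<in> D (inv g) \<inter> D h"
    unfolding x_def using g h D_mult_left D_mult_right e_D by simp
  have id: "is_identity_of R (D g \<inter> D (g \<otimes> h)) (e g \<odot> e (g \<otimes> h))"
    using ee_identity g h by simp
  have ax: "\<alpha> g x \<in> D g \<inter> D (g \<otimes> h)" using im x by blast
  have "e g \<odot> e (g \<otimes> h) \<in> \<alpha> g ` (D (inv g) \<inter> D h)"
    using im id by (auto simp: is_identity_of_def)
  then obtain z where z: "z \<in> D (inv g) \<inter> D h" "e g \<odot> e (g \<otimes> h) = \<alpha> g z" by blast
  have zR: "z \<in> carrier R" using z D_carrier[OF h] by blast
  have "x \<odot> z = z"
    using z g h zR e_left by (simp add: x_def R.m_assoc)
  then have "\<alpha> g x \<odot> (e g \<odot> e (g \<otimes> h)) = e g \<odot> e (g \<otimes> h)"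
    using z x g by (simp flip: alpha_mult)
  moreover have "\<alpha> g x \<odot> (e g \<odot> e (g \<otimes> h)) = \<alpha> g x"
    using id ax by (auto simp: is_identity_of_def)
  ultimately show ?thesis by (simp add: al_def x_def)
qed

lemma al_D2:
  assumes g: "g \<in> carrier G" and h: "h \<in> carrier G" and s: "s \<in> D h"
  shows "al g s \<in> D (g \<otimes> h)"
proof -
  have sR: "s \<in> carrier R" using s h D_carrier by blast
  have "al g s = al g (s \<odot> e h)" using s h e_right by simp
  also have "\<dots> = al g s \<odot> e g \<odot> e (g \<otimes> h)"
    using g h sR by (simp add: al_mult al_e R.m_assoc)
  also have "\<dots> \<in> D (g \<otimes> h)" using g h sR D_mult_left e_D by simp
  finally show ?thesis .
qed

definition w' :: "'g \<Rightarrow> 'g \<Rightarrow> 'a" where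
  "w' g h = inv\<^bsub>ideal_ring R (D g \<cdot>\<^bsub>R\<^esub> D (g \<otimes> h))\<^esub> (w g h)"

lemma w_props:
  assumes g: "g \<in> carrier G" and h: "h \<in> carrier G"
  shows w_D1: "w g h \<in> D g" and w_D2: "w g h \<in> D (g \<otimes> h)"
    and w'_D1: "w' g h \<in> D g" and w'_D2: "w' g h \<in> D (g \<otimes> h)"
    and w'_w: "w' g h \<odot> w g h = e g \<odot> e (g \<otimes> h)"
proof -
  let ?I = "D g \<inter> D (g \<otimes> h)"
  have id: "is_identity_of R ?I (e g \<odot> e (g \<otimes> h))" using ee_identity g h by simp
  have ideal: "ideal ?I R" using R.i_intersect D_ideal g h by simp
  interpret I: monoid "ideal_ring R ?I" using R.monoid_ideal_ring[OF ideal id] .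
  have eq: "D g \<cdot>\<^bsub>R\<^esub> D (g \<otimes> h) = ?I" using g h by (simp add: D_prod)
  have u: "w g h \<in> Units (ideal_ring R ?I)" using w_unit[OF g h] by (simp add: eq)
  have "w g h \<in> ?I" using I.Units_closed[OF u] by (simp add: ideal_ring_def)
  then show "w g h \<in> D g" "w g h \<in> D (g \<otimes> h)" by auto
  have "w' g h \<in> ?I" using I.Units_inv_closed[OF u] by (simp add: w'_def eq) (simp add: ideal_ring_def)
  then show "w' g h \<in> D g" "w' g h \<in> D (g \<otimes> h)" by auto
  have "w' g h \<otimes>\<^bsub>ideal_ring R ?I\<^esub> w g h = \<one>\<^bsub>ideal_ring R ?I\<^esub>"
    using I.Units_l_inv[OF u] by (simp add: w'_def eq)
  then show "w' g h \<odot> w g h = e g \<odot> e (g \<otimes> h)"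
    using id by (simp add: ideal_ring_def identity_of_eq)
qed

lemma w_carrier [simp]: "g \<in> carrier G \<Longrightarrow> h \<in> carrier G \<Longrightarrow> w g h \<in> carrier R"
  and w'_carrier [simp]: "g \<in> carrier G \<Longrightarrow> h \<in> carrier G \<Longrightarrow> w' g h \<in> carrier R"
  using w_D1 w'_D1 D_carrier by blast+

text \<open>\<open>UP3\<close> is applied to \<open>s\<close> cut down by the idempotents of
  \<open>inv h\<close> and \<open>inv (g \<otimes> h)\<close>. On the left this cut is part of the
  definition of \<open>al\<close>; on the right the resulting idempotents are absorbed by
  \<open>w' g h\<close>.\<close>

lemma al_al:
  assumes g: "g \<in> carrier G" and h: "h \<in> carrier G" and s: "s \<in> carrier R"
  shows "al g (al h s) = w g h \<odot> al (g \<otimes> h) s \<odot> w' g h"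
proof -
  have gh: "g \<otimes> h \<in> carrier G" using g h by simp
  define r where "r = s \<odot> e (inv (g \<otimes> h)) \<odot> e (inv h)"
  have r: "r \<in> D (inv h) \<inter> D (inv (g \<otimes> h))"
    unfolding r_def using g h gh s D_mult_left D_mult_right e_D by simp
  have "h \<otimes> inv (g \<otimes> h) = inv g" using g h by (simp add: inv_mult_group mult_inv_cancel)
  then have ah: "al h (s \<odot> e (inv (g \<otimes> h))) = al h s \<odot> e h \<odot> e (inv g)"
    using g h s by (simp add: al_mult al_e R.m_assoc)
  also have "\<dots> = al h s \<odot> e (inv g)" using g h s al_D e_right by simp
  finally have "\<alpha> h r = al h s \<odot> e (inv g)" by (simp add: r_def al_def)
  then have "al g (al h s) = \<alpha> g (\<alpha> h r)" by (simp add: al_def)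
  also have "\<dots> = w g h \<odot> \<alpha> (g \<otimes> h) r \<odot> w' g h"
    unfolding w'_def using UP3[OF g h] r g h by (simp add: D_prod)
  also have "\<alpha> (g \<otimes> h) r = al (g \<otimes> h) (s \<odot> e (inv h))"
    using e_comm[of "inv h" "e (inv (g \<otimes> h))"] g h gh s by (simp add: al_def r_def R.m_assoc)
  also have "\<dots> = al (g \<otimes> h) s \<odot> (e (g \<otimes> h) \<odot> e g)"
    using g h gh s by (simp add: al_mult al_e m_assoc)
  also have "w g h \<odot> (al (g \<otimes> h) s \<odot> (e (g \<otimes> h) \<odot> e g)) \<odot> w' g h = w g h \<odot> al (g \<otimes> h) s \<odot> w' g h"
    using g h gh s e_left[OF _ w'_D1[OF g h]] e_left[OF _ w'_D2[OF g h]] by (simp add: R.m_assoc)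
  finally show ?thesis .
qed

text \<open>This is \<open>UP5\<close> at \<open>r \<odot> e (inv g)\<close>; the factor
  \<open>e (inv g)\<close> is built into \<open>al g\<close>, so \<open>r\<close> need not lie in
  \<open>D (inv g)\<close>.\<close>

lemma al_cocycle:
  assumes g: "g \<in> carrier G" and h: "h \<in> carrier G" and l: "l \<in> carrier G"
    and r: "r \<in> D h" "r \<in> D (h \<otimes> l)"
  shows "al g (r \<odot> w h l) \<odot> w g (h \<otimes> l) = al g r \<odot> w g h \<odot> w (g \<otimes> h) l"
proof -
  have rR: "r \<in> carrier R" using r h D_carrier by blast
  define q where "q = r \<odot> e (inv g)"
  have q3: "q \<in> D (inv g)" "q \<in> D h" "q \<in> D (h \<otimes> l)"
    unfolding q_def using g h l r rR D_mult_left D_mult_right e_D by simp_all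
  have "q \<in> D (inv g) \<cdot>\<^bsub>R\<^esub> D h" using q3 g h by (simp add: D_prod)
  then have "q \<odot> e (h \<otimes> l) \<in> D (inv g) \<cdot>\<^bsub>R\<^esub> D h \<cdot>\<^bsub>R\<^esub> D (h \<otimes> l)"
    using e_D[of "h \<otimes> l"] h l by (intro ideal_prod.prod) auto
  then have "q \<in> D (inv g) \<cdot>\<^bsub>R\<^esub> D h \<cdot>\<^bsub>R\<^esub> D (h \<otimes> l)" using q3 h l e_right by simp
  from UP5[OF g h l this]
  have "\<alpha> g (q \<odot> w h l) \<odot> w g (h \<otimes> l) = \<alpha> g q \<odot> w g h \<odot> w (g \<otimes> h) l" .
  moreover have "q \<odot> w h l = r \<odot> w h l \<odot> e (inv g)"
    using e_comm[of "inv g" "w h l"] g h l rR by (simp add: q_def R.m_assoc)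
  ultimately show ?thesis by (simp add: al_def q_def)
qed

section \<open>Products of homogeneous elements\<close>

definition hmult :: "'g \<Rightarrow> 'g \<Rightarrow> 'a \<Rightarrow> 'a \<Rightarrow> 'a" where
  "hmult g h r s = r \<odot> al g s \<odot> w g h"

lemma hmult_D:
  assumes "g \<in> carrier G" "h \<in> carrier G" "r \<in> carrier R" "s \<in> carrier R"
  shows "hmult g h r s \<in> D (g \<otimes> h)"
  unfolding hmult_def using assms by (intro D_mult_left w_D2) auto

lemma hmult_carrier [simp]:
  assumes "g \<in> carrier G" "h \<in> carrier G" "r \<in> carrier R" "s \<in> carrier R"
  shows "hmult g h r s \<in> carrier R"
  unfolding hmult_def using assms by simp

lemma hmult_add_left:
  assumes "g \<in> carrier G" "h \<in> carrier G" "r \<in> carrier R" "r' \<in> carrier R" "s \<in> carrier R"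
  shows "hmult g h (r \<oplus>r r') s = hmult g h r s \<oplus>r hmult g h r' s"
  unfolding hmult_def using assms by (simp add: R.l_distr)

lemma hmult_add_right:
  assumes "g \<in> carrier G" "h \<in> carrier G" "r \<in> carrier R" "s \<in> carrier R" "s' \<in> carrier R"
  shows "hmult g h r (s \<oplus>r s') = hmult g h r s \<oplus>r hmult g h r s'"
  unfolding hmult_def using assms by (simp add: R.l_distr R.r_distr al_add)

lemma hmult_zero [simp]:
  assumes "g \<in> carrier G" "h \<in> carrier G" "r \<in> carrier R"
  shows "hmult g h \<o> r = \<o>" "hmult g h r \<o> = \<o>"
  unfolding hmult_def using assms by (simp_all add: al_zero)

lemma hmult_one_left: "g \<in> carrier G \<Longrightarrow> r \<in> carrier R \<Longrightarrow> s \<in> D g \<Longrightarrow> hmult \<one> g r s = r \<odot> s"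
  unfolding hmult_def using UP4[of g] e_right D_carrier by (simp add: al_one R.m_assoc flip: e_def)

lemma hmult_one_right: "g \<in> carrier G \<Longrightarrow> r \<in> carrier R \<Longrightarrow> s \<in> carrier R \<Longrightarrow> hmult g \<one> r s = r \<odot> al g s"
  unfolding hmult_def using UP4[of g] e_right al_D by (simp add: R.m_assoc flip: e_def)

text \<open>The cocycle identity moves \<open>al g\<close> past the inner twist, and the composition
  rule for \<open>al g\<close> and \<open>al h\<close> introduces \<open>w g h\<close> and its
  inverse. The inverse cancels against a second \<open>w g h\<close> up to idempotents, which the
  remaining twists absorb.\<close>

lemma hmult_assoc:
  assumes g: "g \<in> carrier G" and h: "h \<in> carrier G" and l: "l \<in> carrier G"
    and a: "a \<in> D g" and b: "b \<in> D h" and c: "c \<in> D l"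
  shows "hmult (g \<otimes> h) l (hmult g h a b) c = hmult g (h \<otimes> l) a (hmult h l b c)"
proof -
  have car: "a \<in> carrier R" "b \<in> carrier R" "c \<in> carrier R" using a b c g h l D_carrier by blast+
  have gh: "g \<otimes> h \<in> carrier G" and hl: "h \<otimes> l \<in> carrier G" using g h l by auto
  have bD: "b \<odot> al h c \<in> D h" "b \<odot> al h c \<in> D (h \<otimes> l)"
    using b car h l hl c by (auto intro: D_mult_left D_mult_right al_D2)
  have "hmult g (h \<otimes> l) a (hmult h l b c) = a \<odot> (al g (b \<odot> al h c \<odot> w h l) \<odot> w g (h \<otimes> l))"
    using g h l car hl by (simp add: hmult_def R.m_assoc)
  also have "\<dots> = a \<odot> (al g (b \<odot> al h c) \<odot> w g h \<odot> w (g \<otimes> h) l)"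
    using al_cocycle[OF g h l bD] by simp
  also have "al g (b \<odot> al h c) = al g b \<odot> (w g h \<odot> al (g \<otimes> h) c \<odot> w' g h)"
    using g h car by (simp add: al_mult al_al)
  also have "a \<odot> (al g b \<odot> (w g h \<odot> al (g \<otimes> h) c \<odot> w' g h) \<odot> w g h \<odot> w (g \<otimes> h) l) =
      a \<odot> al g b \<odot> w g h \<odot> al (g \<otimes> h) c \<odot> (w' g h \<odot> w g h) \<odot> w (g \<otimes> h) l"
    using g h l gh car by (simp add: R.m_assoc)
  also have "\<dots> = a \<odot> al g b \<odot> w g h \<odot> (e g \<odot> al (g \<otimes> h) c) \<odot> (e (g \<otimes> h) \<odot> w (g \<otimes> h) l)"
    using g h l gh car by (simp add: w'_w R.m_assoc e_comm[of g "al (g \<otimes> h) c"])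
  also have "\<dots> = a \<odot> al g b \<odot> (w g h \<odot> e g) \<odot> al (g \<otimes> h) c \<odot> w (g \<otimes> h) l"
    using g h l gh car e_left[OF gh w_D1[OF gh l]] by (simp add: R.m_assoc)
  also have "\<dots> = hmult (g \<otimes> h) l (hmult g h a b) c"
    using e_right[OF g w_D1[OF g h]] by (simp add: hmult_def)
  finally show ?thesis ..
qed

end

section \<open>The partial crossed product\<close>

context unital_twisted_partial_action
begin

definition T :: "('g \<Rightarrow> 'a) ring" where "T = partial_crossed_product G R \<alpha> D w"

abbreviation csupp :: "('g \<Rightarrow> 'a) \<Rightarrow> 'g set" where "csupp x \<equiv> coeff_support G R x"

abbreviation tmult (infixl \<open>\<star>\<close> 70) where "x \<star> y \<equiv> x \<otimes>\<^bsub>T\<^esub> y"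
abbreviation tadd (infixl \<open>\<oplus>t\<close> 65) where "x \<oplus>t y \<equiv> x \<oplus>\<^bsub>T\<^esub> y"

definition single :: "'g \<Rightarrow> 'a \<Rightarrow> 'g \<Rightarrow> 'a" where
  "single g r = (\<lambda>h \<in> carrier G. if h = g then r else \<o>)"

lemma T_carrier: "x \<in> carrier T \<longleftrightarrow> x \<in> (\<Pi>\<^sub>E g \<in> carrier G. D g) \<and> finite (csupp x)"
  by (simp add: T_def partial_crossed_product_def)

lemma T_D: "x \<in> carrier T \<Longrightarrow> g \<in> carrier G \<Longrightarrow> x g \<in> D g"
  by (auto simp: T_carrier)

lemma T_coeff [simp]: "x \<in> carrier T \<Longrightarrow> g \<in> carrier G \<Longrightarrow> x g \<in> carrier R"
  using T_D D_carrier by blast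

lemma T_finite: "x \<in> carrier T \<Longrightarrow> finite (csupp x)"
  by (simp add: T_carrier)

lemma T_eqI:
  "\<lbrakk>x \<in> carrier T; y \<in> carrier T; \<And>g. g \<in> carrier G \<Longrightarrow> x g = y g\<rbrakk> \<Longrightarrow> x = y"
  unfolding T_carrier by (auto intro: PiE_ext)

lemma T_zero: "\<zero>\<^bsub>T\<^esub> = (\<lambda>g \<in> carrier G. \<o>)"
  and T_one: "\<one>\<^bsub>T\<^esub> = single \<one> \<one>\<^bsub>R\<^esub>"
  and T_add: "g \<in> carrier G \<Longrightarrow> (x \<oplus>t y) g = x g \<oplus>r y g"
  by (simp_all add: T_def partial_crossed_product_def single_def)

lemma T_zero_coeff [simp]: "g \<in> carrier G \<Longrightarrow> \<zero>\<^bsub>T\<^esub> g = \<o>"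
  by (simp add: T_zero)

lemma T_zero_closed: "\<zero>\<^bsub>T\<^esub> \<in> carrier T"
proof -
  have "csupp \<zero>\<^bsub>T\<^esub> = {}" by (auto simp: coeff_support_def)
  then show ?thesis by (auto simp: T_carrier) (auto simp: T_zero D_zero)
qed

lemma T_add_closed:
  assumes "x \<in> carrier T" "y \<in> carrier T"
  shows "x \<oplus>t y \<in> carrier T"
proof -
  have "csupp (x \<oplus>t y) \<subseteq> csupp x \<union> csupp y"
    using assms by (auto simp: coeff_support_def T_add)
  then have "finite (csupp (x \<oplus>t y))" using assms T_finite by (meson finite_UnI finite_subset)
  moreover have "x \<oplus>t y \<in> (\<Pi>\<^sub>E g \<in> carrier G. D g)"
    using assms by (auto simp: T_add D_add T_D intro!: PiE_I)
      (simp add: T_def partial_crossed_product_def)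
  ultimately show ?thesis by (simp add: T_carrier)
qed

lemma single_closed:
  assumes "g \<in> carrier G" "r \<in> D g"
  shows "single g r \<in> carrier T"
proof -
  have "csupp (single g r) \<subseteq> {g}" by (auto simp: coeff_support_def single_def)
  then have "finite (csupp (single g r))" by (rule finite_subset) simp
  then show ?thesis using assms by (auto simp: T_carrier single_def D_zero)
qed

lemma single_coeff [simp]: "h \<in> carrier G \<Longrightarrow> single g r h = (if h = g then r else \<o>)"
  by (simp add: single_def)

lemma single_zero: "single g \<o> = \<zero>\<^bsub>T\<^esub>"
  by (auto simp: single_def T_zero)

lemma single_add: "r \<in> carrier R \<Longrightarrow> s \<in> carrier R \<Longrightarrow> single g (r \<oplus>r s) = single g r \<oplus>t single g s"
  by (auto simp: single_def T_def partial_crossed_product_def)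

lemma T_mult_outside: "k \<notin> carrier G \<Longrightarrow> (x \<star> y) k = undefined"
  by (simp add: T_def partial_crossed_product_def)

text \<open>The pairs in the product are indexed by their first component. Any finite set containing
  the support is allowed, so that sums for different \<open>x\<close> can be taken over one index
  set.\<close>

lemma T_mult:
  assumes x: "x \<in> carrier T" and y: "y \<in> carrier T" and k: "k \<in> carrier G"
    and F: "finite F" "csupp x \<subseteq> F" "F \<subseteq> carrier G"
  shows "(x \<star> y) k = finsum R (\<lambda>g. hmult g (inv g \<otimes> k) (x g) (y (inv g \<otimes> k))) F"
proof -
  let ?f = "\<lambda>(g, h). hmult g h (x g) (y h)"
  let ?P = "{(g, h) \<in> csupp x \<times> csupp y. g \<otimes> h = k}"
  let ?A = "{g \<in> csupp x. inv g \<otimes> k \<in> csupp y}"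
  have sG: "csupp x \<subseteq> carrier G" "csupp y \<subseteq> carrier G" by (auto simp: coeff_support_def)
  have im: "?P = (\<lambda>g. (g, inv g \<otimes> k)) ` ?A"
    using sG k by (auto simp: mult_inv_cancel image_iff subset_iff)
  have "(x \<star> y) k = finsum R ?f ?P"
    using k by (simp add: T_def partial_crossed_product_def hmult_def al_def e_def)
  also have "\<dots> = finsum R (\<lambda>g. ?f (g, inv g \<otimes> k)) ?A"
    unfolding im using sG k x y by (subst R.finsum_reindex) (auto simp: inj_on_def subset_iff)
  also have "\<dots> = finsum R (\<lambda>g. hmult g (inv g \<otimes> k) (x g) (y (inv g \<otimes> k))) F"
  proof (rule R.add.finprod_mono_neutral_cong_left)
    show "hmult g (inv g \<otimes> k) (x g) (y (inv g \<otimes> k)) = \<o>" if "g \<in> F - ?A" for g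
    proof -
      have gG: "g \<in> carrier G" using that F by auto
      then have "x g = \<o> \<or> y (inv g \<otimes> k) = \<o>" using that k by (auto simp: coeff_support_def)
      then show ?thesis using gG k x y by auto
    qed
  qed (use F x y k in auto)
  finally show ?thesis .
qed

lemma T_mult_closed:
  assumes x: "x \<in> carrier T" and y: "y \<in> carrier T"
  shows "x \<star> y \<in> carrier T"
proof -
  have sG: "csupp x \<subseteq> carrier G" by (auto simp: coeff_support_def)
  have "(x \<star> y) k \<in> D k" if k: "k \<in> carrier G" for k
  proof -
    have "hmult g (inv g \<otimes> k) (x g) (y (inv g \<otimes> k)) \<in> D k" if "g \<in> csupp x" for g
    proof -
      have "g \<in> carrier G" using that sG by auto
      then show ?thesis
        using hmult_D[of g "inv g \<otimes> k" "x g" "y (inv g \<otimes> k)"] k x y by (simp add: mult_inv_cancel)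
    qed
    then have "finsum R (\<lambda>g. hmult g (inv g \<otimes> k) (x g) (y (inv g \<otimes> k))) (csupp x) \<in> D k"
      by (rule R.finsum_in_ideal[OF D_ideal[OF k]])
    then show ?thesis
      using T_mult[OF x y k T_finite[OF x] subset_refl sG] by simp
  qed
  moreover have "finite (csupp (x \<star> y))"
  proof (rule finite_subset)
    show "csupp (x \<star> y) \<subseteq> (\<lambda>(g, h). g \<otimes> h) ` (csupp x \<times> csupp y)"
    proof
      fix k assume "k \<in> csupp (x \<star> y)"
      then have k: "k \<in> carrier G" and ne: "(x \<star> y) k \<noteq> \<o>" by (auto simp: coeff_support_def)
      have "\<exists>g \<in> csupp x. hmult g (inv g \<otimes> k) (x g) (y (inv g \<otimes> k)) \<noteq> \<o>"
      proof (rule ccontr)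
        assume "\<not> ?thesis"
        then have "finsum R (\<lambda>g. hmult g (inv g \<otimes> k) (x g) (y (inv g \<otimes> k))) (csupp x) = \<o>"
          by (intro R.add.finprod_one_eqI) blast
        then show False using ne T_mult[OF x y k T_finite[OF x] subset_refl sG] by simp
      qed
      then obtain g where g: "g \<in> csupp x" "hmult g (inv g \<otimes> k) (x g) (y (inv g \<otimes> k)) \<noteq> \<o>" by blast
      have gG: "g \<in> carrier G" using g sG by auto
      have "y (inv g \<otimes> k) \<noteq> \<o>" using g gG k x by auto
      then have "inv g \<otimes> k \<in> csupp y" using gG k by (simp add: coeff_support_def)
      moreover have "k = g \<otimes> (inv g \<otimes> k)" using gG k by (simp add: mult_inv_cancel)
      ultimately show "k \<in> (\<lambda>(g, h). g \<otimes> h) ` (csupp x \<times> csupp y)" using g(1) by force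
    qed
  qed (use x y T_finite in auto)
  moreover have "x \<star> y \<in> extensional (carrier G)"
    using T_mult_outside by (auto simp: extensional_def)
  ultimately show ?thesis by (auto simp: T_carrier PiE_def)
qed

lemma T_add_left: 
  assumes x: "x \<in> carrier T" and x': "x' \<in> carrier T" and y: "y \<in> carrier T"
  shows "(x \<oplus>t x') \<star> y = x \<star> y \<oplus>t x' \<star> y"
proof (rule T_eqI)
  fix k assume k: "k \<in> carrier G"
  let ?F = "csupp x \<union> csupp x'"
  have F: "finite ?F" "?F \<subseteq> carrier G" using x x' T_finite by (auto simp: coeff_support_def)
  have s: "csupp (x \<oplus>t x') \<subseteq> ?F" using x x' by (auto simp: coeff_support_def T_add)
  have "((x \<oplus>t x') \<star> y) k = finsum R (\<lambda>g. hmult g (inv g \<otimes> k) (x g) (y (inv g \<otimes> k)) \<oplus>r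
      hmult g (inv g \<otimes> k) (x' g) (y (inv g \<otimes> k))) ?F"
    unfolding T_mult[OF T_add_closed[OF x x'] y k F(1) s F(2)]
  proof (rule R.finsum_cong')
    fix g assume "g \<in> ?F"
    then have "g \<in> carrier G" using F by blast
    then show "hmult g (inv g \<otimes> k) ((x \<oplus>t x') g) (y (inv g \<otimes> k)) =
      hmult g (inv g \<otimes> k) (x g) (y (inv g \<otimes> k)) \<oplus>r hmult g (inv g \<otimes> k) (x' g) (y (inv g \<otimes> k))"
      using x x' y k by (simp add: T_add hmult_add_left)
  qed (use F x x' y k in auto)
  also have "\<dots> = (x \<star> y) k \<oplus>r (x' \<star> y) k"
    unfolding T_mult[OF x y k F(1) Un_upper1 F(2)] T_mult[OF x' y k F(1) Un_upper2 F(2)]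
    using F x x' y k by (intro R.finsum_addf) auto
  finally show "((x \<oplus>t x') \<star> y) k = (x \<star> y \<oplus>t x' \<star> y) k" using k by (simp add: T_add)
qed (use x x' y in \<open>auto intro: T_add_closed T_mult_closed\<close>)

lemma T_add_right: 
  assumes x: "x \<in> carrier T" and y: "y \<in> carrier T" and y': "y' \<in> carrier T"
  shows "x \<star> (y \<oplus>t y') = x \<star> y \<oplus>t x \<star> y'"
proof (rule T_eqI)
  fix k assume k: "k \<in> carrier G"
  have F: "finite (csupp x)" "csupp x \<subseteq> carrier G" using x T_finite by (auto simp: coeff_support_def)
  have "(x \<star> (y \<oplus>t y')) k = finsum R (\<lambda>g. hmult g (inv g \<otimes> k) (x g) (y (inv g \<otimes> k)) \<oplus>r
      hmult g (inv g \<otimes> k) (x g) (y' (inv g \<otimes> k))) (csupp x)"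
    unfolding T_mult[OF x T_add_closed[OF y y'] k F(1) subset_refl F(2)]
  proof (rule R.finsum_cong')
    fix g assume "g \<in> csupp x"
    then have "g \<in> carrier G" using F by blast
    then show "hmult g (inv g \<otimes> k) (x g) ((y \<oplus>t y') (inv g \<otimes> k)) =
      hmult g (inv g \<otimes> k) (x g) (y (inv g \<otimes> k)) \<oplus>r hmult g (inv g \<otimes> k) (x g) (y' (inv g \<otimes> k))"
      using x y y' k by (simp add: T_add hmult_add_right)
  qed (use F x y y' k in auto)
  also have "\<dots> = (x \<star> y) k \<oplus>r (x \<star> y') k"
    unfolding T_mult[OF x y k F(1) subset_refl F(2)] T_mult[OF x y' k F(1) subset_refl F(2)]
    using F x y y' k by (intro R.finsum_addf) auto
  finally show "(x \<star> (y \<oplus>t y')) k = (x \<star> y \<oplus>t x \<star> y') k" using k by (simp add: T_add)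
qed (use x y y' in \<open>auto intro: T_add_closed T_mult_closed\<close>)

lemma single_mult:
  assumes g: "g \<in> carrier G" and r: "r \<in> D g" and x: "x \<in> carrier T" and k: "k \<in> carrier G"
  shows "(single g r \<star> x) k = hmult g (inv g \<otimes> k) r (x (inv g \<otimes> k))"
proof -
  have s: "csupp (single g r) \<subseteq> {g}" by (auto simp: coeff_support_def single_def)
  show ?thesis
    using T_mult[OF single_closed[OF g r] x k _ s] g r x k D_carrier by simp
qed

lemma mult_single:
  assumes h: "h \<in> carrier G" and r: "r \<in> D h" and x: "x \<in> carrier T" and k: "k \<in> carrier G"
  shows "(x \<star> single h r) k = hmult (k \<otimes> inv h) h (x (k \<otimes> inv h)) r"
proof -
  define g where "g = k \<otimes> inv h"
  have gG: "g \<in> carrier G" using h k by (simp add: g_def)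
  have rR: "r \<in> carrier R" using r h D_carrier by blast
  let ?F = "insert g (csupp x)"
  have F: "finite ?F" "csupp x \<subseteq> ?F" "?F \<subseteq> carrier G"
    using x gG T_finite by (auto simp: coeff_support_def)
  have gh: "inv g \<otimes> k = h" using h k by (simp add: g_def inv_mult_group m_assoc)
  have "(x \<star> single h r) k = finsum R (\<lambda>p. if g = p then hmult p h (x p) r else \<o>) ?F"
    unfolding T_mult[OF x single_closed[OF h r] k F]
  proof (rule R.finsum_cong')
    fix p assume "p \<in> ?F"
    then have pG: "p \<in> carrier G" using F by blast
    have "inv p \<otimes> k = h \<longleftrightarrow> p = g"
    proof
      assume "inv p \<otimes> k = h"
      then have "k = p \<otimes> h" using pG k by (metis mult_inv_cancel(2))
      then show "p = g" using pG h by (simp add: g_def m_assoc)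
    qed (use gh in simp)
    then show "hmult p (inv p \<otimes> k) (x p) (single h r (inv p \<otimes> k)) = (if g = p then hmult p h (x p) r else \<o>)"
      using pG k x by auto
  qed (use F x rR h in auto)
  also have "\<dots> = hmult g h (x g) r"
    using F x rR h by (intro R.finsum_singleton) auto
  finally show ?thesis by (simp add: g_def)
qed

lemma single_single:
  assumes "g \<in> carrier G" "h \<in> carrier G" "r \<in> D g" "s \<in> D h"
  shows "single g r \<star> single h s = single (g \<otimes> h) (hmult g h r s)"
proof (rule T_eqI)
  have c: "r \<in> carrier R" "s \<in> carrier R" using assms D_carrier by blast+
  show "single g r \<star> single h s \<in> carrier T" using assms by (intro T_mult_closed single_closed)
  show "single (g \<otimes> h) (hmult g h r s) \<in> carrier T" using assms c by (intro single_closed hmult_D) auto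
  fix k assume k: "k \<in> carrier G"
  have "inv g \<otimes> k = h \<longleftrightarrow> k = g \<otimes> h" using assms k by (auto simp: mult_inv_cancel)
  then show "(single g r \<star> single h s) k = single (g \<otimes> h) (hmult g h r s) k"
    using single_mult[OF assms(1,3) single_closed[OF assms(2,4)] k] assms k c by auto
qed

text \<open>Coefficients are split off one at a time. This reduces additive statements,
  associativity in particular, to homogeneous elements.\<close>

lemma T_induct [consumes 1, case_names zero single add]:
  assumes x: "x \<in> carrier T"
    and zero: "P \<zero>\<^bsub>T\<^esub>" and single: "\<And>g r. g \<in> carrier G \<Longrightarrow> r \<in> D g \<Longrightarrow> P (single g r)"
    and add: "\<And>x y. x \<in> carrier T \<Longrightarrow> y \<in> carrier T \<Longrightarrow> P x \<Longrightarrow> P y \<Longrightarrow> P (x \<oplus>t y)"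
  shows "P x"
  using x
proof (induction "card (csupp x)" arbitrary: x rule: less_induct)
  case less
  show ?case
  proof (cases "csupp x = {}")
    case True
    then have "x = \<zero>\<^bsub>T\<^esub>" using less.prems T_zero_closed by (intro T_eqI) (auto simp: coeff_support_def)
    then show ?thesis using zero by simp
  next
    case False
    then obtain g where g: "g \<in> csupp x" by blast
    then have gG: "g \<in> carrier G" by (simp add: coeff_support_def)
    define y where "y = x(g := \<o>)"
    have sy: "csupp y = csupp x - {g}" by (auto simp: coeff_support_def y_def)
    have y: "y \<in> carrier T"
      using less.prems gG D_zero unfolding T_carrier sy by (auto simp: y_def PiE_def extensional_def)
    have "card (csupp y) < card (csupp x)"
      unfolding sy using g T_finite[OF less.prems] by (rule card_Diff1_less[rotated])
    then have "P y" using less.hyps y by blast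
    moreover have "x = single g (x g) \<oplus>t y"
      using less.prems y gG T_D by (intro T_eqI T_add_closed single_closed) (auto simp: T_add y_def)
    ultimately show ?thesis
      using add[of "single g (x g)" y] single[OF gG] single_closed[OF gG] T_D[OF less.prems gG] y by simp
  qed
qed

lemma T_mult_zero:
  assumes x: "x \<in> carrier T"
  shows "\<zero>\<^bsub>T\<^esub> \<star> x = \<zero>\<^bsub>T\<^esub>" "x \<star> \<zero>\<^bsub>T\<^esub> = \<zero>\<^bsub>T\<^esub>"
proof -
  show "\<zero>\<^bsub>T\<^esub> \<star> x = \<zero>\<^bsub>T\<^esub>"
    using single_mult[OF one_closed _ x, of \<o>] x T_zero_closed
    by (intro T_eqI T_mult_closed) (auto simp: D_zero single_zero)
  show "x \<star> \<zero>\<^bsub>T\<^esub> = \<zero>\<^bsub>T\<^esub>"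
    using mult_single[OF one_closed _ x, of \<o>] x T_zero_closed
    by (intro T_eqI T_mult_closed) (auto simp: D_zero single_zero)
qed

lemma T_assoc:
  assumes x: "x \<in> carrier T" and y: "y \<in> carrier T" and z: "z \<in> carrier T"
  shows "x \<star> y \<star> z = x \<star> (y \<star> z)"
  using x
proof (induction rule: T_induct)
  case zero
  then show ?case using y z by (simp add: T_mult_zero T_mult_closed)
next
  case (add x x')
  then show ?case using y z by (simp add: T_add_left T_mult_closed)
next
  case (single g r)
  note x = single
  have xT: "single g r \<in> carrier T" using x by (rule single_closed)
  show ?case using y
  proof (induction rule: T_induct)
    case zero
    then show ?case using xT z by (simp add: T_mult_zero)
  next
    case (add y y')
    then show ?case using xT z by (simp add: T_add_left T_add_right T_mult_closed)
  next
    case (single h s)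
    note y = single
    have yT: "single h s \<in> carrier T" using y by (rule single_closed)
    show ?case using z
    proof (induction rule: T_induct)
      case zero
      then show ?case using xT yT by (simp add: T_mult_zero T_mult_closed)
    next
      case (add z z')
      then show ?case using xT yT by (simp add: T_add_right T_mult_closed)
    next
      case (single l t)
      have c: "r \<in> carrier R" "s \<in> carrier R" "t \<in> carrier R" using x y single D_carrier by blast+
      show ?case
        using x y single c by (simp add: single_single hmult_D hmult_assoc m_assoc)
    qed
  qed
qed

lemma one_D: "\<one>\<^bsub>R\<^esub> \<in> D \<one>"
  by (simp add: D_one)

lemma ring_T: "ring T"
proof (rule ringI)
  show "abelian_group T"
  proof (rule abelian_groupI)
    fix x assume x: "x \<in> carrier T"
    define y where "y = (\<lambda>g \<in> carrier G. \<ominus>\<^bsub>R\<^esub> x g)"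
    have "csupp y \<subseteq> csupp x" using x by (auto simp: coeff_support_def y_def)
    then have "finite (csupp y)" using T_finite[OF x] by (rule finite_subset)
    then have y: "y \<in> carrier T" using x D_minus[OF _ T_D[OF x]] by (auto simp: T_carrier y_def)
    moreover have "y \<oplus>t x = \<zero>\<^bsub>T\<^esub>"
      using x y T_zero_closed by (intro T_eqI T_add_closed) (auto simp: T_add y_def R.l_neg)
    ultimately show "\<exists>y \<in> carrier T. y \<oplus>t x = \<zero>\<^bsub>T\<^esub>" by blast
  qed (auto intro!: T_add_closed T_zero_closed T_eqI simp: T_add R.add.m_ac)
  show "monoid T"
  proof (rule monoidI)
    show "\<one>\<^bsub>T\<^esub> \<in> carrier T" unfolding T_one using one_D by (intro single_closed) auto
    show "\<one>\<^bsub>T\<^esub> \<star> x = x" if x: "x \<in> carrier T" for x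
      unfolding T_one using x single_mult[OF one_closed one_D x] one_D
      by (intro T_eqI T_mult_closed single_closed) (auto simp: hmult_one_left T_D)
    show "x \<star> \<one>\<^bsub>T\<^esub> = x" if x: "x \<in> carrier T" for x
      unfolding T_one using x mult_single[OF one_closed one_D x] one_D
      by (intro T_eqI T_mult_closed single_closed) (auto simp: hmult_one_right al_unit e_right T_D)
  qed (auto simp: T_mult_closed T_assoc)
qed (auto simp: T_add_left T_add_right)

end

section \<open>Primeness of the partial crossed product\<close>

text \<open>In the definition of invariance, I 1_g is a set of finite sums; each such sum is a
  single product with the fixed right factor.\<close>

lemma (in ring) ideal_prod_singleton:
  assumes I: "ideal I R" and u: "u \<in> carrier R" and t: "t \<in> I \<cdot> {u}"
  shows "\<exists>n \<in> I. t = n \<otimes> u"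
  using t
proof induction
  case (prod i j)
  then show ?case by blast
next
  case (sum s t)
  then obtain m n where mn: "m \<in> I" "n \<in> I" "s = m \<otimes> u" "t = n \<otimes> u" by blast
  then have "s \<oplus> t = (m \<oplus> n) \<otimes> u" using ideal.Icarr[OF I] u by (simp add: l_distr)
  then show ?case using mn additive_subgroup.a_closed[OF ideal.axioms(1)[OF I]] by blast
qed

lemma (in ring) ideal_prod_eq_zero_iff:
  assumes "\<zero> \<in> I" "\<zero> \<in> J"
  shows "I \<cdot> J = {\<zero>} \<longleftrightarrow> (\<forall>i \<in> I. \<forall>j \<in> J. i \<otimes> j = \<zero>)"
proof
  assume "I \<cdot> J = {\<zero>}"
  then show "\<forall>i \<in> I. \<forall>j \<in> J. i \<otimes> j = \<zero>" using ideal_prod.prod[of _ I _ J R] by auto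
next
  assume z: "\<forall>i \<in> I. \<forall>j \<in> J. i \<otimes> j = \<zero>"
  have "t = \<zero>" if "t \<in> I \<cdot> J" for t
    using that by induction (auto simp: z)
  moreover have "\<zero> \<in> I \<cdot> J" using ideal_prod.prod[OF assms, of R] by simp
  ultimately show "I \<cdot> J = {\<zero>}" by blast
qed

context unital_twisted_partial_action
begin

section \<open>The grading of the crossed product\<close>

definition pr :: "'g \<Rightarrow> ('g \<Rightarrow> 'a) \<Rightarrow> 'g \<Rightarrow> 'a" where "pr g x = single g (x g)"

text \<open>The homogeneous elements with coefficients \<open>e g\<close> and \<open>c\<close> are
  mutually inverse up to the idempotent \<open>e g\<close>. Conjugation by them realizes
  \<open>al g\<close> inside the crossed product, which links invariance to multiplication.\<close>

lemma ex_unit_pair: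
  assumes g: "g \<in> carrier G"
  obtains c where "c \<in> D (inv g)"
    "\<And>n. n \<in> carrier R \<Longrightarrow> single g (e g) \<star> single \<one> n \<star> single (inv g) c = single \<one> (al g n)"
    "single g (e g) \<star> single (inv g) c = single \<one> (e g)"
proof -
  have ig: "inv g \<in> carrier G" using g by simp
  \<comment> \<open>The coefficient \<open>c\<close> is the preimage under \<open>\<alpha> g\<close>
    of the inverse of \<open>w g (inv g)\<close>, so that the twist cancels in the product.\<close>
  have "w' g (inv g) \<in> \<alpha> g ` D (inv g)" using w'_D1[OF g ig] alpha_image[OF g] by simp
  then obtain c where c: "c \<in> D (inv g)" "\<alpha> g c = w' g (inv g)" by auto
  have alc: "al g c = w' g (inv g)" using c al_D_inv[OF g] by simp
  have cR: "c \<in> carrier R" using c ig D_carrier by blast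
  have w'w: "w' g (inv g) \<odot> w g (inv g) = e g"
    using w'_w[OF g ig] g by (simp add: e_one)
  have m: "hmult g (inv g) r c = r" if "r \<in> D g" for r
    using that g D_carrier e_right by (simp add: hmult_def alc R.m_assoc w'w)
  have "single g (e g) \<star> single \<one> n \<star> single (inv g) c = single \<one> (al g n)" if n: "n \<in> carrier R" for n
  proof -
    have "hmult g \<one> (e g) n = al g n"
      using g n by (simp add: hmult_one_right e_left al_D)
    then show ?thesis
      using g ig n c by (simp add: single_single e_D D_one al_D m)
  qed
  moreover have "single g (e g) \<star> single (inv g) c = single \<one> (e g)"
    using g ig c by (simp add: single_single e_D m)
  ultimately show ?thesis using that c by blast
qed

lemma single_pr: "s \<in> carrier T \<Longrightarrow> pr g s = s \<Longrightarrow> s = single g (s g)"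
  by (simp add: pr_def)

lemma pr_single: "g \<in> carrier G \<Longrightarrow> pr g (single g r) = single g r"
  by (simp add: pr_def)

text \<open>The local unit in degree \<open>g\<close> is \<open>single \<one> (e g)\<close>,
  factored by \<open>ex_unit_pair\<close>.\<close>

lemma graded_T: "locally_unital_graded_ring G T pr"
proof (intro locally_unital_graded_ring.intro locally_unital_graded_ring_axioms.intro)
  show "group G" by (rule is_group)
  show "ring T" by (rule ring_T)
  fix g assume g: "g \<in> carrier G"
  show "pr g x \<in> carrier T" if "x \<in> carrier T" for x
    using that g by (simp add: pr_def single_closed T_D)
  show "pr g (x \<oplus>t y) = pr g x \<oplus>t pr g y" if "x \<in> carrier T" "y \<in> carrier T" for x y
    using that g by (simp add: pr_def T_add single_add)
  show "pr g (pr h x) = (if g = h then pr h x else \<zero>\<^bsub>T\<^esub>)" if "h \<in> carrier G" "x \<in> carrier T" for h x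
    using that g by (simp add: pr_def single_zero)
  show "pr h (s \<star> x) = s \<star> pr (inv g \<otimes> h) x"
    if h: "h \<in> carrier G" and s: "s \<in> carrier T" "pr g s = s" and x: "x \<in> carrier T" for h s x
  proof -
    have sD: "s g \<in> D g" "s g \<in> carrier R" using s g T_D by auto
    have "pr h (single g (s g) \<star> x) = single g (s g) \<star> pr (inv g \<otimes> h) x"
      using g h x sD by (simp add: pr_def single_mult single_single T_D mult_inv_cancel)
    then show ?thesis using single_pr[OF s] by simp
  qed
  show "pr h (x \<star> s) = pr (h \<otimes> inv g) x \<star> s"
    if h: "h \<in> carrier G" and s: "s \<in> carrier T" "pr g s = s" and x: "x \<in> carrier T" for h s x
  proof -
    have sD: "s g \<in> D g" "s g \<in> carrier R" using s g T_D by auto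
    have "pr h (x \<star> single g (s g)) = pr (h \<otimes> inv g) x \<star> single g (s g)"
      using g h x sD by (simp add: pr_def mult_single single_single T_D m_assoc)
    then show ?thesis using single_pr[OF s] by simp
  qed
  obtain c where c: "c \<in> D (inv g)" "single g (e g) \<star> single (inv g) c = single \<one> (e g)"
    using ex_unit_pair[OF g] by metis
  have "single \<one> (e g) \<star> s = s" if s: "s \<in> carrier T" "pr g s = s" for s
  proof -
    have sD: "s g \<in> D g" "s g \<in> carrier R" using s g T_D by auto
    have "single \<one> (e g) \<star> single g (s g) = single g (s g)"
      using g sD by (simp add: single_single D_one hmult_one_left e_left)
    then show ?thesis using single_pr[OF s] by simp
  qed
  moreover have "s \<star> single \<one> (e g) = s" if s: "s \<in> carrier T" "pr (inv g) s = s" for s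
  proof -
    have ig: "inv g \<in> carrier G" using g by simp
    have sD: "s (inv g) \<in> D (inv g)" "s (inv g) \<in> carrier R" using s ig T_D by auto
    have "single (inv g) (s (inv g)) \<star> single \<one> (e g) = single (inv g) (s (inv g))"
      using g sD by (simp add: single_single D_one hmult_one_right al_e e_one e_right)
    then show ?thesis using single_pr[OF s] by simp
  qed
  ultimately show "\<exists>u \<in> carrier T. \<exists>v \<in> carrier T. pr g u = u \<and> pr (inv g) v = v \<and>
      (\<forall>s \<in> carrier T. pr g s = s \<longrightarrow> u \<star> v \<star> s = s) \<and>
      (\<forall>s \<in> carrier T. pr (inv g) s = s \<longrightarrow> s \<star> (u \<star> v) = s)"
    using g c by (intro bexI[of _ "single g (e g)"] bexI[of _ "single (inv g) c"])
      (auto simp: pr_single single_closed e_D)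
next
  fix x assume x: "x \<in> carrier T"
  have "{g \<in> carrier G. pr g x \<noteq> \<zero>\<^bsub>T\<^esub>} \<subseteq> csupp x"
    by (auto simp: coeff_support_def pr_def single_zero)
  then show "finite {g \<in> carrier G. pr g x \<noteq> \<zero>\<^bsub>T\<^esub>}" using T_finite[OF x] by (rule finite_subset)
  show "x = \<zero>\<^bsub>T\<^esub>" if "\<And>g. g \<in> carrier G \<Longrightarrow> pr g x = \<zero>\<^bsub>T\<^esub>"
  proof (rule T_eqI[OF x T_zero_closed])
    fix g assume g: "g \<in> carrier G"
    have "single g (x g) g = \<zero>\<^bsub>T\<^esub> g" using that[OF g] by (simp add: pr_def)
    then show "x g = \<zero>\<^bsub>T\<^esub> g" using g by simp
  qed
qed

abbreviation Tcomp :: "'g \<Rightarrow> ('g \<Rightarrow> 'a) set" where "Tcomp \<equiv> locally_unital_graded_ring.comp T pr"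

lemma Tcomp_iff: "s \<in> Tcomp g \<longleftrightarrow> s \<in> carrier T \<and> pr g s = s"
  by (simp add: locally_unital_graded_ring.comp_def[OF graded_T])

lemma single_Tcomp: "g \<in> carrier G \<Longrightarrow> r \<in> D g \<Longrightarrow> single g r \<in> Tcomp g"
  by (simp add: Tcomp_iff single_closed pr_single)

lemma single_minus: "r \<in> carrier R \<Longrightarrow> single \<one> (\<ominus>\<^bsub>R\<^esub> r) = \<ominus>\<^bsub>T\<^esub> single \<one> r"
proof -
  interpret TR: ring T by (rule ring_T)
  assume r: "r \<in> carrier R"
  then have "single \<one> (\<ominus>\<^bsub>R\<^esub> r) \<oplus>t single \<one> r = \<zero>\<^bsub>T\<^esub>"
    by (simp add: R.l_neg single_zero flip: single_add)
  then show ?thesis using r single_closed[of \<one>] by (simp add: TR.minus_equality D_one)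
qed

lemma single_mult_one:
  "r \<in> carrier R \<Longrightarrow> s \<in> carrier R \<Longrightarrow> single \<one> (r \<odot> s) = single \<one> r \<star> single \<one> s"
  by (simp add: single_single D_one hmult_one_left)

lemma subgroup_additive:
  assumes "N \<subseteq> carrier R" "\<o> \<in> N" "\<And>x y. x \<in> N \<Longrightarrow> y \<in> N \<Longrightarrow> x \<oplus>r y \<in> N"
    "\<And>x. x \<in> N \<Longrightarrow> \<ominus>\<^bsub>R\<^esub> x \<in> N"
  shows "subgroup N (add_monoid R)"
  using assms by (intro subgroup.intro) (auto simp: a_inv_def)

section \<open>Invariant annihilators and the two implications\<close>

text \<open>Invariance holds because \<open>al g n\<close> is \<open>n\<close> conjugated by the
  pair from \<open>ex_unit_pair\<close>: the left factor of the pair is absorbed into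
  \<open>Q\<close>, after which \<open>n\<close> annihilates.\<close>

lemma right_annihilator:
  assumes Q: "Q \<subseteq> carrier T" and Qs: "\<And>q h s. q \<in> Q \<Longrightarrow> h \<in> carrier G \<Longrightarrow> s \<in> Tcomp h \<Longrightarrow> q \<star> s \<in> Q"
  defines "N \<equiv> {r \<in> carrier R. \<forall>q \<in> Q. q \<star> single \<one> r = \<zero>\<^bsub>T\<^esub>}"
  shows "ideal N R" and "G_invariant G R \<alpha> D N"
proof -
  interpret TR: ring T by (rule ring_T)
  have sT: "r \<in> carrier R \<Longrightarrow> single \<one> r \<in> carrier T" for r by (simp add: single_closed D_one)
  have qT: "q \<in> Q \<Longrightarrow> q \<in> carrier T" for q using Q by blast
  show id: "ideal N R"
  proof (rule idealI[OF R.ring_axioms])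
    show "subgroup N (add_monoid R)"
      by (rule subgroup_additive)
        (auto simp: N_def qT sT single_zero single_add single_minus TR.r_distr TR.r_minus)
    fix r s assume r: "r \<in> N" and s: "s \<in> carrier R"
    have rR: "r \<in> carrier R" using r by (simp add: N_def)
    have "q \<star> single \<one> (s \<odot> r) = \<zero>\<^bsub>T\<^esub>" if q: "q \<in> Q" for q
    proof -
      have "q \<star> single \<one> s \<in> Q" using Qs[OF q one_closed] s by (simp add: single_Tcomp D_one)
      then have "q \<star> single \<one> s \<star> single \<one> r = \<zero>\<^bsub>T\<^esub>" using r by (simp add: N_def)
      then show ?thesis using q s rR by (simp add: single_mult_one TR.m_assoc qT sT)
    qed
    then show "s \<odot> r \<in> N" using s rR by (simp add: N_def)
    have "q \<star> single \<one> (r \<odot> s) = \<zero>\<^bsub>T\<^esub>" if q: "q \<in> Q" for q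
    proof -
      have "q \<star> single \<one> (r \<odot> s) = q \<star> single \<one> r \<star> single \<one> s"
        using q s rR by (simp add: single_mult_one TR.m_assoc qT sT)
      then show ?thesis using r q s by (simp add: N_def sT)
    qed
    then show "r \<odot> s \<in> N" using s rR by (simp add: N_def)
  qed
  show "G_invariant G R \<alpha> D N"
    unfolding G_invariant_def e_def[symmetric]
  proof (intro ballI image_subsetI)
    fix g t assume g: "g \<in> carrier G" and t: "t \<in> N \<cdot>\<^bsub>R\<^esub> {e (inv g)}"
    obtain n where n: "n \<in> N" "t = n \<odot> e (inv g)" using R.ideal_prod_singleton[OF id _ t] g by auto
    have nR: "n \<in> carrier R" using n by (simp add: N_def)
    obtain c where c: "c \<in> D (inv g)"
      and uv: "single g (e g) \<star> single \<one> n \<star> single (inv g) c = single \<one> (al g n)"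
      using ex_unit_pair[OF g] nR by metis
    have cT: "single g (e g) \<in> carrier T" "single (inv g) c \<in> carrier T"
      using g c by (simp_all add: single_closed e_D)
    have "q \<star> single \<one> (al g n) = \<zero>\<^bsub>T\<^esub>" if q: "q \<in> Q" for q
    proof -
      have "q \<star> single g (e g) \<in> Q" using Qs[OF q g] g by (simp add: single_Tcomp e_D)
      then have "q \<star> single g (e g) \<star> single \<one> n \<star> single (inv g) c = \<zero>\<^bsub>T\<^esub>"
        using n cT by (simp add: N_def)
      then show ?thesis using q nR cT by (simp add: TR.m_assoc qT sT flip: uv)
    qed
    then have "al g n \<in> N" using g nR by (simp add: N_def)
    then show "\<alpha> g t \<in> N" by (simp add: n(2) al_def)
  qed
qed

text \<open>Symmetric to the previous lemma, with the right factor of the pair absorbed into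
  \<open>Q\<close>.\<close>

lemma left_annihilator:
  assumes Q: "Q \<subseteq> carrier T" and Qs: "\<And>q h s. q \<in> Q \<Longrightarrow> h \<in> carrier G \<Longrightarrow> s \<in> Tcomp h \<Longrightarrow> s \<star> q \<in> Q"
  defines "N \<equiv> {r \<in> carrier R. \<forall>q \<in> Q. single \<one> r \<star> q = \<zero>\<^bsub>T\<^esub>}"
  shows "ideal N R" and "G_invariant G R \<alpha> D N"
proof -
  interpret TR: ring T by (rule ring_T)
  have sT: "r \<in> carrier R \<Longrightarrow> single \<one> r \<in> carrier T" for r by (simp add: single_closed D_one)
  have qT: "q \<in> Q \<Longrightarrow> q \<in> carrier T" for q using Q by blast
  show id: "ideal N R"
  proof (rule idealI[OF R.ring_axioms])
    show "subgroup N (add_monoid R)"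
      by (rule subgroup_additive)
        (auto simp: N_def qT sT single_zero single_add single_minus TR.l_distr TR.l_minus)
    fix r s assume r: "r \<in> N" and s: "s \<in> carrier R"
    have rR: "r \<in> carrier R" using r by (simp add: N_def)
    have "single \<one> (r \<odot> s) \<star> q = \<zero>\<^bsub>T\<^esub>" if q: "q \<in> Q" for q
    proof -
      have "single \<one> s \<star> q \<in> Q" using Qs[OF q one_closed] s by (simp add: single_Tcomp D_one)
      then have "single \<one> r \<star> (single \<one> s \<star> q) = \<zero>\<^bsub>T\<^esub>" using r by (simp add: N_def)
      then show ?thesis using q s rR by (simp add: single_mult_one TR.m_assoc qT sT)
    qed
    then show "r \<odot> s \<in> N" using s rR by (simp add: N_def)
    have "single \<one> (s \<odot> r) \<star> q = \<zero>\<^bsub>T\<^esub>" if q: "q \<in> Q" for q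
    proof -
      have "single \<one> (s \<odot> r) \<star> q = single \<one> s \<star> (single \<one> r \<star> q)"
        using q s rR by (simp add: single_mult_one TR.m_assoc qT sT)
      then show ?thesis using r q s by (simp add: N_def sT)
    qed
    then show "s \<odot> r \<in> N" using s rR by (simp add: N_def)
  qed
  show "G_invariant G R \<alpha> D N"
    unfolding G_invariant_def e_def[symmetric]
  proof (intro ballI image_subsetI)
    fix g t assume g: "g \<in> carrier G" and t: "t \<in> N \<cdot>\<^bsub>R\<^esub> {e (inv g)}"
    obtain n where n: "n \<in> N" "t = n \<odot> e (inv g)" using R.ideal_prod_singleton[OF id _ t] g by auto
    have nR: "n \<in> carrier R" using n by (simp add: N_def)
    obtain c where c: "c \<in> D (inv g)"
      and uv: "single g (e g) \<star> single \<one> n \<star> single (inv g) c = single \<one> (al g n)"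
      using ex_unit_pair[OF g] nR by metis
    have cT: "single g (e g) \<in> carrier T" "single (inv g) c \<in> carrier T"
      using g c by (simp_all add: single_closed e_D)
    have "single \<one> (al g n) \<star> q = \<zero>\<^bsub>T\<^esub>" if q: "q \<in> Q" for q
    proof -
      have "single (inv g) c \<star> q \<in> Q" using Qs[OF q, of "inv g"] g c by (simp add: single_Tcomp)
      then have "single g (e g) \<star> (single \<one> n \<star> (single (inv g) c \<star> q)) = \<zero>\<^bsub>T\<^esub>"
        using n cT by (simp add: N_def)
      then show ?thesis using q nR cT by (simp add: TR.m_assoc qT sT flip: uv)
    qed
    then have "al g n \<in> N" using g nR by (simp add: N_def)
    then show "\<alpha> g t \<in> N" by (simp add: n(2) al_def)
  qed
qed

text \<open>If I S J = 0, then the coefficients of \<open>J\<close> lie in the invariant ideal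
  \<open>N\<close> annihilated by I S, and those of \<open>I\<close> lie in the invariant ideal
  \<open>L\<close> annihilating S N. Since L N = 0, this contradicts primeness for invariant
  ideals.\<close>

lemma prime_graded_T:
  assumes prime: "G_prime G R \<alpha> D"
  shows "prime_graded_ring G T pr"
proof (intro prime_graded_ring.intro graded_T prime_graded_ring_axioms.intro)
  interpret TR: ring T by (rule ring_T)
  fix I J
  assume I: "locally_unital_graded_ring.eideal G T pr I" "I \<noteq> {\<zero>\<^bsub>T\<^esub>}"
    and J: "locally_unital_graded_ring.eideal G T pr J" "J \<noteq> {\<zero>\<^bsub>T\<^esub>}"
  show "\<exists>h \<in> carrier G. locally_unital_graded_ring.nz T pr I h J"
  proof (rule ccontr)
    assume "\<not> ?thesis"
    then have no: "i \<star> s \<star> j = \<zero>\<^bsub>T\<^esub>" if "h \<in> carrier G" "i \<in> I" "s \<in> Tcomp h" "j \<in> J" for h i s j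
      using that unfolding locally_unital_graded_ring.nz_def[OF graded_T] by blast
    have comp1: "i \<in> carrier T \<and> i = single \<one> (i \<one>) \<and> i \<one> \<in> carrier R" if "i \<in> I \<union> J" for i
    proof -
      have "i \<in> Tcomp \<one>"
        using that locally_unital_graded_ring.eideal_comp[OF graded_T I(1)]
          locally_unital_graded_ring.eideal_comp[OF graded_T J(1)] by blast
      then show ?thesis using single_pr[of i \<one>] by (simp add: Tcomp_iff)
    qed
    have compT: "s \<in> Tcomp h \<Longrightarrow> s \<in> carrier T" for s h by (simp add: Tcomp_iff)
    have cm: "s \<star> t \<in> Tcomp (g \<otimes> h)" if "s \<in> Tcomp g" "t \<in> Tcomp h" "g \<in> carrier G" "h \<in> carrier G" for s t g h
      using locally_unital_graded_ring.comp_mult[OF graded_T that refl] .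
    have sT: "r \<in> carrier R \<Longrightarrow> single \<one> r \<in> carrier T" for r by (simp add: single_closed D_one)
    define Q where "Q = {i \<star> s | i s h. i \<in> I \<and> h \<in> carrier G \<and> s \<in> Tcomp h}"
    have Q: "Q \<subseteq> carrier T" using comp1 compT by (auto simp: Q_def)
    have Qs: "q \<star> t \<in> Q" if q: "q \<in> Q" and t: "g \<in> carrier G" "t \<in> Tcomp g" for q g t
    proof -
      obtain i s h where isx: "i \<in> I" "h \<in> carrier G" "s \<in> Tcomp h" "q = i \<star> s" using q by (auto simp: Q_def)
      have "q \<star> t = i \<star> (s \<star> t)" using isx t comp1 compT by (simp add: TR.m_assoc)
      then show ?thesis using isx t cm[OF isx(3) t(2) isx(2) t(1)] unfolding Q_def by blast
    qed
    define N where "N = {r \<in> carrier R. \<forall>q \<in> Q. q \<star> single \<one> r = \<zero>\<^bsub>T\<^esub>}"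
    have N: "ideal N R" "G_invariant G R \<alpha> D N"
      unfolding N_def by (rule right_annihilator[OF Q Qs]; assumption)+
    \<comment> \<open>\<open>P\<close> is built from the whole of \<open>N\<close>, not just from
      \<open>J\<close>, so that \<open>L\<close> annihilates \<open>N\<close> itself.\<close>
    define P where "P = {s \<star> single \<one> n | s n h. n \<in> N \<and> h \<in> carrier G \<and> s \<in> Tcomp h}"
    have P: "P \<subseteq> carrier T" using compT sT by (auto simp: P_def N_def)
    have Ps: "t \<star> q \<in> P" if q: "q \<in> P" and t: "g \<in> carrier G" "t \<in> Tcomp g" for q g t
    proof -
      obtain s n h where isx: "n \<in> N" "h \<in> carrier G" "s \<in> Tcomp h" "q = s \<star> single \<one> n" using q by (auto simp: P_def)
      have "t \<star> q = t \<star> s \<star> single \<one> n" using isx t compT sT by (simp add: TR.m_assoc N_def)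
      then show ?thesis using isx t cm[OF t(2) isx(3) t(1) isx(2)] unfolding P_def by blast
    qed
    define L where "L = {r \<in> carrier R. \<forall>q \<in> P. single \<one> r \<star> q = \<zero>\<^bsub>T\<^esub>}"
    have L: "ideal L R" "G_invariant G R \<alpha> D L"
      unfolding L_def by (rule left_annihilator[OF P Ps]; assumption)+
    have zero: "\<o> \<in> L" "\<o> \<in> N"
      using additive_subgroup.zero_closed[OF ideal.axioms(1)] N L by auto
    have "l \<odot> n = \<o>" if ln: "l \<in> L" "n \<in> N" for l n
    proof -
      have c: "l \<in> carrier R" "n \<in> carrier R" using ln by (auto simp: L_def N_def)
      have "single \<one> \<one>\<^bsub>R\<^esub> \<star> single \<one> n \<in> P"
        using ln single_Tcomp[OF one_closed one_D] unfolding P_def by blast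
      then have "single \<one> l \<star> (single \<one> \<one>\<^bsub>R\<^esub> \<star> single \<one> n) = \<zero>\<^bsub>T\<^esub>" using ln by (simp add: L_def)
      then have "single \<one> (l \<odot> n) = \<zero>\<^bsub>T\<^esub>" using c by (simp flip: single_mult_one)
      then have "single \<one> (l \<odot> n) \<one> = \<zero>\<^bsub>T\<^esub> \<one>" by simp
      then show ?thesis by simp
    qed
    then have "L \<cdot>\<^bsub>R\<^esub> N = {\<o>}" using zero by (simp add: R.ideal_prod_eq_zero_iff)
    then have "L = {\<o>} \<or> N = {\<o>}" using prime L N unfolding G_prime_def by blast
    moreover have "N \<noteq> {\<o>}"
    proof -
      obtain j where j: "j \<in> J" "j \<noteq> \<zero>\<^bsub>T\<^esub>"
        using J locally_unital_graded_ring.eideal_nonzero[OF graded_T J(1)] by blast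
      have js: "single \<one> (j \<one>) = j" "j \<one> \<in> carrier R" using comp1 j by auto
      have "j \<one> \<in> N" using js j no by (auto simp: N_def Q_def)
      moreover have "j \<one> \<noteq> \<o>" using js j single_zero[of \<one>] by metis
      ultimately show ?thesis by blast
    qed
    moreover have "L \<noteq> {\<o>}"
    proof -
      obtain i where i: "i \<in> I" "i \<noteq> \<zero>\<^bsub>T\<^esub>"
        using I locally_unital_graded_ring.eideal_nonzero[OF graded_T I(1)] by blast
      have isx: "single \<one> (i \<one>) = i" "i \<one> \<in> carrier R" "i \<in> carrier T" using comp1 i by auto
      have "i \<star> (s \<star> single \<one> n) = \<zero>\<^bsub>T\<^esub>" if "n \<in> N" "h \<in> carrier G" "s \<in> Tcomp h" for n h s
      proof -
        have "i \<star> s \<star> single \<one> n = \<zero>\<^bsub>T\<^esub>" using that i by (auto simp: N_def Q_def)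
        then show ?thesis using that isx compT sT by (simp add: TR.m_assoc N_def)
      qed
      then have "i \<one> \<in> L" using isx by (auto simp: L_def P_def)
      moreover have "i \<one> \<noteq> \<o>" using isx i single_zero[of \<one>] by metis
      ultimately show ?thesis by blast
    qed
    ultimately show False by blast
  qed
qed

lemma prime_imp_G_prime:
  assumes prime: "prime_ring T"
  shows "G_prime G R \<alpha> D"
  unfolding G_prime_def
proof (intro allI impI, elim conjE)
  interpret TR: ring T by (rule ring_T)
  define E where "E I = {x \<in> carrier T. \<forall>g \<in> carrier G. x g \<in> I}" for I
  have al_inv: "al g i \<in> I" if "G_invariant G R \<alpha> D I" "g \<in> carrier G" "i \<in> I" for g i I
  proof -
    have "i \<odot> e (inv g) \<in> I \<cdot>\<^bsub>R\<^esub> {e (inv g)}" using that by (intro ideal_prod.prod) auto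
    then show ?thesis using that unfolding G_invariant_def al_def e_def[symmetric] by blast
  qed
  have sG: "csupp x \<subseteq> carrier G" for x by (auto simp: coeff_support_def)
  \<comment> \<open>Coefficients of a product lie in an ideal as soon as all products of homogeneous
    parts do. This is applied to \<open>I\<close> and, for the vanishing of products, to the zero
    ideal.\<close>
  have mult_in: "(x \<star> y) k \<in> I" if I: "ideal I R" and x: "x \<in> carrier T" and y: "y \<in> carrier T"
    and k: "k \<in> carrier G"
    and m: "\<And>g h. g \<in> carrier G \<Longrightarrow> h \<in> carrier G \<Longrightarrow> hmult g h (x g) (y h) \<in> I" for x y I k
  proof -
    have "finsum R (\<lambda>g. hmult g (inv g \<otimes> k) (x g) (y (inv g \<otimes> k))) (csupp x) \<in> I"
      using m sG[of x] k by (intro R.finsum_in_ideal[OF I]) auto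
    then show ?thesis using T_mult[OF x y k T_finite[OF x] subset_refl sG] by simp
  qed
  have E_ideal: "ideal (E I) T" if I: "ideal I R" and inv: "G_invariant G R \<alpha> D I" for I
  proof (rule idealI[OF TR.ring_axioms])
    have z: "\<o> \<in> I" and a: "\<And>r s. r \<in> I \<Longrightarrow> s \<in> I \<Longrightarrow> r \<oplus>r s \<in> I" and n: "\<And>r. r \<in> I \<Longrightarrow> \<ominus>\<^bsub>R\<^esub> r \<in> I"
      using additive_subgroup.zero_closed[OF ideal.axioms(1)[OF I]]
        additive_subgroup.a_closed[OF ideal.axioms(1)[OF I]]
        additive_subgroup.a_inv_closed[OF ideal.axioms(1)[OF I]] by auto
    have neg: "(\<ominus>\<^bsub>T\<^esub> x) g = \<ominus>\<^bsub>R\<^esub> x g" if x: "x \<in> carrier T" and g: "g \<in> carrier G" for x g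
    proof -
      have "(\<ominus>\<^bsub>T\<^esub> x \<oplus>t x) g = \<o>" using x g by (simp add: TR.l_neg)
      then have "(\<ominus>\<^bsub>T\<^esub> x) g \<oplus>r x g = \<o>" using g by (simp add: T_add)
      then show ?thesis using x g by (simp add: R.minus_equality)
    qed
    show "subgroup (E I) (add_monoid T)"
    proof (rule subgroup.intro)
      show "E I \<subseteq> carrier (add_monoid T)" by (auto simp: E_def)
      show "x \<otimes>\<^bsub>add_monoid T\<^esub> y \<in> E I" if "x \<in> E I" "y \<in> E I" for x y
        using that a by (simp add: E_def T_add T_add_closed)
      show "\<one>\<^bsub>add_monoid T\<^esub> \<in> E I" using z by (simp add: E_def T_zero_closed)
      show "inv\<^bsub>add_monoid T\<^esub> x \<in> E I" if "x \<in> E I" for x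
        unfolding a_inv_def[symmetric] using that n neg by (simp add: E_def)
    qed
    fix a x assume a: "a \<in> E I" and x: "x \<in> carrier T"
    have aT: "a \<in> carrier T" and aI: "\<And>g. g \<in> carrier G \<Longrightarrow> a g \<in> I" using a by (auto simp: E_def)
    \<comment> \<open>Multiplying from the left applies \<open>al g\<close> to the coefficients of
      \<open>a\<close>; here invariance of \<open>I\<close> is needed.\<close>
    have "hmult g h (x g) (a h) \<in> I" if "g \<in> carrier G" "h \<in> carrier G" for g h
      unfolding hmult_def using that x al_inv[OF inv _ aI]
      by (intro ideal.I_r_closed[OF I] ideal.I_l_closed[OF I]) auto
    then show "x \<star> a \<in> E I" using mult_in[OF I x aT] x aT by (auto simp: E_def T_mult_closed)
    have "hmult g h (a g) (x h) \<in> I" if "g \<in> carrier G" "h \<in> carrier G" for g h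
      unfolding hmult_def using that x aI by (intro ideal.I_r_closed[OF I]) auto
    then show "a \<star> x \<in> E I" using mult_in[OF I aT x] x aT by (auto simp: E_def T_mult_closed)
  qed
  have E_zero: "I = {\<o>}" if I: "ideal I R" and E0: "E I = {\<zero>\<^bsub>T\<^esub>}" for I
  proof -
    have z: "\<o> \<in> I" using additive_subgroup.zero_closed[OF ideal.axioms(1)[OF I]] .
    have "i = \<o>" if i: "i \<in> I" for i
    proof -
      have iR: "i \<in> carrier R" using i ideal.Icarr[OF I] by blast
      then have "single \<one> i \<in> E I" using i z by (simp add: E_def single_closed D_one)
      then have "single \<one> i \<one> = \<zero>\<^bsub>T\<^esub> \<one>" using E0 by simp
      then show ?thesis by simp
    qed
    then show ?thesis using z by blast
  qed
  fix I J
  assume I: "ideal I R" "G_invariant G R \<alpha> D I" and J: "ideal J R" "G_invariant G R \<alpha> D J"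
    and IJ: "I \<cdot>\<^bsub>R\<^esub> J = {\<o>}"
  have prod0: "i \<odot> j = \<o>" if "i \<in> I" "j \<in> J" for i j
    using IJ ideal_prod.prod[OF that, of R] by simp
  have "x \<star> y = \<zero>\<^bsub>T\<^esub>" if x: "x \<in> E I" and y: "y \<in> E J" for x y
  proof -
    have xT: "x \<in> carrier T" and yT: "y \<in> carrier T" using x y by (auto simp: E_def)
    have "hmult g h (x g) (y h) \<in> {\<o>}" if gh: "g \<in> carrier G" "h \<in> carrier G" for g h
    proof -
      \<comment> \<open>By invariance of \<open>J\<close>, the factor \<open>al g (y h)\<close> is
        again in \<open>J\<close>, so the product lies in I J.\<close>
      have "x g \<odot> al g (y h) = \<o>" using x y gh al_inv[OF J(2)] by (intro prod0) (auto simp: E_def)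
      then show ?thesis using gh by (simp add: hmult_def)
    qed
    then have "(x \<star> y) k = \<o>" if "k \<in> carrier G" for k
      using mult_in[OF R.zeroideal xT yT that] by blast
    then show ?thesis using xT yT by (intro T_eqI) (auto simp: T_mult_closed T_zero_closed)
  qed
  moreover have "\<zero>\<^bsub>T\<^esub> \<in> E I" "\<zero>\<^bsub>T\<^esub> \<in> E J"
    using E_ideal[OF I] E_ideal[OF J] additive_subgroup.zero_closed[OF ideal.axioms(1)] by blast+
  ultimately have "E I \<cdot>\<^bsub>T\<^esub> E J = {\<zero>\<^bsub>T\<^esub>}" by (simp add: TR.ideal_prod_eq_zero_iff)
  then have "E I = {\<zero>\<^bsub>T\<^esub>} \<or> E J = {\<zero>\<^bsub>T\<^esub>}"
    using prime E_ideal[OF I] E_ideal[OF J] unfolding prime_ring_def by blast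
  then show "I = {\<o>} \<or> J = {\<o>}" using E_zero I J by blast
qed

lemma G_prime_imp_prime:
  assumes tf: "torsion_free G" and prime: "G_prime G R \<alpha> D"
  shows "prime_ring T"
  unfolding prime_ring_def
proof (intro conjI allI impI ring_T)
  interpret TR: ring T by (rule ring_T)
  have "\<one>\<^bsub>T\<^esub> \<one> \<noteq> \<zero>\<^bsub>T\<^esub> \<one>" using one_not_zero by (simp add: T_one)
  then have "\<one>\<^bsub>T\<^esub> \<noteq> \<zero>\<^bsub>T\<^esub>" by metis
  then show "{\<zero>\<^bsub>T\<^esub>} \<noteq> carrier T" using TR.one_closed by blast
  fix A B assume AB: "ideal A T \<and> ideal B T \<and> A \<cdot>\<^bsub>T\<^esub> B = {\<zero>\<^bsub>T\<^esub>}"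
  then have "\<forall>a \<in> A. \<forall>b \<in> B. a \<star> b = \<zero>\<^bsub>T\<^esub>"
    using ideal_prod.prod[of _ A _ B T] by auto
  then show "A = {\<zero>\<^bsub>T\<^esub>} \<or> B = {\<zero>\<^bsub>T\<^esub>}"
    using prime_graded_ring.ideal_product_nonzero[OF prime_graded_T[OF prime] tf, of A B] AB by blast
qed

end

theorem theorem13p9:
  fixes G :: "('g, 'c) monoid_scheme" and R :: "('a, 'b) ring_scheme"
    and \<alpha> :: "'g \<Rightarrow> 'a \<Rightarrow> 'a" and D :: "'g \<Rightarrow> 'a set" and w :: "'g \<Rightarrow> 'g \<Rightarrow> 'a"
  assumes "torsion_free_group G"
    and "unital_twisted_partial_action G R \<alpha> D w"
  shows "prime_ring (partial_crossed_product G R \<alpha> D w) \<longleftrightarrow> G_prime G R \<alpha> D"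
proof -
  interpret unital_twisted_partial_action G R \<alpha> D w by fact
  have "torsion_free G"
    using assms(1) by (auto simp: torsion_free_group_def torsion_free_def)
  then show ?thesis
    using prime_imp_G_prime G_prime_imp_prime unfolding T_def by blast
qed

end
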